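(* For each of the following five combinations of integers $n_0$, $c$ and further restrictions, the following holds: for every even integer $n \ge n_0$ there exists a planar $3$-connected $n$-vertex graph $G$ with exactly $c$ perfect matchings that satisfies the stated restrictions. (i) $n_0 = 10$, $c = 12$, and $G$ has four vertices of degree $4$ and $n-4$ vertices of degree $3$. (ii) $n_0 = 14$, $c = 18$, and $G$ has two vertices of degree $5$ and $n-2$ vertices of degree $3$. (iii) $n_0 = 10$, $c = 12$, and $G$ is a triangulation. (iv) $n_0 = 22$, $c = 144$, and $G$ is bipartite and has eight vertices of degree $4$ and $n-8$ vertices of degree $3$. (v) $n_0 = 24$, $c = 768$, and $G$ is a triangulation with minimum degree $4$.
   Context: All graphs are finite and simple. A planar graph is a triangulation if it has at least four vertices and the addition of any edge (between two non-adjacent vertices) renders it non-planar. *)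

theory Defs
  imports "HOL-Analysis.Analysis"
begin

text \<open>A graph is given by its vertex set \<open>V\<close> and its edge set \<open>E\<close>, an edge being the
  two-element set of its endpoints.\<close>

definition simple_graph :: "'a set \<Rightarrow> 'a set set \<Rightarrow> bool" where
  "simple_graph V E \<longleftrightarrow> finite V \<and> (\<forall>e\<in>E. e \<subseteq> V \<and> card e = 2)"

definition vdegree :: "'a set set \<Rightarrow> 'a \<Rightarrow> nat" where
  "vdegree E v = card {e \<in> E. v \<in> e}"

definition min_degree :: "'a set \<Rightarrow> 'a set set \<Rightarrow> nat" where
  "min_degree V E = Min (vdegree E ` V)"

definition connected_graph :: "'a set \<Rightarrow> 'a set set \<Rightarrow> bool" where
  "connected_graph V E \<longleftrightarrow> V \<noteq> {} \<and> (\<forall>u\<in>V. \<forall>v\<in>V. (u, v) \<in> {(x, y). {x, y} \<in> E}\<^sup>*)"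

definition k_connected :: "nat \<Rightarrow> 'a set \<Rightarrow> 'a set set \<Rightarrow> bool" where
  "k_connected k V E \<longleftrightarrow> card V > k \<and>
     (\<forall>S\<subseteq>V. card S < k \<longrightarrow> connected_graph (V - S) {e \<in> E. e \<inter> S = {}})"

definition bipartite_graph :: "'a set \<Rightarrow> 'a set set \<Rightarrow> bool" where
  "bipartite_graph V E \<longleftrightarrow>
     (\<exists>A B. A \<union> B = V \<and> A \<inter> B = {} \<and> (\<forall>e\<in>E. \<exists>a\<in>A. \<exists>b\<in>B. e = {a, b}))"

definition perfect_matching :: "'a set \<Rightarrow> 'a set set \<Rightarrow> 'a set set \<Rightarrow> bool" where
  "perfect_matching V E M \<longleftrightarrow> M \<subseteq> E \<and> (\<forall>v\<in>V. \<exists>!e. e \<in> M \<and> v \<in> e)"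

definition num_perfect_matchings :: "'a set \<Rightarrow> 'a set set \<Rightarrow> nat" where
  "num_perfect_matchings V E = card {M. perfect_matching V E M}"

text \<open>Drawings in the plane, which is taken to be \<^typ>\<open>complex\<close> as in the library's Jordan
  curve theorem. Edges are drawn as arbitrary (injective, continuous) arcs.\<close>

definition plane_drawing ::
    "'a set \<Rightarrow> 'a set set \<Rightarrow> ('a \<Rightarrow> complex) \<Rightarrow> ('a set \<Rightarrow> real \<Rightarrow> complex) \<Rightarrow> bool" where
  "plane_drawing V E p \<gamma> \<longleftrightarrow>
     inj_on p V \<and>
     (\<forall>e\<in>E. arc (\<gamma> e) \<and> {pathstart (\<gamma> e), pathfinish (\<gamma> e)} = p ` e \<and>
            path_image (\<gamma> e) \<inter> p ` V = p ` e) \<and>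
     (\<forall>e\<in>E. \<forall>f\<in>E. e \<noteq> f \<longrightarrow> path_image (\<gamma> e) \<inter> path_image (\<gamma> f) = p ` (e \<inter> f))"

definition planar_graph :: "'a set \<Rightarrow> 'a set set \<Rightarrow> bool" where
  "planar_graph V E \<longleftrightarrow> simple_graph V E \<and> (\<exists>p \<gamma>. plane_drawing V E p \<gamma>)"

definition planar_triangulation :: "'a set \<Rightarrow> 'a set set \<Rightarrow> bool" where
  "planar_triangulation V E \<longleftrightarrow> planar_graph V E \<and> card V \<ge> 4 \<and>
     (\<forall>u\<in>V. \<forall>v\<in>V. u \<noteq> v \<and> {u, v} \<notin> E \<longrightarrow> \<not> planar_graph V (insert {u, v} E))"

end

theory Submission
  imports Defs "HOL-Library.Code_Binary_Nat"
begin

text \<open>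
  Let \<open>A, B, u, i, j\<close> be vertices and add five vertices adjacent to the triples \<open>ABj, Aij, Bij, Aui, Bui\<close>.
  This planar bipartite graph has exactly 12 perfect matchings. All initial graphs but those of (ii)
  are built around it; each is checked by computation. Since no perfect matching can use an edge
  inside a tight barrier, arbitrarily long strips can be attached whose matching is forced: either a
  path of vertices all adjacent to the same two vertices is lengthened by two, or a rung is inserted
  into a ladder. Both steps preserve three-connectedness and the number of perfect matchings (a rung
  exchanges two matching numbers \<open>P\<close> and \<open>Q\<close>).

  Planarity is carried along as a straight-line drawing with some empty triangles, in which both steps
  are stellar subdivisions of edges. A triangulation is maximal planar because a plane drawing of a
  bridgeless connected graph has at most \<open>3n - 6\<close> edges; the number of faces is counted by drawing the
  edges one after the other, using the Jordan curve theorem and Janiszewski's theorem.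
\<close>

section \<open>Faces of a plane drawing\<close>

text \<open>Deleting \<open>A, B, u, i, j\<close> isolates the other five vertices, so a perfect
  matching pairs these two sets, and edges among the first five can be added without changing the
  count 12: they serve to adjust degrees or to complete a triangulation. Lengthening a path makes
  the degrees of \<open>A\<close> and \<open>B\<close> grow, which only the triangulations tolerate;
  where degrees are prescribed, a rung adds two cubic vertices and leaves all other degrees alone.
  The number 144 is 12 * 12: two copies are joined so that the colour classes force which vertex of
  each copy is matched outwards. The number 768 is 12 * 2^6: each of six vertices of degree three
  becomes a triangle that sends exactly one matching edge outwards and offers two ends for it. The
  topology is needed because planarity allows arbitrary arcs: straight lines suffice to show that a
  graph is planar, but maximality has to exclude every drawing with one more edge.\<close>

text \<open>Everything added lies inside the one face \<open>U\<close>, so every other face stays in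
  the complement and remains a maximal connected set.\<close>

lemma components_refine:
  fixes K K' :: "'a::topological_space set"
  assumes "K \<subseteq> K'" "K' - K \<subseteq> U" "U \<in> components (- K)"
  shows "components (- K') = components (- K) - {U} \<union> {W \<in> components (- K'). W \<subseteq> U}"
proof (intro equalityI subsetI)
  fix W assume W: "W \<in> components (- K')"
  have "W \<subseteq> - K" using in_components_subset[OF W] assms(1) by blast
  moreover have "W \<noteq> {}" using W in_components_nonempty by blast
  ultimately obtain C where C: "C \<in> components (- K)" "W \<subseteq> C"
    using exists_component_superset[of W "- K"] in_components_connected[OF W] by blast
  show "W \<in> components (- K) - {U} \<union> {W \<in> components (- K'). W \<subseteq> U}"
  proof (cases "C = U")
    case False
    then have "C \<inter> U = {}" using components_nonoverlap[OF C(1) assms(3)] by blast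
    then have "C \<subseteq> - K'" using assms(2) in_components_subset[OF C(1)] by blast
    then have "C \<subseteq> W"
      using components_maximal[OF W in_components_connected[OF C(1)]] C(2) \<open>W \<noteq> {}\<close> by blast
    then have "W = C" using C by blast
    then show ?thesis using C False by blast
  qed (use C W in blast)
next
  fix W assume W: "W \<in> components (- K) - {U} \<union> {W \<in> components (- K'). W \<subseteq> U}"
  show "W \<in> components (- K')"
  proof (cases "W \<in> components (- K) - {U}")
    case True
    then have "W \<inter> U = {}" using components_nonoverlap[of W "-K" U] assms(3) by blast
    then have "W \<subseteq> - K'" using assms(2) in_components_subset[of W "-K"] True by blast
    then show ?thesis
      using components_intermediate_subset[of W "-K" "-K'"] True assms(1) by blast
  qed (use W in blast)
qed

text \<open>An arc within \<open>K\<close> closes \<open>g\<close> to a Jordan curve, whose two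
  sides cut \<open>U\<close> into \<open>U1\<close> and \<open>U2\<close>. Both parts are nonempty
  because each side has the whole curve as its frontier, and connected by Janiszewski's theorem
  because \<open>K\<close> meets the curve exactly in the closing arc. Path-connectedness of
  \<open>K\<close> provides that arc.\<close>

lemma components_chord:
  fixes K :: "complex set"
  assumes K: "compact K" "path_connected K"
    and g: "arc g" "path_image g \<inter> K = {pathstart g, pathfinish g}"
  obtains U U1 U2 where "U \<in> components (- K)" "path_image g - {pathstart g, pathfinish g} \<subseteq> U"
    "U1 \<noteq> U2"
    "components (- (K \<union> path_image g)) = components (- K) - {U} \<union> {U1, U2}"
    "U1 \<notin> components (- K) - {U}" "U2 \<notin> components (- K) - {U}"
proof -
  define a b where a_def: "a = pathstart g" and b_def: "b = pathfinish g"
  note a_b_def = a_def b_def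
  have ab: "a \<noteq> b" using arc_distinct_ends[OF g(1)] a_b_def by simp
  have abK: "a \<in> K" "b \<in> K" using g(2) a_b_def by auto
  obtain q where q: "arc q" "path_image q \<subseteq> K" "pathstart q = b" "pathfinish q = a"
    using K(2)[unfolded path_connected_arcwise] ab[symmetric] abK by blast
  define c where "c = g +++ q"
  have int: "path_image g \<inter> path_image q = {a, b}"
    using q g(2) a_b_def pathstart_in_path_image[of q] pathfinish_in_path_image[of q] by auto
  have c: "simple_path c" "pathfinish c = pathstart c" 
    unfolding c_def using simple_path_join_loop_eq[of q g] q g int a_b_def by auto
  have J: "path_image c = path_image g \<union> path_image q"
    unfolding c_def by (rule path_image_join) (use q a_b_def in auto)
  define C1 C2 where "C1 = inside (path_image c)" and "C2 = outside (path_image c)"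
  have jc: "open C1" "connected C1" "open C2" "connected C2" "C1 \<inter> C2 = {}"
    "C1 \<union> C2 = - path_image c" "frontier C1 = path_image c" "frontier C2 = path_image c"
    using Jordan_inside_outside[OF c] unfolding C1_def C2_def by auto
  define g' where "g' = path_image g - {a, b}"
  have g': "connected g'" "g' \<noteq> {}"
    unfolding g'_def a_b_def
    using connected_simple_path_endless nonempty_simple_path_endless arc_imp_simple_path[OF g(1)] by auto
  have "g' \<subseteq> - K" using g(2) unfolding g'_def a_b_def by blast
  then obtain U where U: "U \<in> components (- K)" "g' \<subseteq> U"
    using exists_component_superset[of g' "-K"] g' by blast
  have cl: "closed K" using K by (simp add: compact_imp_closed)
  have opU: "open U" by (rule open_components[OF open_Compl[OF cl] U(1)])
  have UK: "U \<inter> K = {}" using in_components_subset[OF U(1)] by blast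
  have KJ: "K \<union> path_image c = K \<union> path_image g" using q(2) J by blast
  have piece: "U \<inter> C \<noteq> {} \<and> U \<inter> C \<in> components (- (K \<union> path_image g))"
    if C: "C \<in> {C1, C2}" for C
  proof -
    have oC: "open C" "connected C" "C \<subseteq> - path_image c" "frontier C = path_image c" using jc C by auto
    have ne: "U \<inter> C \<noteq> {}"
    proof -
      obtain x where x: "x \<in> g'" using g'(2) by auto
      then have "x \<in> frontier C" using oC J g'_def by auto
      then have "x \<in> closure C" by (simp add: frontier_def)
      then show ?thesis using opU U(2) x by (metis Int_commute open_Int_closure_eq_empty disjoint_iff subset_iff)
    qed
    have sub: "U \<inter> C \<subseteq> - (K \<union> path_image g)" using UK oC J by blast
    have cc: "connected_component (- (K \<union> path_image g)) x y" if xy: "x \<in> U \<inter> C" "y \<in> U \<inter> C" for x y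
    proof -
      have "connected_component (- (K \<union> path_image c)) x y"
      proof (rule Janiszewski)
        show "closed (path_image c)" by (rule closed_simple_path_image[OF c(1)])
        have "K \<inter> path_image c = path_image q"
          using J q(2) int g(2) a_b_def pathstart_in_path_image[of q] pathfinish_in_path_image[of q] q(3,4) by blast
        then show "connected (K \<inter> path_image c)" by (simp add: connected_arc_image q(1))
        show "connected_component (- K) x y"
          unfolding connected_component_def using xy in_components_connected[OF U(1)] in_components_subset[OF U(1)] by blast
        show "connected_component (- path_image c) x y"
          unfolding connected_component_def using xy oC by blast
      qed (use K in auto)
      then show ?thesis using KJ by simp
    qed
    obtain x where x: "x \<in> U \<inter> C" using ne by blast
    define W where "W = connected_component_set (- (K \<union> path_image g)) x"
    have xx: "x \<in> - (K \<union> path_image g)" using sub x by blast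
    have W: "W \<in> components (- (K \<union> path_image g))" unfolding W_def by (rule componentsI[OF xx])
    have xW: "x \<in> W" unfolding W_def using xx connected_component_refl by simp
    have "U \<inter> C \<subseteq> W" unfolding W_def using cc x by blast
    moreover have "W \<subseteq> U"
      using components_maximal[OF U(1) in_components_connected[OF W]] in_components_subset[OF W] x xW by blast
    moreover have "W \<subseteq> C"
    proof -
      have "W \<subseteq> C1 \<union> C2" using in_components_subset[OF W] jc KJ by blast
      moreover have "C1 \<inter> W = {} \<or> C2 \<inter> W = {}"
        using connectedD[OF in_components_connected[OF W] jc(1,3)] calculation jc(5) by blast
      ultimately show ?thesis using C x xW by blast
    qed
    ultimately have "W = U \<inter> C" by blast
    then show ?thesis using W ne by simp
  qed
  have all: "W \<in> {U \<inter> C1, U \<inter> C2}" if W: "W \<in> components (- (K \<union> path_image g))" "W \<subseteq> U" for W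
  proof -
    obtain x where x: "x \<in> W" using W in_components_nonempty by blast
    then have "x \<in> C1 \<union> C2" using in_components_subset[OF W(1)] jc KJ by blast
    then have "W \<inter> (U \<inter> C1) \<noteq> {} \<or> W \<inter> (U \<inter> C2) \<noteq> {}" using x W(2) by blast
    then show ?thesis using components_eq[OF W(1)] piece by (metis insertCI)
  qed
  have eq: "{W \<in> components (- (K \<union> path_image g)). W \<subseteq> U} = {U \<inter> C1, U \<inter> C2}"
    using all piece by blast
  have ref: "components (- (K \<union> path_image g)) = components (- K) - {U} \<union> {U \<inter> C1, U \<inter> C2}"
    unfolding eq[symmetric] by (rule components_refine[OF _ _ U(1)]) (use U(2) abK g'_def in auto)
  \<comment> \<open>A nonempty part of \<open>U\<close> differs from every other face; this is what
    lets the faces be counted later.\<close>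
  have nc: "U \<inter> C \<notin> components (- K) - {U}" if "U \<inter> C \<noteq> {}" for C
    using components_nonoverlap[OF U(1), of "U \<inter> C"] that by blast
  have "U \<inter> C1 \<noteq> U \<inter> C2" using piece jc(5) by blast
  from that[OF U(1) _ this ref] show thesis using U piece nc g'_def a_b_def by auto
qed

text \<open>Here \<open>K\<close> and the arc share a single point, so Janiszewski's theorem keeps
  \<open>U\<close> connected after the arc is removed from it, and the number of faces does not
  change.\<close>

lemma components_pendant:
  fixes K :: "complex set"
  assumes K: "compact K" and g: "arc g" "path_image g \<inter> K = {pathstart g}"
  obtains U W where "U \<in> components (- K)" "W \<notin> components (- K) - {U}"
    "components (- (K \<union> path_image g)) = insert W (components (- K) - {U})"
proof -
  define a where "a = pathstart g"
  define g' where "g' = path_image g - {a}"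
  have inj: "inj_on g {0..1}" and cont: "continuous_on {0..1} g" using g(1) by (auto simp: arc_def path_def)
  have "g' = g ` {0<..1}"
  proof -
    have "g ` {0<..1} = g ` ({0..1} - {0})" by (rule arg_cong[of _ _ "(`) g"]) auto
    also have "\<dots> = g ` {0..1} - g ` {0}" by (rule inj_on_image_set_diff[OF inj]) auto
    finally show ?thesis by (simp add: g'_def a_def path_image_def pathstart_def)
  qed
  moreover have "connected (g ` {0<..1})"
    by (rule connected_continuous_image) (auto intro: continuous_on_subset[OF cont])
  ultimately have g': "connected g'" "g' \<noteq> {}" by auto
  have "g' \<subseteq> - K" using g(2) unfolding g'_def a_def by blast
  then obtain U where U: "U \<in> components (- K)" "g' \<subseteq> U"
    using exists_component_superset[of g' "-K"] g' by blast
  have cl: "closed K" using K by (simp add: compact_imp_closed)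
  have UK: "U \<inter> K = {}" using in_components_subset[OF U(1)] by blast
  have aK: "a \<in> K" using g(2) a_def by auto
  have Une: "U \<noteq> {}" by (rule in_components_nonempty[OF U(1)])
  \<comment> \<open>If the arc filled \<open>U\<close>, the frontier of \<open>U\<close> would lie
    in \<open>{a}\<close>; but the plane without \<open>a\<close> is connected, meets
    \<open>U\<close> and is too large to lie in the bounded set \<open>U\<close>.\<close>
  have ne: "U - path_image g \<noteq> {}"
  proof
    assume "U - path_image g = {}"
    then have Ug: "U \<subseteq> path_image g" by blast
    have clg: "closed (path_image g)" "bounded (path_image g)" by (simp_all add: closed_arc_image bounded_arc_image g(1))
    have "frontier U \<subseteq> K" using frontier_of_components_closed_complement[OF cl U(1)] .
    moreover have "frontier U \<subseteq> path_image g"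
      using Ug clg by (metis closure_minimal frontier_def Diff_subset subset_trans)
    ultimately have fr: "frontier U \<subseteq> {a}" using g(2) a_def by auto
    have "connected (- {a})" by (rule connected_punctured_universe) simp
    moreover have "- {a} \<inter> U \<noteq> {}" using Une UK aK by blast
    moreover have "- {a} - U \<noteq> {}"
    proof
      assume "- {a} - U = {}"
      then have "UNIV \<subseteq> insert a U" by blast
      moreover have "bounded (insert a U)" using Ug clg bounded_subset by auto
      ultimately show False using not_bounded_UNIV bounded_subset by blast
    qed
    ultimately show False using connected_Int_frontier[of "- {a}" U] fr by blast
  qed
  define W where "W = U - path_image g"
  have sub: "W \<subseteq> - (K \<union> path_image g)" using UK W_def by blast
  have cc: "connected_component (- (K \<union> path_image g)) x y" if xy: "x \<in> W" "y \<in> W" for x y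
  proof (rule Janiszewski)
    show "closed (path_image g)" by (rule closed_arc_image[OF g(1)])
    show "connected (K \<inter> path_image g)" using g(2) by (simp add: Int_commute)
    show "connected_component (- K) x y"
      unfolding connected_component_def using xy in_components_connected[OF U(1)] in_components_subset[OF U(1)] W_def by blast
    show "connected_component (- path_image g) x y"
      unfolding connected_component_def using xy W_def connected_arc_complement[OF g(1)]
      by (intro exI[of _ "- path_image g"]) auto
  qed (use K in auto)
  have "{W' \<in> components (- (K \<union> path_image g)). W' \<subseteq> U} = {W}"
  proof -
    have "connected W"
    proof (rule connectedI)
      fix A B assume AB: "open A" "open B" "A \<inter> W \<noteq> {}" "B \<inter> W \<noteq> {}" "A \<inter> B \<inter> W = {}" "W \<subseteq> A \<union> B"
      obtain x y where "x \<in> A \<inter> W" "y \<in> B \<inter> W" using AB by blast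
      then obtain T where T: "connected T" "T \<subseteq> - (K \<union> path_image g)" "x \<in> T" "y \<in> T"
        using cc[of x y] unfolding connected_component_def by blast
      have "T \<subseteq> U" using components_maximal[OF U(1) T(1)] T \<open>x \<in> A \<inter> W\<close> W_def by blast
      then have "T \<subseteq> W" using T W_def by blast
      then show False using connectedD[OF T(1) AB(1,2)] AB T \<open>x \<in> A \<inter> W\<close> \<open>y \<in> B \<inter> W\<close> by blast
    qed
    then have *: "W \<subseteq> W'" if "W' \<in> components (- (K \<union> path_image g))" "W' \<inter> W \<noteq> {}" for W'
      using components_maximal[OF that(1) _ sub that(2)] by blast
    have **: "W' = W" if "W' \<in> components (- (K \<union> path_image g))" "W' \<subseteq> U" for W'
    proof -
      have "W' \<subseteq> W" using that in_components_subset[OF that(1)] W_def by blast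
      then show ?thesis using * that in_components_nonempty[OF that(1)] by blast
    qed
    obtain C where C: "C \<in> components (- (K \<union> path_image g))" "W \<subseteq> C"
      using exists_component_superset[OF sub _ \<open>connected W\<close>] ne sub W_def by blast
    have "C \<subseteq> U"
      using components_maximal[OF U(1) in_components_connected[OF C(1)]] in_components_subset[OF C(1)] C(2) ne W_def by blast
    then show ?thesis using C ** by blast
  qed
  then have "components (- (K \<union> path_image g)) = insert W (components (- K) - {U})"
    using components_refine[of K "K \<union> path_image g" U, OF _ _ U(1)] U(2) aK g'_def by auto
  moreover have "W \<notin> components (- K) - {U}"
    using components_nonoverlap[OF U(1), of W] ne W_def by blast
  ultimately show thesis using that U(1) by blast
qed

section \<open>Euler's formula for connected plane drawings\<close>

definition drawn :: "('a \<Rightarrow> complex) \<Rightarrow> ('a set \<Rightarrow> real \<Rightarrow> complex) \<Rightarrow> 'a set \<Rightarrow> 'a set set \<Rightarrow> complex set" where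
  "drawn p \<gamma> V E = p ` V \<union> (\<Union>e\<in>E. path_image (\<gamma> e))"

lemma simple_graph_finite_edges: "simple_graph V E \<Longrightarrow> finite E"
  by (rule finite_subset[of _ "Pow V"]) (auto simp: simple_graph_def)

lemma connected_graph_crossing:
  assumes "connected_graph V E" "V' \<subseteq> V" "V' \<noteq> {}" "V' \<noteq> V"
  obtains u v where "{u, v} \<in> E" "u \<in> V'" "v \<notin> V'"
proof -
  obtain a b where ab: "a \<in> V'" "b \<in> V" "b \<notin> V'" using assms by blast
  have r: "(a, b) \<in> {(x, y). {x, y} \<in> E}\<^sup>*" using assms ab by (auto simp: connected_graph_def)
  have "\<exists>u v. {u, v} \<in> E \<and> u \<in> V' \<and> v \<notin> V'"
  proof (rule ccontr)
    assume no: "\<nexists>u v. {u, v} \<in> E \<and> u \<in> V' \<and> v \<notin> V'"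
    from r have "b \<in> V'" by (induction rule: rtrancl_induct) (use ab no in auto)
    then show False using ab by blast
  qed
  then show thesis using that by blast
qed

context
  fixes V :: "'a set" and E p \<gamma>
  assumes simple: "simple_graph V E" and pd: "plane_drawing V E p \<gamma>"
begin

lemma inj_points: "inj_on p V" and arc_edge: "e \<in> E \<Longrightarrow> arc (\<gamma> e)"
  and ends_edge: "e \<in> E \<Longrightarrow> {pathstart (\<gamma> e), pathfinish (\<gamma> e)} = p ` e"
  and edge_points: "e \<in> E \<Longrightarrow> path_image (\<gamma> e) \<inter> p ` V = p ` e"
  and edge_edge: "e \<in> E \<Longrightarrow> f \<in> E \<Longrightarrow> e \<noteq> f \<Longrightarrow> path_image (\<gamma> e) \<inter> path_image (\<gamma> f) = p ` (e \<inter> f)"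
  using pd unfolding plane_drawing_def by auto

lemma edge_in_V: "e \<in> E \<Longrightarrow> e \<subseteq> V"
  using simple by (auto simp: simple_graph_def)

lemma compact_drawn: "V' \<subseteq> V \<Longrightarrow> E' \<subseteq> E \<Longrightarrow> compact (drawn p \<gamma> V' E')"
  unfolding drawn_def using simple simple_graph_finite_edges[OF simple] arc_edge
  by (intro compact_Un compact_UN finite_imp_compact compact_arc_image finite_imageI)
     (auto simp: simple_graph_def intro: finite_subset)

lemma edge_Int_drawn:
  assumes "V' \<subseteq> V" "E' \<subseteq> E" "e \<in> E - E'" "\<And>f. f \<in> E' \<Longrightarrow> f \<subseteq> V'"
  shows "path_image (\<gamma> e) \<inter> drawn p \<gamma> V' E' = p ` (e \<inter> V')"
proof -
  have e: "e \<in> E" "e \<subseteq> V" using assms edge_in_V by auto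
  have "path_image (\<gamma> e) \<inter> p ` V' = p ` e \<inter> p ` V'"
    using edge_points[OF e(1)] assms(1) by blast
  also have "\<dots> = p ` (e \<inter> V')"
    using inj_on_image_Int[OF inj_points e(2) assms(1)] by simp
  finally have 1: "path_image (\<gamma> e) \<inter> p ` V' = p ` (e \<inter> V')" .
  have 2: "path_image (\<gamma> e) \<inter> path_image (\<gamma> f) \<subseteq> p ` (e \<inter> V')" if "f \<in> E'" for f
  proof -
    have "path_image (\<gamma> e) \<inter> path_image (\<gamma> f) = p ` (e \<inter> f)"
      using edge_edge[OF e(1), of f] that assms by blast
    then show ?thesis using assms(4)[OF that] by blast
  qed
  show ?thesis unfolding drawn_def using 1 2 by blast
qed

lemma drawn_insert: "drawn p \<gamma> V' (insert e E') = drawn p \<gamma> V' E' \<union> path_image (\<gamma> e)"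
  unfolding drawn_def by blast

lemma drawn_insert_vertex:
  "e \<in> E \<Longrightarrow> v \<in> e \<Longrightarrow> drawn p \<gamma> (insert v V') (insert e E') = drawn p \<gamma> V' E' \<union> path_image (\<gamma> e)"
  unfolding drawn_def using edge_points[of e] edge_in_V[of e] by blast

text \<open>A connected part is grown edge by edge. A new edge meets the part in one vertex or in
  two: a pendant edge adds a vertex and no face, a chord adds a face and no vertex, so faces plus
  vertices minus edges stays 2. Path-connectedness is carried along for the sake of
  \<open>components_chord\<close>.\<close>

lemma euler_partial:
  assumes conn: "connected_graph V E"
  shows "k \<le> card E \<Longrightarrow> \<exists>V' E'. V' \<subseteq> V \<and> V' \<noteq> {} \<and> E' \<subseteq> E \<and> (\<forall>f\<in>E'. f \<subseteq> V') \<and> card E' = k \<and>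
    path_connected (drawn p \<gamma> V' E') \<and> finite (components (- drawn p \<gamma> V' E')) \<and>
    card (components (- drawn p \<gamma> V' E')) + card V' = card E' + 2"
proof (induction k)
  case 0
  obtain v where v: "v \<in> V" using conn by (auto simp: connected_graph_def)
  have d: "drawn p \<gamma> {v} {} = {p v}" by (simp add: drawn_def)
  have "connected (- {p v})" by (rule connected_punctured_universe) simp
  moreover have "- {p v} \<noteq> {}" using infinite_UNIV_char_0[where 'a=complex]
    by (metis Compl_empty_eq double_complement finite.emptyI finite_insert)
  ultimately have "components (- {p v}) = {- {p v}}" by (metis connected_eq_components_subset_sing connected_eq_connected_components_eq components_eq_sing_iff)
  then show ?case using v d by (intro exI[of _ "{v}"] exI[of _ "{}"]) auto
next
  case (Suc k)
  then obtain V' E' where *: "V' \<subseteq> V" "V' \<noteq> {}" "E' \<subseteq> E" "\<forall>f\<in>E'. f \<subseteq> V'" "card E' = k"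
    "path_connected (drawn p \<gamma> V' E')" "finite (components (- drawn p \<gamma> V' E'))"
    "card (components (- drawn p \<gamma> V' E')) + card V' = card E' + 2" by auto
  have fin: "finite E" "finite V" using simple_graph_finite_edges[OF simple] simple by (auto simp: simple_graph_def)
  have fin': "finite E'" "finite V'" using *(1,3) fin by (auto intro: finite_subset)
  define K where "K = drawn p \<gamma> V' E'"
  have K: "compact K" "path_connected K" unfolding K_def using compact_drawn * by auto
  have "E' \<noteq> E" using * Suc.prems by auto
  then have "\<exists>e\<in>E - E'. e \<inter> V' \<noteq> {}"
  proof (cases "V' = V")
    case True
    obtain e where e: "e \<in> E - E'" using * \<open>E' \<noteq> E\<close> by blast
    then have "e \<subseteq> V" "card e = 2" using simple by (auto simp: simple_graph_def)
    then have "e \<subseteq> V" "e \<noteq> {}" by auto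
    then show ?thesis using e True by blast
  next
    case False
    then obtain u v where "{u, v} \<in> E" "u \<in> V'" "v \<notin> V'" using connected_graph_crossing[OF conn *(1,2)] by metis
    then show ?thesis using *(4) by (intro bexI[of _ "{u, v}"]) auto
  qed
  then obtain e where e: "e \<in> E - E'" "e \<inter> V' \<noteq> {}" by blast
  then obtain u v where uv: "e = {u, v}" "u \<noteq> v" "u \<in> V'" "u \<in> V" "v \<in> V"
  proof -
    have "e \<subseteq> V" "card e = 2" using simple e by (auto simp: simple_graph_def)
    moreover obtain u where u: "u \<in> e \<inter> V'" using e(2) by blast
    moreover obtain v where "e = {u, v}" "u \<noteq> v"
      using \<open>card e = 2\<close> u unfolding card_2_iff by fastforce
    ultimately show thesis using that[of u v] by auto
  qed
  have eE: "e \<in> E" using e by blast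
  have int: "path_image (\<gamma> e) \<inter> K = p ` (e \<inter> V')"
    unfolding K_def by (rule edge_Int_drawn) (use * e in auto)
  have arc: "arc (\<gamma> e)" by (rule arc_edge[OF eE])
  have pcg: "path_connected (path_image (\<gamma> e))" using arc by (simp add: arc_imp_path path_connected_path_image)
  have pcu: "path_connected (K \<union> path_image (\<gamma> e))"
    by (rule path_connected_Un[OF K(2) pcg]) (use int uv in auto)
  have ce: "card (insert e E') = Suc k" using e fin' * by auto
  show ?case
  proof (cases "v \<in> V'")
    case True
    then have "e \<inter> V' = e" using uv by blast
    then have gK: "path_image (\<gamma> e) \<inter> K = {pathstart (\<gamma> e), pathfinish (\<gamma> e)}" using int ends_edge eE by simp
    obtain U U1 U2 where U: "U \<in> components (- K)" "U1 \<noteq> U2"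
      "components (- (K \<union> path_image (\<gamma> e))) = components (- K) - {U} \<union> {U1, U2}"
      "U1 \<notin> components (- K) - {U}" "U2 \<notin> components (- K) - {U}"
      by (rule components_chord[OF K arc gK]) (rule that; assumption)
    have finK: "finite (components (- K))" using *(7) K_def by simp
    have "card (components (- K) - {U} \<union> {U1, U2}) = card (components (- K) - {U}) + 2"
      by (subst card_Un_disjoint) (use U finK in auto)
    also have "\<dots> = Suc (card (components (- K)))"
      using card_Suc_Diff1[OF finK U(1)] by simp
    finally have c: "card (components (- (K \<union> path_image (\<gamma> e)))) = Suc (card (components (- K)))" using U(3) by simp
    show ?thesis
      by (intro exI[of _ V'] exI[of _ "insert e E'"]) 
         (use * e eE ce c pcu uv True U(3) finK in \<open>auto simp: drawn_insert K_def[symmetric]\<close>)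
  next
    case False
    then have "e \<inter> V' = {u}" using uv by blast
    then have gu: "path_image (\<gamma> e) \<inter> K = {p u}" using int by simp
    have "{pathstart (\<gamma> e), pathfinish (\<gamma> e)} = {p u, p v}" using ends_edge[OF eE] uv by simp
    then consider "pathstart (\<gamma> e) = p u" | "pathfinish (\<gamma> e) = p u" by (metis doubleton_eq_iff)
    \<comment> \<open>The arc of \<open>e\<close> may run towards the part; reversed if necessary,
      it starts there.\<close>
    then obtain g where g: "arc g" "path_image g = path_image (\<gamma> e)" "pathstart g = p u"
    proof cases
      case 1 then show ?thesis using that arc by blast
    next
      case 2 then show ?thesis using that[of "reversepath (\<gamma> e)"] arc by (simp add: arc_reversepath)
    qed
    have gK: "path_image g \<inter> K = {pathstart g}" using g gu by simp
    obtain U W where U: "U \<in> components (- K)" "W \<notin> components (- K) - {U}"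
      "components (- (K \<union> path_image g)) = insert W (components (- K) - {U})"
      by (rule components_pendant[OF K(1) g(1) gK]) (rule that; assumption)
    have finK: "finite (components (- K))" using *(7) K_def by simp
    have c: "card (components (- (K \<union> path_image g))) = card (components (- K))"
      using U finK by (metis card_insert_disjoint card_Suc_Diff1 finite_Diff)
    have dr: "drawn p \<gamma> (insert v V') (insert e E') = K \<union> path_image g"
      using drawn_insert_vertex[OF eE, of v V' E'] uv g K_def by simp
    show ?thesis
    proof (intro exI[of _ "insert v V'"] exI[of _ "insert e E'"] conjI ballI)
      show "f \<subseteq> insert v V'" if "f \<in> insert e E'" for f using that *(4) uv by auto
      show "path_connected (drawn p \<gamma> (insert v V') (insert e E'))" unfolding dr g(2) by (rule pcu)
      show "finite (components (- drawn p \<gamma> (insert v V') (insert e E')))" unfolding dr U(3) using finK by simp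
      have "card (insert v V') = Suc (card V')" using fin'(2) False by simp
      then show "card (components (- drawn p \<gamma> (insert v V') (insert e E'))) + card (insert v V') = card (insert e E') + 2"
        unfolding dr c ce using *(5,8) K_def by simp
    qed (use *(1,3) eE uv ce in auto)
  qed
qed

lemma euler_formula:
  assumes conn: "connected_graph V E"
  shows "path_connected (drawn p \<gamma> V E)" "finite (components (- drawn p \<gamma> V E))"
    "card (components (- drawn p \<gamma> V E)) + card V = card E + 2"
proof -
  obtain V' E' where *: "V' \<subseteq> V" "V' \<noteq> {}" "E' \<subseteq> E" "\<forall>f\<in>E'. f \<subseteq> V'" "card E' = card E"
    "path_connected (drawn p \<gamma> V' E')" "finite (components (- drawn p \<gamma> V' E'))"
    "card (components (- drawn p \<gamma> V' E')) + card V' = card E' + 2"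
    using euler_partial[OF conn order_refl] by blast
  have E: "E' = E" using * simple_graph_finite_edges[OF simple] by (simp add: card_subset_eq)
  have V: "V' = V"
  proof (rule ccontr)
    assume "V' \<noteq> V"
    then obtain u v where "{u, v} \<in> E" "u \<in> V'" "v \<notin> V'" using connected_graph_crossing[OF conn *(1,2)] by metis
    then show False using *(4) E by auto
  qed
  show "path_connected (drawn p \<gamma> V E)" "finite (components (- drawn p \<gamma> V E))"
    "card (components (- drawn p \<gamma> V E)) + card V = card E + 2" using * E V by auto
qed

end

section \<open>The bound 3n - 6 by counting incidences of faces and edges\<close>

context
  fixes V :: "'a set" and E p \<gamma>
  assumes simple: "simple_graph V E" and pd: "plane_drawing V E p \<gamma>"
begin

lemma interior_edge_disjoint:
  assumes "e \<in> E"
  shows "(path_image (\<gamma> e) - p ` e) \<inter> p ` V = {}"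
    "f \<in> E \<Longrightarrow> f \<noteq> e \<Longrightarrow> (path_image (\<gamma> e) - p ` e) \<inter> path_image (\<gamma> f) = {}"
  using edge_points[OF simple pd assms] edge_edge[OF simple pd assms, of f] by blast+

text \<open>Without \<open>e\<close> the drawing is still connected, so \<open>e\<close> is a chord
  of one face \<open>U\<close> and splits it in two. The open set \<open>U\<close> contains the
  interior of \<open>e\<close> and misses the closures of all other faces.\<close>

lemma edge_two_faces:
  assumes e: "e \<in> E" and conn: "connected_graph V (E - {e})"
  shows "card {W \<in> components (- drawn p \<gamma> V E). frontier W \<inter> (path_image (\<gamma> e) - p ` e) \<noteq> {}} \<le> 2"
proof -
  define K where "K = drawn p \<gamma> V (E - {e})"
  define g where "g = \<gamma> e"
  have "simple_graph V (E - {e})" using simple by (auto simp: simple_graph_def)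
  moreover have "plane_drawing V (E - {e}) p \<gamma>" using pd unfolding plane_drawing_def by blast
  ultimately have pc: "path_connected K" unfolding K_def
    using euler_formula(1) conn by blast
  have K: "compact K" unfolding K_def by (rule compact_drawn[OF simple pd]) auto
  have int: "path_image g \<inter> K = p ` (e \<inter> V)"
    unfolding K_def g_def by (rule edge_Int_drawn[OF simple pd]) (use e edge_in_V[OF simple pd] in auto)
  moreover have "e \<inter> V = e" using edge_in_V[OF simple pd e] by blast
  ultimately have gK: "path_image g \<inter> K = {pathstart g, pathfinish g}" using ends_edge[OF simple pd e] g_def by simp
  have dr: "drawn p \<gamma> V E = K \<union> path_image g"
    using drawn_insert[OF simple pd, of V e "E - {e}"] e K_def g_def by (simp add: insert_absorb)
  have arc: "arc g" using arc_edge[OF simple pd e] g_def by simp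
  obtain U U1 U2 where U: "U \<in> components (- K)" "path_image g - {pathstart g, pathfinish g} \<subseteq> U"
      "components (- (K \<union> path_image g)) = components (- K) - {U} \<union> {U1, U2}"
    by (rule components_chord[OF K pc arc gK]) (rule that; assumption)
  have "{W \<in> components (- drawn p \<gamma> V E). frontier W \<inter> (path_image (\<gamma> e) - p ` e) \<noteq> {}} \<subseteq> {U1, U2}"
  proof
    fix W assume W: "W \<in> {W \<in> components (- drawn p \<gamma> V E). frontier W \<inter> (path_image (\<gamma> e) - p ` e) \<noteq> {}}"
    show "W \<in> {U1, U2}"
    proof (rule ccontr)
      assume "W \<notin> {U1, U2}"
      then have W': "W \<in> components (- K)" "W \<noteq> U" using W U(3) dr by auto
      then have "W \<inter> U = {}" using components_nonoverlap[OF W'(1) U(1)] by blast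
      moreover have "open U" by (rule open_components[OF open_Compl U(1)]) (use K compact_imp_closed in blast)
      ultimately have "closure W \<inter> U = {}" by (metis open_Int_closure_eq_empty Int_commute)
      moreover have "frontier W \<subseteq> closure W" by (simp add: frontier_def)
      moreover have "path_image (\<gamma> e) - p ` e \<subseteq> U" using U(2) ends_edge[OF simple pd e] g_def by simp
      ultimately show False using W by blast
    qed
  qed
  then have "card {W \<in> components (- drawn p \<gamma> V E). frontier W \<inter> (path_image (\<gamma> e) - p ` e) \<noteq> {}} \<le> card {U1, U2}"
    by (rule card_mono[rotated]) simp
  also have "\<dots> \<le> 2" by (simp add: card_insert_if)
  finally show ?thesis .
qed

text \<open>Two edges meet in at most one point, so by Janiszewski's theorem they do not separate the plane.\<close>

lemma face_three_edges:
  assumes E3: "card E \<ge> 3" and W: "W \<in> components (- drawn p \<gamma> V E)"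
  shows "card {e \<in> E. frontier W \<inter> (path_image (\<gamma> e) - p ` e) \<noteq> {}} \<ge> 3"
proof (rule ccontr)
  define I where "I = {e \<in> E. frontier W \<inter> (path_image (\<gamma> e) - p ` e) \<noteq> {}}"
  assume "\<not> 3 \<le> card {e \<in> E. frontier W \<inter> (path_image (\<gamma> e) - p ` e) \<noteq> {}}"
  then have I2: "card I < 3" by (simp add: I_def)
  have finE: "finite E" using simple_graph_finite_edges[OF simple] .
  have IE: "I \<subseteq> E" "finite I" using finE by (auto simp: I_def)
  have cl: "closed (drawn p \<gamma> V E)" using compact_drawn[OF simple pd] compact_imp_closed by blast
  define D where "D = p ` V \<union> (\<Union>e\<in>I. path_image (\<gamma> e))"
  have frD: "frontier W \<subseteq> D"
  proof
    fix x assume x: "x \<in> frontier W"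
    then have "x \<in> drawn p \<gamma> V E" using frontier_of_components_closed_complement[OF cl W] by blast
    then consider "x \<in> p ` V" | e where "e \<in> E" "x \<in> path_image (\<gamma> e)" "x \<notin> p ` V" unfolding drawn_def by blast
    then show "x \<in> D"
    proof cases
      case 2
      then have "x \<in> path_image (\<gamma> e) - p ` e" using edge_in_V[OF simple pd] by blast
      then have "e \<in> I" using x 2 I_def by blast
      then show ?thesis using 2 D_def by blast
    qed (simp add: D_def)
  qed
  have con1: "connected (- (\<Union>e\<in>I. path_image (\<gamma> e)))"
  proof -
    have "card I = 0 \<or> card I = 1 \<or> card I = 2" using I2 by auto
    then consider "I = {}" | e where "I = {e}" | e f where "I = {e, f}" "e \<noteq> f"
      using IE(2) by (auto simp: card_1_singleton_iff card_2_iff)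
    then show ?thesis
    proof cases
      case 1 then show ?thesis by (simp add: connected_UNIV)
    next
      case (2 e)
      then show ?thesis using connected_arc_complement[OF arc_edge[OF simple pd]] IE by auto
    next
      case (3 e f)
      then have ef: "e \<in> E" "f \<in> E" using IE by auto
      have "card (e \<inter> f) \<le> 1"
      proof (rule ccontr)
        assume "\<not> card (e \<inter> f) \<le> 1"
        moreover have "card e = 2" "card f = 2" "finite e" "finite f" 
          using simple ef by (auto simp: simple_graph_def intro: card_ge_0_finite)
        ultimately have "e \<inter> f = e" "e \<inter> f = f" by (intro card_seteq; simp)+
        then show False using 3 by blast
      qed
      moreover have "finite (e \<inter> f)" using simple ef by (auto simp: simple_graph_def intro: finite_subset)
      ultimately have "e \<inter> f = {} \<or> (\<exists>x. e \<inter> f = {x})" by (metis One_nat_def card_0_eq card_1_singletonE le_Suc_eq le_zero_eq)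
      then have "connected (p ` (e \<inter> f))" by auto
      then have "connected (path_image (\<gamma> e) \<inter> path_image (\<gamma> f))" using edge_edge[OF simple pd ef 3(2)] by simp
      then have "connected (- (path_image (\<gamma> e) \<union> path_image (\<gamma> f)))"
        by (intro Janiszewski_connected compact_arc_image closed_arc_image connected_arc_complement arc_edge[OF simple pd] ef) auto
      then show ?thesis using 3 by simp
    qed
  qed
  have con: "connected (- D)"
  proof -
    have "closed (\<Union>e\<in>I. path_image (\<gamma> e))"
      using IE by (intro closed_UN) (auto intro: closed_arc_image arc_edge[OF simple pd])
    then have "connected (- (\<Union>e\<in>I. path_image (\<gamma> e)) - p ` V)"
      using simple by (intro connected_open_delete_finite con1 open_Compl) (auto simp: simple_graph_def)
    moreover have "- D = - (\<Union>e\<in>I. path_image (\<gamma> e)) - p ` V" unfolding D_def by blast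
    ultimately show ?thesis by simp
  qed
  have DK: "D \<subseteq> drawn p \<gamma> V E" using IE unfolding D_def drawn_def by blast
  \<comment> \<open>The set \<open>- D\<close> is connected, meets \<open>W\<close> and misses its
    frontier, so it lies in \<open>W\<close>. Then the vertices and at most two edges cover the
    whole drawing, although there is a third edge.\<close>
  have "- D \<subseteq> W"
  proof (rule ccontr)
    assume "\<not> - D \<subseteq> W"
    moreover have "- D \<inter> W \<noteq> {}" using DK in_components_subset[OF W] in_components_nonempty[OF W] by blast
    ultimately have "- D \<inter> frontier W \<noteq> {}" using connected_Int_frontier[OF con, of W] by blast
    then show False using frD by blast
  qed
  then have KD: "drawn p \<gamma> V E \<subseteq> D" using in_components_subset[OF W] by blast
  have "\<not> E \<subseteq> I" using card_mono[OF IE(2)] I2 E3 by (metis le_trans not_le)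
  then obtain h where h: "h \<in> E" "h \<notin> I" by blast
  have "path_image (\<gamma> h) - p ` h \<noteq> {}"
    using nonempty_simple_path_endless[OF arc_imp_simple_path[OF arc_edge[OF simple pd h(1)]]] ends_edge[OF simple pd h(1)] by simp
  then obtain x where x: "x \<in> path_image (\<gamma> h) - p ` h" by blast
  then have "x \<in> D" using KD h unfolding drawn_def by blast
  then show False using interior_edge_disjoint[OF h(1)] x h(2) IE(1) unfolding D_def by blast
qed

text \<open>Each face has at least three edges on its frontier and each edge lies on at most two
  faces, as no edge is a bridge. Hence 3F \<le> 2E, and F + V = E + 2 gives the bound.\<close>

lemma planar_edge_bound_drawing:
  assumes E3: "card E \<ge> 3" and conn: "connected_graph V E" and conn': "\<And>e. e \<in> E \<Longrightarrow> connected_graph V (E - {e})"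
  shows "card E + 6 \<le> 3 * card V"
proof -
  define F where "F = components (- drawn p \<gamma> V E)"
  define R where "R = (\<lambda>W e. frontier W \<inter> (path_image (\<gamma> e) - p ` e) \<noteq> {})"
  have fin: "finite E" "finite F" using simple_graph_finite_edges[OF simple] euler_formula[OF simple pd conn] F_def by auto
  have "3 * card F = (\<Sum>W\<in>F. 3)" by simp
  also have "\<dots> \<le> (\<Sum>W\<in>F. card {e \<in> E. R W e})"
    by (rule sum_mono) (use face_three_edges[OF E3] in \<open>simp add: F_def R_def\<close>)
  also have "\<dots> = (\<Sum>e\<in>E. card {W \<in> F. R W e})"
    by (rule sum_multicount_gen) (use fin in auto)
  also have "\<dots> \<le> (\<Sum>e\<in>E. 2)"
    by (rule sum_mono) (use edge_two_faces conn' in \<open>simp add: F_def R_def\<close>)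
  finally have "3 * card F \<le> 2 * card E" by simp
  then show ?thesis using euler_formula(3)[OF simple pd conn] unfolding F_def by linarith
qed

end

section \<open>Three-connectedness\<close>

definition reach :: "'a set set \<Rightarrow> 'a \<Rightarrow> 'a \<Rightarrow> bool" where
  "reach E u v \<longleftrightarrow> (u, v) \<in> {(x, y). {x, y} \<in> E}\<^sup>*"

lemma reach_refl [simp]: "reach E u u" and reach_edge: "{u, v} \<in> E \<Longrightarrow> reach E u v"
  and reach_trans: "reach E u v \<Longrightarrow> reach E v w \<Longrightarrow> reach E u w"
  by (auto simp: reach_def)

lemma reach_sym: "reach E u v \<Longrightarrow> reach E v u"
  unfolding reach_def
  by (metis (no_types, lifting) case_prodI2 case_prod_conv insert_commute mem_Collect_eq sym_def sym_rtrancl)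

lemma connected_graph_reach:
  "connected_graph V E \<longleftrightarrow> V \<noteq> {} \<and> (\<forall>u\<in>V. \<forall>v\<in>V. reach E u v)"
  by (simp add: connected_graph_def reach_def)

lemma reach_transfer:
  assumes "reach F u v" "\<And>p q. {p, q} \<in> F \<Longrightarrow> reach F' p q"
  shows "reach F' u v"
  using assms(1) unfolding reach_def[of F]
  by (induction rule: rtrancl_induct) (auto intro: reach_trans assms(2))

text \<open>Suited to local changes of a graph: each old edge only has to be replaced by a walk in
  the new graph, and each new vertex only has to be joined to an old one.\<close>

lemma connected_graph_transfer:
  assumes "connected_graph W F" "W \<subseteq> W'" "\<And>p q. {p, q} \<in> F \<Longrightarrow> reach F' p q"
    "\<And>v. v \<in> W' - W \<Longrightarrow> \<exists>w\<in>W. reach F' v w"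
  shows "connected_graph W' F'"
proof -
  have W: "reach F' u v" if "u \<in> W" "v \<in> W" for u v
    using that assms(1,3) reach_transfer connected_graph_reach by metis
  have *: "\<exists>w\<in>W. reach F' v w" if "v \<in> W'" for v
    using that assms(4) by (cases "v \<in> W") (auto intro: bexI[of _ v])
  have "reach F' u v" if uv: "u \<in> W'" "v \<in> W'" for u v
  proof -
    obtain u' v' where "u' \<in> W" "reach F' u u'" "v' \<in> W" "reach F' v v'" using * uv by meson
    then show ?thesis using W reach_trans reach_sym by metis
  qed
  then show ?thesis using assms(1,2) by (auto simp: connected_graph_reach)
qed

lemma card_avoid:
  assumes "card S < card T" "finite S"
  shows "\<exists>t\<in>T. t \<notin> S"
  using assms card_mono by (metis subsetI leD)

section \<open>Edge deletions and the two insertions in a three-connected graph\<close>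

context
  fixes V :: "'a set" and E
  assumes simple: "simple_graph V E" and k3: "k_connected 3 V E"
begin

lemma fin_V: "finite V" and edge_V: "e \<in> E \<Longrightarrow> e \<subseteq> V" and edge_2: "e \<in> E \<Longrightarrow> card e = 2"
  using simple by (auto simp: simple_graph_def)

lemma no_loop: "{v, v} \<notin> E" "{v} \<notin> E"
  using edge_2[of "{v}"] by auto

lemma delete_connected:
  "S \<subseteq> V \<Longrightarrow> card S < 3 \<Longrightarrow> connected_graph (V - S) {e \<in> E. e \<inter> S = {}}"
  using k3 by (simp add: k_connected_def)

text \<open>Deleting \<open>S\<close> leaves \<open>v\<close> and at least one further vertex in a
  connected graph, so \<open>v\<close> keeps a neighbour. In particular all degrees are at least
  three.\<close>

lemma third_neighbour:
  assumes "v \<in> V" "S \<subseteq> V" "card S < 3" "v \<notin> S"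
  obtains u where "{v, u} \<in> E" "u \<in> V" "u \<notin> S" "u \<noteq> v"
proof -
  have "finite S" using fin_V assms finite_subset by blast
  then have "card (insert v S) < card V" "finite (insert v S)"
    using assms k3 by (auto simp: k_connected_def)
  then obtain w where w: "w \<in> V" "w \<notin> insert v S" using card_avoid by blast
  have "reach {e \<in> E. e \<inter> S = {}} v w"
    using delete_connected[OF assms(2,3)] w assms by (auto simp: connected_graph_reach)
  then obtain u where u: "{v, u} \<in> E" "{v, u} \<inter> S = {}"
    unfolding reach_def using w by (auto elim: converse_rtranclE)
  moreover have "u \<noteq> v" using no_loop u by auto
  moreover have "u \<in> V" using edge_V u by blast
  ultimately show thesis using that by blast
qed

text \<open>Deleting an edge is no worse than deleting its end \<open>b\<close>, for which the bound
  on \<open>S\<close> leaves room; \<open>b\<close> is then attached again by an edge avoiding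
  \<open>S\<close> and \<open>a\<close>.\<close>

lemma delete_edge_connected:
  assumes S: "S \<subseteq> V" "card S < 2" and f: "{a, b} \<in> E"
  shows "connected_graph (V - S) {e \<in> E - {{a, b}}. e \<inter> S = {}}"
proof (cases "{a, b} \<inter> S = {}")
  case False
  then have "{e \<in> E - {{a, b}}. e \<inter> S = {}} = {e \<in> E. e \<inter> S = {}}" by blast
  then show ?thesis using delete_connected S by simp
next
  case True
  have ab: "a \<in> V" "b \<in> V" "a \<noteq> b" using edge_V f no_loop by auto
  have fS: "finite S" using S fin_V finite_subset by blast
  have cS: "card (insert t S) < 3" for t using S fS by (simp add: card_insert_if)
  have "connected_graph (V - insert b S) {e \<in> E. e \<inter> insert b S = {}}"
    by (rule delete_connected) (use ab S cS in auto)
  then show ?thesis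
  proof (rule connected_graph_transfer)
    show "reach {e \<in> E - {{a, b}}. e \<inter> S = {}} p q" if "{p, q} \<in> {e \<in> E. e \<inter> insert b S = {}}" for p q
      using that by (intro reach_edge) auto
    fix v assume "v \<in> V - S - (V - insert b S)"
    then have v: "v = b" by blast
    obtain u where u: "{b, u} \<in> E" "u \<in> V" "u \<notin> insert a S" "u \<noteq> b"
      using third_neighbour[of b "insert a S"] ab S cS True by auto
    then have "{b, u} \<in> {e \<in> E - {{a, b}}. e \<inter> S = {}}" using True by (auto simp: doubleton_eq_iff)
    then show "\<exists>w\<in>V - insert b S. reach {e \<in> E - {{a, b}}. e \<inter> S = {}} v w"
      using u v reach_edge[of b u] by (intro bexI[of _ u]) auto
  qed auto
qed

text \<open>One end of each edge is deleted instead of the edge; \<open>a\<close> and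
  \<open>c\<close> are then attached again by other edges, which exist because every vertex has at
  least three neighbours.\<close>

lemma delete_two_edges_connected:
  assumes "{a, b} \<in> E" "{c, d} \<in> E" "distinct [a, b, c, d]"
  shows "connected_graph V (E - {{a, b}, {c, d}})"
proof -
  have in_V: "a \<in> V" "b \<in> V" "c \<in> V" "d \<in> V" using edge_V assms by auto
  have "connected_graph (V - {a, c}) {e \<in> E. e \<inter> {a, c} = {}}"
    by (rule delete_connected) (use in_V in \<open>auto simp: card_insert_if\<close>)
  then show ?thesis
  proof (rule connected_graph_transfer)
    show "reach (E - {{a, b}, {c, d}}) p q" if "{p, q} \<in> {e \<in> E. e \<inter> {a, c} = {}}" for p q
      using that by (intro reach_edge) auto
    fix v assume "v \<in> V - (V - {a, c})"
    then consider "v = a" | "v = c" by blast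
    then show "\<exists>w\<in>V - {a, c}. reach (E - {{a, b}, {c, d}}) v w"
    proof cases
      case 1
      obtain u where u: "{a, u} \<in> E" "u \<in> V" "u \<notin> {b, c}" "u \<noteq> a"
        by (rule third_neighbour[of a "{b, c}"]) (use in_V assms in \<open>auto simp: card_insert_if\<close>)
      then have "{a, u} \<noteq> {a, b}" "{a, u} \<noteq> {c, d}" using assms(3) by (auto simp: doubleton_eq_iff)
      then have "{a, u} \<in> E - {{a, b}, {c, d}}" using u(1) by simp
      then show ?thesis using u 1 reach_edge[of a u] by (intro bexI[of _ u]) auto
    next
      case 2
      obtain u where u: "{c, u} \<in> E" "u \<in> V" "u \<notin> {a, d}" "u \<noteq> c"
        by (rule third_neighbour[of c "{a, d}"]) (use in_V assms in \<open>auto simp: card_insert_if\<close>)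
      then have "{c, u} \<noteq> {a, b}" "{c, u} \<noteq> {c, d}" using assms(3) by (auto simp: doubleton_eq_iff)
      then have "{c, u} \<in> E - {{a, b}, {c, d}}" using u(1) by simp
      then show ?thesis using u 2 reach_edge[of c u] by (intro bexI[of _ u]) auto
    qed
  qed auto
qed

text \<open>Each of \<open>x\<close> and \<open>y\<close> has three old neighbours, so one of these
  survives the deletion of two vertices. The lost edge \<open>zw\<close> is replaced by the walk
  through \<open>x\<close> and \<open>y\<close>; if one of them is deleted, at most one old vertex
  is, and the old graph stays connected even without \<open>zw\<close>.\<close>

lemma k_connected_path_insertion:
  assumes zw: "{z, w} \<in> E" and AB: "A \<in> V" "B \<in> V" "distinct [z, w, A, B]" and new: "x \<notin> V" "y \<notin> V" "x \<noteq> y"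
  shows "k_connected 3 (V \<union> {x, y})
    (E - {{z, w}} \<union> {{z, x}, {x, y}, {y, w}, {x, A}, {x, B}, {y, A}, {y, B}})" (is "k_connected 3 ?V ?E")
  unfolding k_connected_def
proof (intro conjI allI impI)
  have in_V: "z \<in> V" "w \<in> V" using edge_V zw by auto
  show "3 < card ?V" using k3 fin_V by (simp add: k_connected_def card_insert_if)
  fix S assume S: "S \<subseteq> ?V" "card S < 3"
  have fS: "finite S" using S fin_V finite_subset by (metis finite.emptyI finite_UnI finite_insert)
  define F where "F = {e \<in> ?E. e \<inter> S = {}}"
  have edge: "reach F p q" if "{p, q} \<in> ?E" "p \<notin> S" "q \<notin> S" for p q
    using that by (intro reach_edge) (auto simp: F_def)
  have c3: "\<exists>t\<in>{t1, A, B}. t \<notin> S" if "t1 \<in> {z, w}" for t1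
    using card_avoid[of S "{t1, A, B}"] S fS AB that by auto
  have x: "\<exists>t\<in>V - S. reach F x t" if xS: "x \<notin> S"
  proof -
    obtain t where "t \<in> {z, A, B}" "t \<notin> S" using c3[of z] by auto
    then show ?thesis using edge[of x t] xS in_V AB by (auto simp: insert_commute)
  qed
  have y: "\<exists>t\<in>V - S. reach F y t" if yS: "y \<notin> S"
  proof -
    obtain t where "t \<in> {w, A, B}" "t \<notin> S" using c3[of w] by auto
    then show ?thesis using edge[of y t] yS in_V AB by (auto simp: insert_commute)
  qed
  have "connected_graph (?V - S) F"
  proof (cases "x \<in> S \<or> y \<in> S")
    case False
    have "connected_graph (V - S) {e \<in> E. e \<inter> S = {}}" using S False by (intro delete_connected) auto
    then show ?thesis
    proof (rule connected_graph_transfer)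
      fix p q assume pq: "{p, q} \<in> {e \<in> E. e \<inter> S = {}}"
      show "reach F p q"
      proof (cases "{p, q} = {z, w}")
        case True
        then have zwS: "z \<notin> S" "w \<notin> S" using pq by auto
        have "reach F z w"
          by (rule reach_trans[OF edge[of z x] reach_trans[OF edge[of x y] edge[of y w]]]) (use zwS False in auto)
        then show ?thesis using True reach_sym[of F z w] unfolding doubleton_eq_iff by metis
      qed (use pq edge in auto)
    qed (use x y False in auto)
  next
    case True
    define S0 where "S0 = S - {x, y}"
    have "card S0 < card S" unfolding S0_def by (rule psubset_card_mono) (use fS True in auto)
    then have "card S0 < 2" using S by simp
    then have "connected_graph (V - S0) {e \<in> E - {{z, w}}. e \<inter> S0 = {}}"
      using S by (intro delete_edge_connected zw) (auto simp: S0_def)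
    then show ?thesis
    proof (rule connected_graph_transfer)
      have *: "V - S0 = V - S" using new S0_def by blast
      show "V - S0 \<subseteq> ?V - S" using * by blast
      show "reach F p q" if "{p, q} \<in> {e \<in> E - {{z, w}}. e \<inter> S0 = {}}" for p q
        using that edge_V[of "{p, q}"] new S0_def by (intro edge) auto
      show "\<exists>t\<in>V - S0. reach F v t" if "v \<in> ?V - S - (V - S0)" for v
        using that x y unfolding * by auto
    qed
  qed
  then show "connected_graph (?V - S) {e \<in> ?E. e \<inter> S = {}}" by (simp only: F_def)
qed

text \<open>Each of \<open>x\<close> and \<open>y\<close> has only two old neighbours; if both are
  deleted, nothing else is, and the way out leads along the rung. A subdivided edge is replaced by
  the walk through its new vertex, unless that vertex is deleted, and then fewer old vertices
  are.\<close>

lemma k_connected_rung_insertion: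
  assumes ab: "{a, b} \<in> E" and cd: "{c, d} \<in> E" and dist: "distinct [a, b, c, d]" and new: "x \<notin> V" "y \<notin> V" "x \<noteq> y"
  shows "k_connected 3 (V \<union> {x, y})
    (E - {{a, b}, {c, d}} \<union> {{a, x}, {x, b}, {c, y}, {y, d}, {x, y}})" (is "k_connected 3 ?V ?E")
  unfolding k_connected_def
proof (intro conjI allI impI)
  have in_V: "a \<in> V" "b \<in> V" "c \<in> V" "d \<in> V" using edge_V ab cd by auto
  show "3 < card ?V" using k3 fin_V by (simp add: k_connected_def card_insert_if)
  fix S assume S: "S \<subseteq> ?V" "card S < 3"
  have fS: "finite S" using S fin_V finite_subset by (metis finite.emptyI finite_UnI finite_insert)
  define F where "F = {e \<in> ?E. e \<inter> S = {}}"
  have edge: "reach F p q" if "{p, q} \<in> ?E" "p \<notin> S" "q \<notin> S" for p q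
    using that by (intro reach_edge) (auto simp: F_def)
  have xy: "reach F x y" "reach F y x" if "x \<notin> S" "y \<notin> S"
    using edge[of x y] edge[of y x] that by (auto simp: insert_commute)
  have x1: "\<exists>t\<in>V - S. reach F x t" if xS: "x \<notin> S" "a \<notin> S \<or> b \<notin> S"
    using edge[of x a] edge[of x b] xS in_V by (auto simp: insert_commute)
  have y1: "\<exists>t\<in>V - S. reach F y t" if yS: "y \<notin> S" "c \<notin> S \<or> d \<notin> S"
    using edge[of y c] edge[of y d] yS in_V by (auto simp: insert_commute)
  have av: "\<exists>t\<in>T. t \<notin> S" if "card T \<ge> 3" for T using card_avoid[of S T] S fS that by auto
  have x: "\<exists>t\<in>V - S. reach F x t" if xS: "x \<notin> S"
  proof (cases "a \<notin> S \<or> b \<notin> S")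
    case False
    have "y \<noteq> a" "y \<noteq> b" using new in_V by auto
    then have "card {a, b, y} \<ge> 3" "card {a, b, c} \<ge> 3" using dist by auto
    then have "y \<notin> S" "c \<notin> S" using av[of "{a, b, y}"] av[of "{a, b, c}"] False by auto
    then show ?thesis using y1 reach_trans[OF xy(1)] xS by meson
  qed (use x1 xS in auto)
  have y: "\<exists>t\<in>V - S. reach F y t" if yS: "y \<notin> S"
  proof (cases "c \<notin> S \<or> d \<notin> S")
    case False
    have "x \<noteq> c" "x \<noteq> d" using new in_V by auto
    then have "card {c, d, x} \<ge> 3" "card {c, d, a} \<ge> 3" using dist by auto
    then have "x \<notin> S" "a \<notin> S" using av[of "{c, d, x}"] av[of "{c, d, a}"] False by auto
    then show ?thesis using x1 reach_trans[OF xy(2)] yS by meson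
  qed (use y1 yS in auto)
  have rab: "reach F p q" if "{p, q} = {a, b}" "p \<notin> S" "q \<notin> S" "x \<notin> S" for p q
  proof -
    have "a \<notin> S" "b \<notin> S" using that unfolding doubleton_eq_iff by auto
    then have "reach F a b" by (intro reach_trans[OF edge[of a x] edge[of x b]]) (use that(4) in auto)
    then show ?thesis using that(1) reach_sym unfolding doubleton_eq_iff by metis
  qed
  have rcd: "reach F p q" if "{p, q} = {c, d}" "p \<notin> S" "q \<notin> S" "y \<notin> S" for p q
  proof -
    have "c \<notin> S" "d \<notin> S" using that unfolding doubleton_eq_iff by auto
    then have "reach F c d" by (intro reach_trans[OF edge[of c y] edge[of y d]]) (use that(4) in auto)
    then show ?thesis using that(1) reach_sym unfolding doubleton_eq_iff by metis
  qed
  define S0 where "S0 = S - {x, y}"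
  have *: "V - S0 = V - S" using new S0_def by blast
  have out: "p \<notin> S" "q \<notin> S" if "{p, q} \<in> E" "{p, q} \<inter> S0 = {}" for p q
    using that edge_V[of "{p, q}"] new S0_def by auto
  have S0V: "S0 \<subseteq> V" using S S0_def by blast
  have xy': "\<exists>t\<in>V - S0. reach F v t" if "v \<in> ?V - S - (V - S0)" for v
    using that x y unfolding * by auto
  have sub: "V - S0 \<subseteq> ?V - S" using * by blast
  \<comment> \<open>\<open>D\<close> collects the edges that cannot be rerouted because their
    subdividing vertex is deleted. Each such vertex leaves one old vertex less in \<open>S0\<close>,
    which pays for the loss of the edge.\<close>
  define D where "D = (if x \<in> S then {{a, b}} else {}) \<union> (if y \<in> S then {{c, d}} else {})"
  have S02: "card S0 < 2" if "x \<in> S \<or> y \<in> S"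
  proof -
    have "card S0 < card S" unfolding S0_def by (rule psubset_card_mono) (use fS that in auto)
    then show ?thesis using S(2) by simp
  qed
  have "connected_graph (V - S0) {e \<in> E - D. e \<inter> S0 = {}}"
  proof (cases "x \<in> S"; cases "y \<in> S")
    assume xS: "x \<in> S" "y \<in> S"
    then have "{x, y} = S" using S fS new by (intro card_seteq) auto
    then have "S0 = {}" using S0_def by blast
    moreover have "D = {{a, b}, {c, d}}" using xS by (auto simp: D_def)
    ultimately have "{e \<in> E - D. e \<inter> S0 = {}} = E - {{a, b}, {c, d}}" "V - S0 = V" by auto
    then show ?thesis using delete_two_edges_connected[OF ab cd dist] by (simp only:)
  next
    assume xS: "x \<in> S" "y \<notin> S"
    then show ?thesis using delete_edge_connected[OF S0V S02 ab] by (simp add: D_def)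
  next
    assume xS: "x \<notin> S" "y \<in> S"
    then show ?thesis using delete_edge_connected[OF S0V S02 cd] by (simp add: D_def)
  next
    assume xS: "x \<notin> S" "y \<notin> S"
    then have "S0 = S" using S0_def by blast
    then show ?thesis using delete_connected[OF S0V] S(2) xS by (simp add: D_def)
  qed
  then have "connected_graph (?V - S) F"
  proof (rule connected_graph_transfer[OF _ sub _ xy'])
    fix p q assume pq: "{p, q} \<in> {e \<in> E - D. e \<inter> S0 = {}}"
    then have pS: "p \<notin> S" "q \<notin> S" using out[of p q] by simp_all
    have E: "{p, q} \<in> E" and D: "{p, q} \<notin> D" using pq by simp_all
    consider "{p, q} = {a, b}" | "{p, q} = {c, d}" | "{p, q} \<notin> {{a, b}, {c, d}}" by auto
    then show "reach F p q"
    proof cases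
      case 1
      have "x \<notin> S" using D unfolding 1 by (auto simp: D_def)
      then show ?thesis by (rule rab[OF 1 pS])
    next
      case 2
      have "y \<notin> S" using D unfolding 2 by (auto simp: D_def)
      then show ?thesis by (rule rcd[OF 2 pS])
    next
      case 3
      show ?thesis by (rule edge[OF _ pS]) (use E 3 in simp)
    qed
  qed
  then show "connected_graph (?V - S) {e \<in> ?E. e \<inter> S = {}}" by (simp only: F_def)
qed

end

text \<open>One more edge would exceed the bound 3n - 6, which applies to the enlarged graph because
  three-connectedness excludes bridges.\<close>

lemma planar_triangulation_of_card_edges:
  assumes simple: "simple_graph V E" and k3: "k_connected 3 V E" and pl: "planar_graph V E"
    and cE: "card E + 6 = 3 * card V"
  shows "planar_triangulation V E"
proof -
  have fin: "finite E" "finite V" using simple_graph_finite_edges[OF simple] simple by (auto simp: simple_graph_def)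
  have V4: "card V \<ge> 4" using k3 by (auto simp: k_connected_def)
  have con: "connected_graph V E" using delete_connected[OF simple k3, of "{}"] by simp
  have False if uv: "u \<in> V" "v \<in> V" "u \<noteq> v" "{u, v} \<notin> E" and plan: "planar_graph V (insert {u, v} E)" for u v
  proof -
    let ?E = "insert {u, v} E"
    obtain p \<gamma> where pd: "simple_graph V ?E" "plane_drawing V ?E p \<gamma>"
      using plan by (auto simp: planar_graph_def)
    have mono: "connected_graph V F'" if "connected_graph V F" "F \<subseteq> F'" for F F' :: "'a set set"
      using connected_graph_transfer[OF that(1), of V F'] that(2) reach_edge by (metis DiffE order_refl subsetD)
    have "card ?E + 6 \<le> 3 * card V"
    proof (rule planar_edge_bound_drawing[OF pd])
      show "3 \<le> card ?E" using cE V4 fin by (simp add: card_insert_if)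
      show "connected_graph V ?E" by (rule mono[OF con]) auto
      fix e assume e: "e \<in> ?E"
      show "connected_graph V (?E - {e})"
      proof (cases "e \<in> E")
        case True
        then obtain a b where ab: "e = {a, b}" using edge_2[OF simple k3] by (metis card_2_iff)
        then have "connected_graph V {f \<in> E - {e}. f \<inter> {} = {}}"
          using delete_edge_connected[OF simple k3, of "{}" a b] True by simp
        then show ?thesis by (rule mono) auto
      qed (use e con uv in \<open>auto intro: mono\<close>)
    qed
    then show False using cE uv fin by simp
  qed
  then show ?thesis using pl V4 by (auto simp: planar_triangulation_def)
qed

section \<open>Counting perfect matchings\<close>

text \<open>The count refers to the subgraph induced on \<open>V\<close>, so that vertices can be
  removed from \<open>V\<close> while \<open>E\<close> stays the same.\<close>

definition pmc :: "'a set \<Rightarrow> 'a set set \<Rightarrow> nat" where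
  "pmc V E = num_perfect_matchings V {e \<in> E. e \<subseteq> V}"

lemma pmc_simple: "simple_graph V E \<Longrightarrow> pmc V E = num_perfect_matchings V E"
  unfolding pmc_def by (rule arg_cong[of _ _ "num_perfect_matchings V"]) (auto simp: simple_graph_def)

lemma pmc_cong: "(\<And>e. e \<subseteq> V \<Longrightarrow> e \<in> E \<longleftrightarrow> e \<in> E') \<Longrightarrow> pmc V E = pmc V E'"
  unfolding pmc_def by (rule arg_cong[of _ _ "num_perfect_matchings V"]) auto

lemma pmc_empty:
  assumes "{} \<notin> E"
  shows "pmc {} E = 1"
proof -
  have "{M. perfect_matching {} {e \<in> E. e \<subseteq> {}} M} = {{}}"
    using assms by (auto simp: perfect_matching_def)
  then show ?thesis by (simp add: pmc_def num_perfect_matchings_def)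
qed

text \<open>The analogue of expanding a permanent along a row: matchings are sorted by the partner
  of \<open>v\<close>, and taking out that edge is a bijection onto the matchings of the
  rest.\<close>

lemma pmc_expand:
  assumes fin: "finite V" and two: "\<And>e. e \<in> E \<Longrightarrow> card e = 2" and v: "v \<in> V"
  shows "pmc V E = (\<Sum>u\<in>{u \<in> V. {v, u} \<in> E}. pmc (V - {v, u}) E)"
proof -
  define PM where "PM = (\<lambda>V. {M. perfect_matching V {e \<in> E. e \<subseteq> V} M})"
  have pmc: "pmc V E = card (PM V)" for V by (simp add: pmc_def num_perfect_matchings_def PM_def)
  have finPM: "finite (PM V')" if "finite V'" for V'
    by (rule finite_subset[of _ "Pow (Pow V')"]) (use that in \<open>auto simp: PM_def perfect_matching_def\<close>)
  let ?N = "{u \<in> V. {v, u} \<in> E}"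
  define X where "X = (\<lambda>u. insert {v, u} ` PM (V - {v, u}))"
  have notin: "{v, u} \<notin> M" if "M \<in> PM (V - {v, u})" for u M
    using that by (auto simp: PM_def perfect_matching_def)
  have "PM V = (\<Union>u\<in>?N. X u)"
  proof (intro equalityI subsetI)
    fix M assume "M \<in> PM V"
    then have M: "M \<subseteq> {e \<in> E. e \<subseteq> V}" "\<And>w. w \<in> V \<Longrightarrow> \<exists>!e. e \<in> M \<and> w \<in> e"
      by (auto simp: PM_def perfect_matching_def)
    obtain e where e: "e \<in> M" "v \<in> e" using M(2)[OF v] by blast
    then obtain u where u: "e = {v, u}" "u \<noteq> v"
      using two[of e] M(1) by (auto simp: card_2_iff doubleton_eq_iff)
    have uV: "u \<in> V" "{v, u} \<in> E" using e u M(1) by auto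
    have only: "f = e" if f: "f \<in> M" "f \<inter> {v, u} \<noteq> {}" for f
    proof -
      obtain w where w: "w \<in> f" "w \<in> {v, u}" using f(2) by blast
      then have "w \<in> V" "w \<in> e" using v uV u by auto
      then show ?thesis using M(2)[of w] f(1) w(1) e(1) by blast
    qed
    have "M - {e} \<in> PM (V - {v, u})"
      unfolding PM_def perfect_matching_def
    proof (intro CollectI conjI ballI)
      have "f \<inter> {v, u} = {}" if "f \<in> M - {e}" for f using only[of f] that by blast
      then show "M - {e} \<subseteq> {e \<in> E. e \<subseteq> V - {v, u}}" using M(1) by blast
    next
      fix w assume w: "w \<in> V - {v, u}"
      then obtain f where f: "f \<in> M" "w \<in> f" and uniq: "\<And>f'. f' \<in> M \<Longrightarrow> w \<in> f' \<Longrightarrow> f' = f"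
        using M(2)[of w] unfolding Ex1_def by blast
      have "f \<noteq> e" using f w u by auto
      then show "\<exists>!f. f \<in> M - {e} \<and> w \<in> f" 
      proof (intro ex1I[of _ f])
        show "f' = f" if "f' \<in> M - {e} \<and> w \<in> f'" for f' by (rule uniq) (use that in auto)
      qed (use f in simp)
    qed
    moreover have "M = insert {v, u} (M - {e})" using e(1) u(1) by auto
    ultimately have "M \<in> X u" unfolding X_def by (rule image_eqI[rotated])
    then show "M \<in> (\<Union>u\<in>?N. X u)" by (intro UN_I[of u]) (use uV in auto)
  next
    fix M assume "M \<in> (\<Union>u\<in>?N. X u)"
    then obtain u M' where u: "u \<in> V" "{v, u} \<in> E" and M': "M' \<in> PM (V - {v, u})" and M: "M = insert {v, u} M'"
      unfolding X_def by blast
    have sub: "M' \<subseteq> {e \<in> E. e \<subseteq> V - {v, u}}" and un: "\<And>w. w \<in> V - {v, u} \<Longrightarrow> \<exists>!e. e \<in> M' \<and> w \<in> e"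
      using M' by (auto simp: PM_def perfect_matching_def)
    show "M \<in> PM V"
      unfolding PM_def perfect_matching_def
    proof (intro CollectI conjI ballI)
      show "M \<subseteq> {e \<in> E. e \<subseteq> V}" using sub M u v by auto
      fix w assume w: "w \<in> V"
      show "\<exists>!e. e \<in> M \<and> w \<in> e"
      proof (cases "w \<in> {v, u}")
        case True
        moreover have "w \<notin> e" if "e \<in> M'" for e using sub that True by blast
        ultimately show ?thesis using M by (intro ex1I[of _ "{v, u}"]) auto
      next
        case False
        then have "\<exists>!e. e \<in> M' \<and> w \<in> e" using un[of w] w by simp
        moreover have "(e \<in> M \<and> w \<in> e) = (e \<in> M' \<and> w \<in> e)" for e using M False by auto
        ultimately show ?thesis by simp
      qed
    qed
  qed
  moreover have "card (\<Union>u\<in>?N. X u) = (\<Sum>u\<in>?N. card (X u))"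
  proof (rule card_UN_disjoint)
    show "\<forall>u\<in>?N. finite (X u)" using finPM fin by (simp add: X_def)
    show "\<forall>u\<in>?N. \<forall>u'\<in>?N. u \<noteq> u' \<longrightarrow> X u \<inter> X u' = {}"
    proof (intro ballI impI)
      fix u u' assume uu: "u \<in> ?N" "u' \<in> ?N" "u \<noteq> u'"
      have False if M: "M \<in> X u" "M \<in> X u'" for M
      proof -
        obtain M1 where M1: "M1 \<in> PM (V - {v, u})" "M = insert {v, u} M1" using M(1) unfolding X_def by (rule imageE)
        obtain M2 where M2: "M = insert {v, u'} M2" using M(2) unfolding X_def by (rule imageE)
        have "{v, u'} \<noteq> {v, u}" using uu by (auto simp: doubleton_eq_iff)
        moreover have "{v, u'} \<in> insert {v, u} M1" unfolding M1(2)[symmetric] M2 by simp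
        ultimately have "{v, u'} \<in> M1" by simp
        then show False using M1(1) by (auto simp: PM_def perfect_matching_def)
      qed
      then show "X u \<inter> X u' = {}" by blast
    qed
  qed (use fin in simp)
  moreover have "card (X u) = card (PM (V - {v, u}))" for u
    unfolding X_def
  proof (rule card_image, rule inj_onI)
    fix M1 M2 assume "M1 \<in> PM (V - {v, u})" "M2 \<in> PM (V - {v, u})" "insert {v, u} M1 = insert {v, u} M2"
    then show "M1 = M2" using notin[of M1 u] notin[of M2 u] by (simp add: insert_ident)
  qed
  ultimately show ?thesis by (simp add: pmc)
qed

lemma pmc_insert:
  assumes "finite U" "\<And>e. e \<in> E \<Longrightarrow> card e = 2" "x \<notin> U" "{t \<in> U. {x, t} \<in> E} = T"
  shows "pmc (insert x U) E = (\<Sum>t\<in>T. pmc (U - {t}) E)"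
proof -
  have "{u \<in> insert x U. {x, u} \<in> E} = T" using assms(2)[of "{x, x}"] assms(4) by auto
  moreover have "insert x U - {x, t} = U - {t}" for t using assms(3) by blast
  ultimately show ?thesis using pmc_expand[of "insert x U" E x] assms by simp
qed

text \<open>Matchings are sorted by their use of the edge. Both terms refer to the graph without it,
  so that all later numbers belong to one reduced edge set.\<close>

lemma pmc_delete_edge:
  assumes "finite V" "\<And>e. e \<in> E \<Longrightarrow> card e = 2" "{z, w} \<in> E" "z \<in> V" "w \<in> V"
  shows "pmc V E = pmc V (E - {{z, w}}) + pmc (V - {z, w}) (E - {{z, w}})"
proof -
  let ?H = "E - {{z, w}}"
  have zw: "z \<noteq> w" using assms(2)[OF assms(3)] by auto
  have N: "{u \<in> V. {z, u} \<in> E} = insert w {u \<in> V. {z, u} \<in> ?H}"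
    using assms zw by (auto simp: doubleton_eq_iff)
  have same: "pmc (V - {z, u}) E = pmc (V - {z, u}) ?H" for u
    by (rule pmc_cong) auto
  have "pmc V E = (\<Sum>u\<in>{u \<in> V. {z, u} \<in> E}. pmc (V - {z, u}) ?H)"
    using pmc_expand[OF assms(1,2,4)] same by simp
  also have "\<dots> = pmc (V - {z, w}) ?H + (\<Sum>u\<in>{u \<in> V. {z, u} \<in> ?H}. pmc (V - {z, u}) ?H)"
    unfolding N by (rule sum.insert) (use assms in auto)
  also have "(\<Sum>u\<in>{u \<in> V. {z, u} \<in> ?H}. pmc (V - {z, u}) ?H) = pmc V ?H"
    using pmc_expand[of V ?H z] assms by simp
  finally show ?thesis by simp
qed

section \<open>Matching numbers under the insertion of two vertices\<close>

text \<open>Common frame of both insertions: \<open>H\<close> is what remains of the old edges,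
  \<open>X\<close> and \<open>Y\<close> are the old neighbours of \<open>x\<close> and
  \<open>y\<close>, and \<open>n\<close> and \<open>n'\<close> are the matching numbers before and
  after with the vertices of \<open>S\<close> removed. The edge \<open>xy\<close> is kept out of
  \<open>H'\<close> and added by \<open>pmc_link\<close>, since after a path insertion it is the
  next slot, whose conditions refer to the graph without it.\<close>

locale two_new_vertices =
  fixes V :: "'a set" and H x y X Y
  assumes fin: "finite V" and H: "\<And>e. e \<in> H \<Longrightarrow> card e = 2 \<and> e \<subseteq> V"
    and XY: "X \<subseteq> V" "Y \<subseteq> V" and new: "x \<notin> V" "y \<notin> V" "x \<noteq> y"
begin

definition H' where "H' = H \<union> (\<lambda>t. {x, t}) ` X \<union> (\<lambda>t. {y, t}) ` Y"

definition n where "n S = pmc (V - S) H"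

definition n' where "n' S = pmc (V \<union> {x, y} - S) H'"

lemma two': "e \<in> H' \<Longrightarrow> card e = 2"
  using H XY new by (auto simp: H'_def card_insert_if)

lemma H'_V: "S \<subseteq> V \<Longrightarrow> pmc S H' = pmc S H"
  by (rule pmc_cong) (use new in \<open>auto simp: H'_def\<close>)

lemma N_x: "{t \<in> S. {x, t} \<in> H'} = X \<inter> S" if "S \<subseteq> insert y V" for S
  using that H[of "{x, t}" for t] XY new by (auto simp: H'_def doubleton_eq_iff)

lemma N_y: "{t \<in> S. {y, t} \<in> H'} = Y \<inter> S" if "S \<subseteq> insert x V" for S
  using that H[of "{y, t}" for t] XY new by (auto simp: H'_def doubleton_eq_iff)

lemma n'_both: 
  assumes "S \<subseteq> V"
  shows "n' (insert x (insert y S)) = n S"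
proof -
  have "V \<union> {x, y} - insert x (insert y S) = V - S" using new by blast
  then show ?thesis by (simp add: n_def n'_def H'_V)
qed

lemma n'_x:
  assumes "S \<subseteq> V"
  shows "n' (insert x S) = (\<Sum>t\<in>Y - S. n (insert t S))"
proof -
  have 1: "V \<union> {x, y} - insert x S = insert y (V - S)" using new assms by blast
  have 2: "Y \<inter> (V - S) = Y - S" using XY by blast
  have "n' (insert x S) = (\<Sum>t\<in>Y - S. pmc (V - S - {t}) H')"
    unfolding n'_def 1 
    by (rule pmc_insert) (use fin two' new 2 N_y[of "V - S"] in auto)
  also have "\<dots> = (\<Sum>t\<in>Y - S. n (insert t S))"
    unfolding n_def by (rule sum.cong) (auto simp: H'_V Diff_insert[symmetric] simp flip: Diff_insert2)
  finally show ?thesis .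
qed

lemma n'_y:
  assumes "S \<subseteq> V"
  shows "n' (insert y S) = (\<Sum>t\<in>X - S. n (insert t S))"
proof -
  have 1: "V \<union> {x, y} - insert y S = insert x (V - S)" using new assms by blast
  have 2: "X \<inter> (V - S) = X - S" using XY by blast
  have "n' (insert y S) = (\<Sum>t\<in>X - S. pmc (V - S - {t}) H')"
    unfolding n'_def 1 
    by (rule pmc_insert) (use fin two' new 2 N_x[of "V - S"] in auto)
  also have "\<dots> = (\<Sum>t\<in>X - S. n (insert t S))"
    unfolding n_def by (rule sum.cong) (auto simp: H'_V Diff_insert[symmetric] simp flip: Diff_insert2)
  finally show ?thesis .
qed

lemma n'_none:
  assumes "S \<subseteq> V"
  shows "n' S = (\<Sum>s\<in>X - S. \<Sum>t\<in>Y - insert s S. n (insert t (insert s S)))"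
proof -
  have 1: "V \<union> {x, y} - S = insert x (insert y (V - S))" using new assms by blast
  have 2: "X \<inter> insert y (V - S) = X - S" using XY new by blast
  have "n' S = (\<Sum>s\<in>X - S. pmc (insert y (V - S) - {s}) H')"
    unfolding n'_def 1 
    by (rule pmc_insert) (use fin two' new 2 N_x[of "insert y (V - S)"] in auto)
  also have "\<dots> = (\<Sum>s\<in>X - S. n' (insert x (insert s S)))"
  proof (rule sum.cong)
    fix s assume s: "s \<in> X - S"
    have "insert y (V - S) - {s} = V \<union> {x, y} - insert x (insert s S)" using new s assms XY by blast
    then show "pmc (insert y (V - S) - {s}) H' = n' (insert x (insert s S))" by (simp add: n'_def)
  qed simp
  also have "\<dots> = (\<Sum>s\<in>X - S. \<Sum>t\<in>Y - insert s S. n (insert t (insert s S)))"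
    by (intro sum.cong refl n'_x) (use assms XY in auto)
  finally show ?thesis .
qed

lemma mem_H': "e \<in> H' \<longleftrightarrow> e \<in> H \<or> (\<exists>t\<in>X. e = {x, t}) \<or> (\<exists>t\<in>Y. e = {y, t})"
  by (auto simp: H'_def)

lemma xy_notin: "{x, y} \<notin> H'"
proof -
  have "{x, y} \<notin> H" using H[of "{x, y}"] new by auto
  then show ?thesis using XY new by (auto simp: mem_H' doubleton_eq_iff)
qed

lemma pmc_link: "pmc (V \<union> {x, y}) (insert {x, y} H') = n' {} + n {}"
proof -
  have "insert {x, y} H' - {{x, y}} = H'" using xy_notin by simp
  moreover have "V \<union> {x, y} - {x, y} = V" using new by blast
  moreover have "card e = 2" if "e \<in> insert {x, y} H'" for e using that two' new by auto
  moreover have "finite (V \<union> {x, y})" using fin by simp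
  ultimately have "pmc (V \<union> {x, y}) (insert {x, y} H') = pmc (V \<union> {x, y}) H' + pmc V H'"
    using pmc_delete_edge[of "V \<union> {x, y}" "insert {x, y} H'" x y] by (metis UnCI insertI1 insertI2)
  then show ?thesis using H'_V[of V] by (simp add: n'_def n_def)
qed

end

text \<open>The vanishing numbers force every perfect matching of the graph extended by \<open>x\<close> and \<open>y\<close> to contain
  either \<open>{x, y}\<close> or both \<open>{z, x}\<close> and \<open>{y, w}\<close>. They vanish when \<open>z, w, A, B\<close> lie in a tight barrier.\<close>

definition path_slot :: "'a set \<Rightarrow> 'a set set \<Rightarrow> 'a \<Rightarrow> 'a \<Rightarrow> 'a \<Rightarrow> 'a \<Rightarrow> bool" where
  "path_slot V E z w A B \<longleftrightarrow> {z, w} \<in> E \<and> A \<in> V \<and> B \<in> V \<and> distinct [z, w, A, B] \<and>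
     (\<forall>S\<in>{{z, A}, {z, B}, {w, A}, {w, B}, {A, B}, {z, w, A, B}}. pmc (V - S) (E - {{z, w}}) = 0)"

definition path_insert :: "'a set set \<Rightarrow> 'a \<Rightarrow> 'a \<Rightarrow> 'a \<Rightarrow> 'a \<Rightarrow> 'a \<Rightarrow> 'a \<Rightarrow> 'a set set" where
  "path_insert E z w A B x y =
     E - {{z, w}} \<union> {{z, x}, {x, y}, {y, w}, {x, A}, {x, B}, {y, A}, {y, B}}"

text \<open>A perfect matching leaves the ladder at exactly one left and one right end of its rails. Whether
  these ends lie on the same rail depends on the parity of the number of rungs.\<close>

definition rung_slot :: "'a set \<Rightarrow> 'a set set \<Rightarrow> 'a \<Rightarrow> 'a \<Rightarrow> 'a \<Rightarrow> 'a \<Rightarrow> nat \<Rightarrow> nat \<Rightarrow> bool" where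
  "rung_slot V E a b c d P Q \<longleftrightarrow> {a, b} \<in> E \<and> {c, d} \<in> E \<and> distinct [a, b, c, d] \<and>
     (\<forall>S\<in>{{}, {a, c}, {b, d}, {a, b, c, d}}. pmc (V - S) (E - {{a, b}, {c, d}}) = 0) \<and>
     pmc (V - {a, d}) (E - {{a, b}, {c, d}}) + pmc (V - {b, c}) (E - {{a, b}, {c, d}}) = P \<and>
     pmc (V - {a, b}) (E - {{a, b}, {c, d}}) + pmc (V - {c, d}) (E - {{a, b}, {c, d}}) = Q"

definition rung_insert :: "'a set set \<Rightarrow> 'a \<Rightarrow> 'a \<Rightarrow> 'a \<Rightarrow> 'a \<Rightarrow> 'a \<Rightarrow> 'a \<Rightarrow> 'a set set" where
  "rung_insert E a b c d x y =
     E - {{a, b}, {c, d}} \<union> {{a, x}, {x, b}, {c, y}, {y, d}, {x, y}}"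

text \<open>Matchings through \<open>xy\<close> correspond to old ones without \<open>zw\<close>,
  those with \<open>zx\<close> and \<open>yw\<close> to old ones with \<open>zw\<close>; any other
  partners of \<open>x\<close> and \<open>y\<close> lead to a vanishing number. The conditions on
  the new slot expand into the same vanishing numbers, which makes the step repeatable.\<close>

lemma pmc_path_insert:
  assumes simple: "simple_graph V E" and slot: "path_slot V E z w A B" and new: "x \<notin> V" "y \<notin> V" "x \<noteq> y"
  shows "pmc (V \<union> {x, y}) (path_insert E z w A B x y) = pmc V E"
    and "path_slot (V \<union> {x, y}) (path_insert E z w A B x y) x y A B"
proof -
  define H where "H = E - {{z, w}}"
  have zw: "{z, w} \<in> E" "z \<in> V" "w \<in> V" and AB: "A \<in> V" "B \<in> V" and dist: "distinct [z, w, A, B]"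
    using simple slot by (auto simp: path_slot_def simple_graph_def)
  interpret two_new_vertices V H x y "{z, A, B}" "{w, A, B}"
    by unfold_locales (use simple zw AB new in \<open>auto simp: H_def simple_graph_def\<close>)
  have eq: "path_insert E z w A B x y = insert {x, y} H'"
  proof -
    have "{x, z} = {z, x}" "{w, y} = {y, w}" by auto
    then show ?thesis unfolding path_insert_def H'_def H_def[symmetric] by auto
  qed
  have eq': "path_insert E z w A B x y - {{x, y}} = H'" unfolding eq using xy_notin by simp
  have z: "n {z, A} = 0" "n {z, B} = 0" "n {w, A} = 0" "n {w, B} = 0" "n {A, B} = 0" "n {z, w, A, B} = 0"
    using slot unfolding path_slot_def n_def H_def[symmetric] by simp_all
  have ne: "z \<noteq> w" "z \<noteq> A" "z \<noteq> B" "w \<noteq> z" "w \<noteq> A" "w \<noteq> B" "A \<noteq> z" "A \<noteq> w" "A \<noteq> B" "B \<noteq> z" "B \<noteq> w" "B \<noteq> A" using dist by auto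
  have "pmc V E = n {} + n {z, w}"
    using pmc_delete_edge[of V E z w] fin simple zw unfolding n_def H_def[symmetric] by (simp add: simple_graph_def)
  moreover have "n' {} = n {z, w}"
    using n'_none[of "{}"] ne z by (simp add: insert_Diff_if insert_commute)
  ultimately show "pmc (V \<union> {x, y}) (path_insert E z w A B x y) = pmc V E"
    unfolding eq pmc_link by simp
  have "n' {x, A} = 0" "n' {x, B} = 0" using n'_x[of "{A}"] n'_x[of "{B}"] AB ne z
    by (simp_all add: insert_Diff_if insert_commute)
  moreover have "n' {y, A} = 0" "n' {y, B} = 0" using n'_y[of "{A}"] n'_y[of "{B}"] AB ne z
    by (simp_all add: insert_Diff_if insert_commute)
  moreover have "n' {A, B} = 0" using n'_none[of "{A, B}"] AB ne z
    by (simp add: insert_Diff_if insert_commute)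
  moreover have "n' {x, y, A, B} = 0" using n'_both[of "{A, B}"] AB z by simp
  ultimately show "path_slot (V \<union> {x, y}) (path_insert E z w A B x y) x y A B"
    unfolding path_slot_def eq' using AB new dist by (auto simp: n'_def path_insert_def)
qed

text \<open>Sorting by the use of the two slot edges gives four numbers, of which those for neither
  edge and for both vanish.\<close>

lemma pmc_rung_slot:
  assumes simple: "simple_graph V E" and slot: "rung_slot V E a b c d P Q"
  shows "pmc V E = Q"
proof -
  let ?H = "E - {{a, b}, {c, d}}"
  have in_V: "{a, b} \<in> E" "{c, d} \<in> E" "a \<in> V" "b \<in> V" "c \<in> V" "d \<in> V" and dist: "distinct [a, b, c, d]"
    and fin: "finite V" and two: "\<And>e. e \<in> E \<Longrightarrow> card e = 2"
    using simple slot by (auto simp: rung_slot_def simple_graph_def)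
  have cd: "{c, d} \<in> E - {{a, b}}" using in_V dist by (auto simp: doubleton_eq_iff)
  have HH: "E - {{a, b}} - {{c, d}} = ?H" by blast
  have "pmc V E = pmc V (E - {{a, b}}) + pmc (V - {a, b}) (E - {{a, b}})"
    by (rule pmc_delete_edge) (use in_V fin two in auto)
  also have "pmc V (E - {{a, b}}) = pmc V ?H + pmc (V - {c, d}) ?H"
    using pmc_delete_edge[OF fin _ cd] in_V two unfolding HH by simp
  also have "pmc (V - {a, b}) (E - {{a, b}}) = pmc (V - {a, b}) ?H + pmc (V - {a, b} - {c, d}) ?H"
    by (subst pmc_delete_edge[OF _ _ cd, of "V - {a, b}"]) (use in_V two dist fin HH in auto)
  also have "V - {a, b} - {c, d} = V - {a, b, c, d}" by blast
  finally show ?thesis using slot by (simp add: rung_slot_def)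
qed

text \<open>When one of \<open>x\<close> and \<open>y\<close> is removed, the other must be matched
  to its only old neighbour \<open>a\<close> or \<open>c\<close>. So the pair \<open>x, d\<close>
  turns into \<open>c, d\<close> and the pair \<open>x, b\<close> into \<open>b, c\<close>, and
  symmetrically for \<open>y\<close>; this exchanges \<open>P\<close> and \<open>Q\<close>.\<close>

lemma rung_slot_insert:
  assumes simple: "simple_graph V E" and slot: "rung_slot V E a b c d P Q" and new: "x \<notin> V" "y \<notin> V" "x \<noteq> y"
  shows "rung_slot (V \<union> {x, y}) (rung_insert E a b c d x y) x b y d Q P"
proof -
  define H where "H = E - {{a, b}, {c, d}}"
  have in_V: "{a, b} \<in> E" "{c, d} \<in> E" "a \<in> V" "b \<in> V" "c \<in> V" "d \<in> V" and dist: "distinct [a, b, c, d]"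
    using simple slot by (auto simp: rung_slot_def simple_graph_def)
  have ne: "a \<noteq> b" "a \<noteq> c" "a \<noteq> d" "b \<noteq> a" "b \<noteq> c" "b \<noteq> d" "c \<noteq> a" "c \<noteq> b" "c \<noteq> d" "d \<noteq> a" "d \<noteq> b" "d \<noteq> c" using dist by auto
  interpret two_new_vertices V H x y "{a}" "{c}"
    by unfold_locales (use simple in_V new in \<open>auto simp: H_def simple_graph_def\<close>)
  have nin: "{x, b} \<notin> insert {x, y} H'" "{y, d} \<notin> insert {x, y} H'"
    using H[of "{x, b}"] H[of "{y, d}"] in_V new dist by (auto simp: mem_H' doubleton_eq_iff)
  have eq: "rung_insert E a b c d x y - {{x, b}, {y, d}} = insert {x, y} H'"
  proof -
    have "{x, a} = {a, x}" "{y, c} = {c, y}" by auto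
    then have "rung_insert E a b c d x y = insert {x, y} H' \<union> {{x, b}, {y, d}}"
      unfolding rung_insert_def H'_def H_def[symmetric] by auto
    then show ?thesis using nin by auto
  qed
  let ?n = "\<lambda>S. pmc (V \<union> {x, y} - S) (insert {x, y} H')"
  have cong: "?n S = n' S" if "S \<inter> {x, y} \<noteq> {}" for S
    unfolding n'_def by (rule pmc_cong) (use that in auto)
  have both: "?n S = n' S + n S" if S: "S \<subseteq> V" for S
  proof -
    have "?n S = pmc (V \<union> {x, y} - S) (insert {x, y} H' - {{x, y}}) + pmc (V \<union> {x, y} - S - {x, y}) (insert {x, y} H' - {{x, y}})"
      by (rule pmc_delete_edge) (use fin S new two' in auto)
    moreover have "insert {x, y} H' - {{x, y}} = H'" using xy_notin by simp
    moreover have "V \<union> {x, y} - S - {x, y} = V - S" using new by blast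
    ultimately show ?thesis using H'_V[of "V - S"] by (simp add: n'_def n_def Diff_subset)
  qed
  have z: "n {} = 0" "n {a, c} = 0" "n {b, d} = 0" "n {a, b, c, d} = 0"
    and PQ: "n {a, d} + n {b, c} = P" "n {a, b} + n {c, d} = Q"
    using slot unfolding rung_slot_def n_def H_def[symmetric] by simp_all
  have "?n {} = 0" using both[of "{}"] n'_none[of "{}"] ne z by (simp add: insert_commute)
  moreover have "?n {x, y} = 0" using cong[of "{x, y}"] n'_both[of "{}"] z by simp
  moreover have "?n {b, d} = 0" using both[of "{b, d}"] n'_none[of "{b, d}"] ne z in_V by (simp add: insert_Diff_if insert_commute)
  moreover have "?n {x, b, y, d} = 0" using cong[of "{x, b, y, d}"] n'_both[of "{b, d}"] z in_V by (simp add: insert_commute)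
  moreover have "?n {x, d} = n {c, d}"
    by (subst cong) (use n'_x[of "{d}"] ne in_V in \<open>auto simp: insert_commute\<close>)
  moreover have "?n {b, y} = n {a, b}"
    by (subst cong) (use n'_y[of "{b}"] ne in_V in \<open>auto simp: insert_commute\<close>)
  moreover have "?n {x, b} = n {b, c}"
    by (subst cong) (use n'_x[of "{b}"] ne in_V in \<open>auto simp: insert_commute\<close>)
  moreover have "?n {y, d} = n {a, d}"
    by (subst cong) (use n'_y[of "{d}"] ne in_V in \<open>auto simp: insert_commute\<close>)
  moreover have "distinct [x, b, y, d]" using new in_V dist by auto
  moreover have "{x, b} \<in> rung_insert E a b c d x y" "{y, d} \<in> rung_insert E a b c d x y" by (simp_all add: rung_insert_def)
  ultimately show ?thesis using PQ unfolding rung_slot_def eq by simp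
qed

section \<open>Straight-line drawings\<close>

text \<open>Coordinates are functions on all vertices that vanish outside \<open>s\<close>, so that
  those of two different simplices can be compared.\<close>

definition barycentric :: "'a set \<Rightarrow> ('a \<Rightarrow> real) \<Rightarrow> bool" where
  "barycentric s l \<longleftrightarrow> (\<forall>v. l v \<ge> 0) \<and> (\<forall>v. v \<notin> s \<longrightarrow> l v = 0) \<and> sum l s = 1"

definition point :: "('a \<Rightarrow> complex) \<Rightarrow> 'a set \<Rightarrow> ('a \<Rightarrow> real) \<Rightarrow> complex" where
  "point p s l = (\<Sum>v\<in>s. l v *\<^sub>R p v)"

text \<open>Injectivity of barycentric coordinates expresses at once that simplices are nondegenerate and that
  two of them meet in the simplex spanned by their common vertices.\<close>

definition embedded :: "('a \<Rightarrow> complex) \<Rightarrow> 'a set set \<Rightarrow> bool" where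
  "embedded p F \<longleftrightarrow> (\<forall>s\<in>F. finite s) \<and> (\<forall>s\<in>F. \<forall>t\<in>F. \<forall>l m.
     barycentric s l \<and> barycentric t m \<and> point p s l = point p t m \<longrightarrow> l = m)"

lemma barycentric_mono: "barycentric s l \<Longrightarrow> s \<subseteq> t \<Longrightarrow> finite t \<Longrightarrow> barycentric t l"
  using sum.mono_neutral_left[of t s l] by (auto simp: barycentric_def)

lemma point_mono: "barycentric s l \<Longrightarrow> s \<subseteq> t \<Longrightarrow> finite t \<Longrightarrow> point p t l = point p s l"
  unfolding point_def barycentric_def by (rule sum.mono_neutral_right) auto

lemma embeddedD:
  assumes "embedded p F" "s \<subseteq> s'" "s' \<in> F" "t \<subseteq> t'" "t' \<in> F"
    "barycentric s l" "barycentric t m" "point p s l = point p t m"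
  shows "l = m"
proof -
  have fin: "finite s'" "finite t'" using assms by (auto simp: embedded_def)
  have b: "barycentric s' l" "barycentric t' m"
    by (rule barycentric_mono[OF assms(6,2) fin(1)], rule barycentric_mono[OF assms(7,4) fin(2)])
  have p: "point p s' l = point p t' m"
    unfolding point_mono[OF assms(6,2) fin(1)] point_mono[OF assms(7,4) fin(2)] by (rule assms(8))
  show ?thesis
    using assms(1)[unfolded embedded_def, THEN conjunct2, rule_format, OF assms(3,5)] b p by blast
qed

lemma barycentric_vertex: "barycentric {v} (\<lambda>w. if w = v then 1 else 0)"
  and point_vertex: "point p {v} (\<lambda>w. if w = v then 1 else 0) = p v"
  by (auto simp: barycentric_def point_def)

lemma closed_segment_point:
  assumes "a \<noteq> b"
  shows "closed_segment (p a) (p b) = {point p {a, b} l | l. barycentric {a, b} l}" (is "_ = ?R")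
proof (intro equalityI subsetI)
  fix x assume "x \<in> closed_segment (p a) (p b)"
  then obtain u where u: "0 \<le> u" "u \<le> 1" "x = (1 - u) *\<^sub>R p a + u *\<^sub>R p b" by (auto simp: closed_segment_def)
  let ?l = "\<lambda>v. if v = a then 1 - u else if v = b then u else 0"
  have "barycentric {a, b} ?l" "x = point p {a, b} ?l"
    using u assms by (auto simp: barycentric_def point_def)
  then show "x \<in> ?R" by blast
next
  fix x assume "x \<in> ?R"
  then obtain l where l: "barycentric {a, b} l" "x = point p {a, b} l" by blast
  have s: "l a + l b = 1" and pos: "0 \<le> l a" "0 \<le> l b" using l(1) assms by (auto simp: barycentric_def)
  have "l a = 1 - l b" using s by simp
  then have "x = (1 - l b) *\<^sub>R p a + l b *\<^sub>R p b" using l(2) assms by (simp add: point_def)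
  then show "x \<in> closed_segment (p a) (p b)" using s pos by (auto simp: closed_segment_def intro!: exI[of _ "l b"])
qed

text \<open>An edge only has to be contained in a simplex, and simplices may have sides that are not
  edges. So triangles persist when an edge is deleted, and a rung can be drawn across such a
  side.\<close>

definition complex_drawing :: "'a set \<Rightarrow> 'a set set \<Rightarrow> ('a \<Rightarrow> complex) \<Rightarrow> 'a set set \<Rightarrow> bool" where
  "complex_drawing V E p F \<longleftrightarrow> embedded p F \<and> \<Union>F = V \<and> (\<forall>e\<in>E. \<exists>s\<in>F. e \<subseteq> s)"

text \<open>Edges become straight segments. A common point of two edges has the same coordinates in
  both, so these are supported on the at most one common vertex.\<close>

lemma planar_graph_complex_drawing:
  assumes simple: "simple_graph V E" and cd: "complex_drawing V E p F"
  shows "planar_graph V E"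
proof -
  have emb: "embedded p F" and cov: "\<And>v. v \<in> V \<Longrightarrow> \<exists>s\<in>F. {v} \<subseteq> s" "\<And>e. e \<in> E \<Longrightarrow> \<exists>s\<in>F. e \<subseteq> s"
    using cd by (auto simp: complex_drawing_def)
  define C where "C = (\<lambda>s. (\<exists>s'\<in>F. s \<subseteq> s'))"
  have uniq: "l = m" if "C s" "C t" "barycentric s l" "barycentric t m" "point p s l = point p t m" for s t l m
    using that embeddedD[OF emb] unfolding C_def by metis
  have C: "C {v}" if "v \<in> V" for v using cov(1)[OF that] by (simp add: C_def)
  have CE: "C e" if "e \<in> E" for e using cov(2)[OF that] by (simp add: C_def)
  have inj: "inj_on p V"
  proof (rule inj_onI)
    fix u v assume uv: "u \<in> V" "v \<in> V" "p u = p v"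
    have "(\<lambda>w. if w = u then 1 else 0) = (\<lambda>w. if w = v then 1 else (0::real))"
      by (rule uniq[OF C[OF uv(1)] C[OF uv(2)] barycentric_vertex barycentric_vertex]) (simp add: point_vertex uv)
    from fun_cong[OF this, of u] show "u = v" by (simp split: if_splits)
  qed
  \<comment> \<open>Edges are unordered, so a direction has to be chosen for each segment.\<close>
  define ends where "ends = (\<lambda>e::'a set. SOME ab. e = {fst ab, snd ab})"
  define \<gamma> where "\<gamma> = (\<lambda>e. linepath (p (fst (ends e))) (p (snd (ends e))))"
  have edge: "\<exists>a b. e = {a, b} \<and> a \<noteq> b \<and> a \<in> V \<and> b \<in> V \<and> \<gamma> e = linepath (p a) (p b)" if e: "e \<in> E" for e
  proof -
    obtain a b where "e = {a, b}" using simple e by (auto simp: simple_graph_def card_2_iff)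
    then have "\<exists>ab. e = {fst ab, snd ab}" by (intro exI[of _ "(a, b)"]) simp
    then have eq: "e = {fst (ends e), snd (ends e)}" unfolding ends_def by (rule someI_ex)
    define a' where "a' = fst (ends e)"
    define b' where "b' = snd (ends e)"
    have eq': "e = {a', b'}" using eq unfolding a'_def b'_def .
    have "card e = 2" "e \<subseteq> V" using simple e by (auto simp: simple_graph_def)
    then have "card {a', b'} = 2" "{a', b'} \<subseteq> V" unfolding eq'[symmetric] by auto
    then have "a' \<noteq> b'" "a' \<in> V" "b' \<in> V" by auto
    moreover have "\<gamma> e = linepath (p a') (p b')" by (simp add: \<gamma>_def a'_def b'_def)
    ultimately show ?thesis using eq' by blast
  qed
  have image: "path_image (\<gamma> e) = {point p e l | l. barycentric e l}" if "e \<in> E" for e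
    using edge[OF that] closed_segment_point[of _ _ p] by auto
  have sub: "p ` e \<subseteq> path_image (\<gamma> e)" if "e \<in> E" for e using edge[OF that] by auto
  have "plane_drawing V E p \<gamma>"
    unfolding plane_drawing_def
  proof (intro conjI ballI impI inj)
    fix e assume e: "e \<in> E"
    obtain a b where ab: "e = {a, b}" "a \<noteq> b" "a \<in> V" "b \<in> V" "\<gamma> e = linepath (p a) (p b)" using edge[OF e] by blast
    have "p a \<noteq> p b" using inj ab by (auto dest: inj_onD)
    then show "arc (\<gamma> e)" using ab by simp
    show "{pathstart (\<gamma> e), pathfinish (\<gamma> e)} = p ` e" using ab by auto
    show "path_image (\<gamma> e) \<inter> p ` V = p ` e"
    proof
      show "path_image (\<gamma> e) \<inter> p ` V \<subseteq> p ` e"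
      proof
        fix x assume "x \<in> path_image (\<gamma> e) \<inter> p ` V"
        then obtain l v where x: "x = point p e l" "barycentric e l" "x = p v" "v \<in> V" using image[OF e] by auto
        have "l = (\<lambda>w. if w = v then 1 else 0)"
          by (rule uniq[OF CE[OF e] C[OF x(4)] x(2) barycentric_vertex]) (simp add: point_vertex x flip: x(1))
        then have "l v = 1" by simp
        then have "v \<in> e" using x(2) by (auto simp: barycentric_def)
        then show "x \<in> p ` e" using x by blast
      qed
    qed (use sub[OF e] ab in auto)
  next
    fix e f assume ef: "e \<in> E" "f \<in> E" "e \<noteq> f"
    show "path_image (\<gamma> e) \<inter> path_image (\<gamma> f) = p ` (e \<inter> f)"
    proof
      show "path_image (\<gamma> e) \<inter> path_image (\<gamma> f) \<subseteq> p ` (e \<inter> f)"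
      proof
        fix x assume "x \<in> path_image (\<gamma> e) \<inter> path_image (\<gamma> f)"
        then have "x \<in> {point p e l | l. barycentric e l}" "x \<in> {point p f l | l. barycentric f l}"
          using image[OF ef(1)] image[OF ef(2)] by auto
        then obtain l m where x: "x = point p e l" "barycentric e l" "x = point p f m" "barycentric f m" by blast
        have "l = m" by (rule uniq[OF CE[OF ef(1)] CE[OF ef(2)] x(2,4)]) (use x in simp)
        then have supp: "l v = 0" if "v \<notin> e \<inter> f" for v using that x by (auto simp: barycentric_def)
        obtain a b where ab: "e = {a, b}" "a \<noteq> b" using edge[OF ef(1)] by blast
        have "\<not> e \<subseteq> f"
        proof
          assume "e \<subseteq> f"
          moreover have "card e = 2" "card f = 2" using simple ef by (auto simp: simple_graph_def)
          ultimately show False using ef(3) by (metis card_subset_eq card.infinite zero_neq_numeral)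
        qed
        then obtain u v where uv: "e = {u, v}" "u \<noteq> v" "v \<notin> f" using ab by blast
        then have "l v = 0" using supp by blast
        moreover have "l u + l v = 1" using x(2) uv by (simp add: barycentric_def)
        ultimately have "l u = 1" "l v = 0" by auto
        then have "u \<in> e \<inter> f" using supp[of u] by fastforce
        moreover have "x = p u" using x(1) uv \<open>l u = 1\<close> \<open>l v = 0\<close> by (simp add: point_def)
        ultimately show "x \<in> p ` (e \<inter> f)" by blast
      qed
    qed (use sub ef in blast)
  qed
  then show ?thesis using simple by (auto simp: planar_graph_def)
qed

section \<open>Stellar subdivision of an edge, and the insertions drawn by it\<close>

definition stellar :: "'a \<Rightarrow> 'a \<Rightarrow> 'a \<Rightarrow> 'a set set \<Rightarrow> 'a set set" where
  "stellar u v m F = {s \<in> F. \<not> {u, v} \<subseteq> s} \<union>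
     (\<lambda>s. insert m (s - {u})) ` {s \<in> F. {u, v} \<subseteq> s} \<union> (\<lambda>s. insert m (s - {v})) ` {s \<in> F. {u, v} \<subseteq> s}"

text \<open>Distributing the weight of \<open>m\<close> equally to \<open>u\<close> and \<open>v\<close> is injective on coordinates that vanish at
  \<open>u\<close> or \<open>v\<close>: the weight of \<open>m\<close> is twice the smaller of the new weights of \<open>u\<close> and \<open>v\<close>.\<close>

lemma embedded_stellar:
  assumes emb: "embedded p F" and uv: "u \<noteq> v" "m \<noteq> u" "m \<noteq> v" and m: "m \<notin> \<Union>F"
  shows "embedded (p(m := midpoint (p u) (p v))) (stellar u v m F)"
proof -
  define q where "q = p(m := midpoint (p u) (p v))"
  define push where "push = (\<lambda>l w. if w = m then 0 else l w + (if w = u \<or> w = v then l m / 2 else (0::real)))"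
  have finF: "finite s" if "s \<in> F" for s using emb that by (simp add: embedded_def)
  have split: "\<exists>t\<in>F. barycentric t (push l) \<and> point p t (push l) = point q s l \<and> (l u = 0 \<or> l v = 0)"
    if s: "s \<in> stellar u v m F" and l: "barycentric s l" for s l
  proof -
    have half: "\<exists>t\<in>F. barycentric t (push l) \<and> point p t (push l) = point q s l \<and> (l u = 0 \<or> l v = 0)"
      if t: "t \<in> F" "{u, v} \<subseteq> t" "s = insert m (t - {w})" "w = u \<or> w = v" for t w
    proof -
      have ft: "finite t" and mt: "m \<notin> t" using finF m t by auto
      have lw: "l w = 0" and pos: "\<And>v. l v \<ge> 0" and out: "\<And>v. v \<notin> s \<Longrightarrow> l v = 0"
        using l t uv by (auto simp: barycentric_def)
      have sw: "sum f t = sum f (t - {w})" if "f w = 0" for f :: "'a \<Rightarrow> 'b :: comm_monoid_add"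
        using that ft t by (intro sum.mono_neutral_right) auto
      have pushed: "(\<Sum>x\<in>t. push l x *\<^sub>R f x) = (\<Sum>x\<in>t. l x *\<^sub>R f x) + (l m / 2) *\<^sub>R (f u + f v)"
        for f :: "'a \<Rightarrow> 'b :: real_vector"
      proof -
        have "(\<Sum>x\<in>t. push l x *\<^sub>R f x) = (\<Sum>x\<in>t. l x *\<^sub>R f x + (if x \<in> {u, v} then (l m / 2) *\<^sub>R f x else 0))"
          by (rule sum.cong) (use mt in \<open>auto simp: push_def scaleR_add_left\<close>)
        also have "\<dots> = (\<Sum>x\<in>t. l x *\<^sub>R f x) + (\<Sum>x\<in>{u, v}. (l m / 2) *\<^sub>R f x)"
        proof -
          have "t \<inter> {x. x \<in> {u, v}} = {u, v}" using t(2) by auto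
          then show ?thesis unfolding sum.distrib using ft by (simp only: sum.If_cases) simp
        qed
        finally show ?thesis using uv by (simp add: scaleR_add_right)
      qed
      have "sum (push l) t = sum l t + l m"
        using pushed[of "\<lambda>_. 1::real"] by simp
      also have "sum l t = sum l (t - {w})" using sw lw by blast
      also have "\<dots> + l m = 1"
        using l ft mt t by (simp add: barycentric_def add.commute)
      finally have "barycentric t (push l)"
        using pos out t uv by (auto simp: barycentric_def push_def)
      moreover have "point p t (push l) = point q s l"
      proof -
        have "point p t (push l) = (\<Sum>x\<in>t. l x *\<^sub>R p x) + l m *\<^sub>R midpoint (p u) (p v)"
          unfolding point_def pushed by (simp add: midpoint_def)
        also have "(\<Sum>x\<in>t. l x *\<^sub>R p x) = (\<Sum>x\<in>t - {w}. l x *\<^sub>R p x)" using sw[of "\<lambda>x. l x *\<^sub>R p x"] lw by simp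
        also have "\<dots> = (\<Sum>x\<in>t - {w}. l x *\<^sub>R q x)" by (rule sum.cong) (use mt q_def in auto)
        finally show ?thesis unfolding point_def t(3) using ft mt by (simp add: q_def add.commute)
      qed
      ultimately show ?thesis using t lw by blast
    qed
    consider "s \<in> F" "\<not> {u, v} \<subseteq> s" | t w where "t \<in> F" "{u, v} \<subseteq> t" "s = insert m (t - {w})" "w = u \<or> w = v"
      using s unfolding stellar_def by blast
    then show ?thesis
    proof cases
      case 1
      then have "l m = 0" "l u = 0 \<or> l v = 0" using l m by (auto simp: barycentric_def)
      moreover have "push l = l" using \<open>l m = 0\<close> by (auto simp: push_def)
      moreover have "point p s l = point q s l"
        unfolding point_def by (rule sum.cong) (use 1 m q_def in auto)
      ultimately show ?thesis using 1 l by metis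
    qed (use half in blast)
  qed
  have recover: "l = k" if eq: "push l = push k" and zl: "l u = 0 \<or> l v = 0" and zk: "k u = 0 \<or> k v = 0"
    and pos: "\<And>v. l v \<ge> 0" "\<And>v. k v \<ge> 0" for l k
  proof
    fix w
    have "l u + l m / 2 = k u + k m / 2" "l v + l m / 2 = k v + k m / 2"
      using fun_cong[OF eq, of u] fun_cong[OF eq, of v] uv by (auto simp: push_def)
    then have "l m = k m" using zl zk pos(1)[of u] pos(1)[of v] pos(2)[of u] pos(2)[of v] by argo
    then show "l w = k w" using fun_cong[OF eq, of w] by (auto simp: push_def split: if_splits)
  qed
  show ?thesis
    unfolding q_def[symmetric] embedded_def
  proof (intro conjI ballI allI impI)
    show "finite s" if "s \<in> stellar u v m F" for s using that finF by (auto simp: stellar_def)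
    fix s t l k assume st: "s \<in> stellar u v m F" "t \<in> stellar u v m F"
      and lk: "barycentric s l \<and> barycentric t k \<and> point q s l = point q t k"
    obtain s' where s': "s' \<in> F" "barycentric s' (push l)" "point p s' (push l) = point q s l" "l u = 0 \<or> l v = 0"
      using split[OF st(1)] lk by blast
    obtain t' where t': "t' \<in> F" "barycentric t' (push k)" "point p t' (push k) = point q t k" "k u = 0 \<or> k v = 0"
      using split[OF st(2)] lk by blast
    have "point p s' (push l) = point p t' (push k)" using s'(3) t'(3) lk by simp
    then have "push l = push k" by (rule embeddedD[OF emb order_refl s'(1) order_refl t'(1) s'(2) t'(2)])
    then show "l = k" by (rule recover) (use s'(4) t'(4) lk in \<open>auto simp: barycentric_def\<close>)
  qed
qed

lemma stellar_covers:
  assumes "e \<subseteq> s" "s \<in> F" "\<not> {u, v} \<subseteq> e"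
  shows "\<exists>s'\<in>stellar u v m F. e \<subseteq> s'"
proof (cases "{u, v} \<subseteq> s")
  case True
  then have "insert m (s - {u}) \<in> stellar u v m F" "insert m (s - {v}) \<in> stellar u v m F"
    using assms(2) by (auto simp: stellar_def)
  moreover have "e \<subseteq> insert m (s - {u}) \<or> e \<subseteq> insert m (s - {v})" using assms by blast
  ultimately show ?thesis by blast
qed (use assms in \<open>auto simp: stellar_def\<close>)

text \<open>Old edges other than the subdivided one stay covered, so only for new edges a simplex
  has to be exhibited.\<close>

lemma complex_drawing_stellar:
  assumes cd: "complex_drawing V E p F" and uv: "u \<noteq> v" "{u, v} \<subseteq> s" "s \<in> F" and m: "m \<notin> V"
    and E': "\<And>e. e \<in> E' \<Longrightarrow> e \<in> E \<and> \<not> {u, v} \<subseteq> e \<or> (\<exists>s'\<in>stellar u v m F. e \<subseteq> s')"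
  shows "complex_drawing (insert m V) E' (p(m := midpoint (p u) (p v))) (stellar u v m F)"
proof -
  have *: "embedded p F" "\<Union>F = V" "\<And>e. e \<in> E \<Longrightarrow> \<exists>s\<in>F. e \<subseteq> s" using cd by (auto simp: complex_drawing_def)
  have "\<Union>(stellar u v m F) = insert m V"
  proof
    show "\<Union>(stellar u v m F) \<subseteq> insert m V" using *(2) by (auto simp: stellar_def)
    have "w \<in> \<Union>(stellar u v m F)" if w: "w \<in> V" for w
    proof -
      obtain s where "s \<in> F" "{w} \<subseteq> s" using *(2) w by blast
      then show ?thesis using stellar_covers[of "{w}" s F u v m] uv(1) by auto
    qed
    moreover have "m \<in> \<Union>(stellar u v m F)" using uv by (auto simp: stellar_def)
    ultimately show "insert m V \<subseteq> \<Union>(stellar u v m F)" by blast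
  qed
  moreover have "embedded (p(m := midpoint (p u) (p v))) (stellar u v m F)"
    by (rule embedded_stellar[OF *(1) uv(1)]) (use m uv *(2) in auto)
  moreover have "\<exists>s\<in>stellar u v m F. e \<subseteq> s" if "e \<in> E'" for e
    using E'[OF that] *(3)[of e] stellar_covers[of e] by blast
  ultimately show ?thesis by (simp add: complex_drawing_def)
qed

lemma stellarI:
  assumes "s \<in> F"
  shows "\<not> {u, v} \<subseteq> s \<Longrightarrow> s \<in> stellar u v m F"
    "{u, v} \<subseteq> s \<Longrightarrow> insert m (s - {u}) \<in> stellar u v m F"
    "{u, v} \<subseteq> s \<Longrightarrow> insert m (s - {v}) \<in> stellar u v m F"
  using assms by (auto simp: stellar_def)

lemma simple_graph_edge_eq:
  assumes "simple_graph V E" "e \<in> E" "q \<noteq> r" "{q, r} \<subseteq> e"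
  shows "e = {q, r}"
proof -
  have "card e = 2" using assms by (auto simp: simple_graph_def)
  moreover have "finite e" using calculation by (metis card.infinite zero_neq_numeral)
  moreover have "card {q, r} = 2" using assms(3) by simp
  ultimately show ?thesis using card_subset_eq[OF _ assms(4)] by simp
qed

text \<open>\<open>x\<close> is the midpoint of \<open>zw\<close> and \<open>y\<close> that of
  \<open>xw\<close>; each subdivision bisects the triangle on either side, which draws the edges to
  \<open>A\<close> and \<open>B\<close>. Both sides of \<open>xy\<close> are again empty triangles,
  ready for the next step.\<close>

lemma complex_drawing_path_insert:
  assumes simple: "simple_graph V E" and cd: "complex_drawing V E p F"
    and tri: "{z, w, A} \<in> F" "{z, w, B} \<in> F" and dist: "distinct [z, w, A, B]"
    and new: "x \<notin> V" "y \<notin> V" "x \<noteq> y"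
  shows "\<exists>p' F'. complex_drawing (V \<union> {x, y}) (path_insert E z w A B x y) p' F' \<and>
    {x, y, A} \<in> F' \<and> {x, y, B} \<in> F'"
proof -
  have FV: "\<And>s. s \<in> F \<Longrightarrow> s \<subseteq> V" using cd by (auto simp: complex_drawing_def)
  have in_V: "z \<in> V" "w \<in> V" "A \<in> V" "B \<in> V" using FV[OF tri(1)] FV[OF tri(2)] by auto
  have ne: "x \<noteq> z" "x \<noteq> w" "x \<noteq> A" "x \<noteq> B" "y \<noteq> z" "y \<noteq> w" "y \<noteq> A" "y \<noteq> B" using new in_V by auto
  define F1 where "F1 = stellar z w x F"
  define p1 where "p1 = p(x := midpoint (p z) (p w))"
  have t1: "{x, z, A} \<in> F1" "{x, w, A} \<in> F1" "{x, z, B} \<in> F1" "{x, w, B} \<in> F1"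
  proof -
    have "{z, w, A} - {w} = {z, A}" "{z, w, A} - {z} = {w, A}" "{z, w, B} - {w} = {z, B}" "{z, w, B} - {z} = {w, B}"
      using dist by auto
    then show "{x, z, A} \<in> F1" "{x, w, A} \<in> F1" "{x, z, B} \<in> F1" "{x, w, B} \<in> F1"
      using stellarI(2,3)[OF tri(1), of z w x] stellarI(2,3)[OF tri(2), of z w x] unfolding F1_def by auto
  qed
  have old: "\<exists>s\<in>F1. e \<subseteq> s" if e: "e \<in> E - {{z, w}}" for e
  proof -
    obtain s where "s \<in> F" "e \<subseteq> s" using cd e unfolding complex_drawing_def by blast
    moreover have "\<not> {z, w} \<subseteq> e" using simple_graph_edge_eq[OF simple, of e z w] e dist by auto
    ultimately show ?thesis unfolding F1_def by (intro stellar_covers)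
  qed
  have cd1: "complex_drawing (insert x V) (E - {{z, w}}) p1 F1"
    unfolding F1_def p1_def
    by (rule complex_drawing_stellar[OF cd _ _ tri(1)]) (use dist new old F1_def in auto)
  define F2 where "F2 = stellar x w y F1"
  have t2: "{y, x, A} \<in> F2" "{y, w, A} \<in> F2" "{y, x, B} \<in> F2" "{y, w, B} \<in> F2" "{x, z, A} \<in> F2"
  proof -
    have "{x, w, A} - {w} = {x, A}" "{x, w, A} - {x} = {w, A}" "{x, w, B} - {w} = {x, B}" "{x, w, B} - {x} = {w, B}"
      using dist ne by auto
    then show "{y, x, A} \<in> F2" "{y, w, A} \<in> F2" "{y, x, B} \<in> F2" "{y, w, B} \<in> F2"
      using stellarI(2,3)[OF t1(2), of x w y] stellarI(2,3)[OF t1(4), of x w y] unfolding F2_def by auto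
    show "{x, z, A} \<in> F2" using stellarI(1)[OF t1(1), of x w y] dist ne unfolding F2_def by auto
  qed
  have cover: "e \<in> E - {{z, w}} \<and> \<not> {x, w} \<subseteq> e \<or> (\<exists>s'\<in>stellar x w y F1. e \<subseteq> s')" if e: "e \<in> path_insert E z w A B x y" for e
  proof -
    have "e \<in> E - {{z, w}} \<or> e \<in> {{z, x}, {x, y}, {y, w}, {x, A}, {x, B}, {y, A}, {y, B}}"
      using e unfolding path_insert_def by (simp only: Un_iff)
    then show ?thesis
    proof
      assume 1: "e \<in> E - {{z, w}}"
      then have "e \<subseteq> V" using simple by (simp add: simple_graph_def)
      then have "\<not> {x, w} \<subseteq> e" using new(1) by blast
      then show ?thesis using 1 by simp
    next
      assume 2: "e \<in> {{z, x}, {x, y}, {y, w}, {x, A}, {x, B}, {y, A}, {y, B}}"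
      have b: "\<exists>s'\<in>F2. e \<subseteq> s'" if "T \<in> F2" "e \<subseteq> T" for T using that by (rule bexI[rotated])
      have "e \<subseteq> {x, z, A} \<or> e \<subseteq> {y, x, A} \<or> e \<subseteq> {y, w, A} \<or> e \<subseteq> {y, x, B}" using 2 by auto
      then have "\<exists>s'\<in>F2. e \<subseteq> s'" by (elim disjE) (rule b[OF t2(5)] b[OF t2(1)] b[OF t2(2)] b[OF t2(3)], assumption)+
      then show ?thesis unfolding F2_def by simp
    qed
  qed
  have cd2: "complex_drawing (insert y (insert x V)) (path_insert E z w A B x y) (p1(y := midpoint (p1 x) (p1 w))) F2"
    unfolding F2_def by (rule complex_drawing_stellar[OF cd1 ne(2) _ t1(2) _ cover]) (use new in auto)
  have eq: "insert y (insert x V) = V \<union> {x, y}" by auto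
  have t3: "{x, y, A} \<in> F2" "{x, y, B} \<in> F2" using t2 by (simp_all add: insert_commute)
  show ?thesis by (intro exI conjI) (fact cd2[unfolded eq], fact t3(1), fact t3(2))
qed

text \<open>The rung crosses the quadrilateral \<open>a b d c\<close>, so \<open>y\<close> is placed on the diagonal from \<open>b\<close> to \<open>c\<close>, which is not
  an edge, and \<open>x\<close> on the edge from \<open>a\<close> to \<open>b\<close>.\<close>

lemma complex_drawing_rung_insert:
  assumes simple: "simple_graph V E" and cd: "complex_drawing V E p F"
    and tri: "{a, b, c} \<in> F" "{b, c, d} \<in> F" and dist: "distinct [a, b, c, d]" and bc: "{b, c} \<notin> E"
    and new: "x \<notin> V" "y \<notin> V" "x \<noteq> y"
  shows "\<exists>p' F'. complex_drawing (V \<union> {x, y}) (rung_insert E a b c d x y) p' F' \<and>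
    {x, b, y} \<in> F' \<and> {b, y, d} \<in> F'"
proof -
  have FV: "\<And>s. s \<in> F \<Longrightarrow> s \<subseteq> V" using cd by (auto simp: complex_drawing_def)
  have in_V: "a \<in> V" "b \<in> V" "c \<in> V" "d \<in> V" using FV[OF tri(1)] FV[OF tri(2)] by auto
  have ne: "x \<noteq> a" "x \<noteq> b" "x \<noteq> c" "x \<noteq> d" "y \<noteq> a" "y \<noteq> b" "y \<noteq> c" "y \<noteq> d" using new in_V by auto
  have ab: "a \<noteq> b" using dist by simp
  define F1 where "F1 = stellar b c y F"
  define p1 where "p1 = p(y := midpoint (p b) (p c))"
  have t1: "{y, a, b} \<in> F1" "{y, a, c} \<in> F1" "{y, b, d} \<in> F1" "{y, c, d} \<in> F1"
  proof -
    have "{a, b, c} - {b} = {a, c}" "{a, b, c} - {c} = {a, b}" "{b, c, d} - {b} = {c, d}" "{b, c, d} - {c} = {b, d}"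
      using dist by auto
    then show "{y, a, b} \<in> F1" "{y, a, c} \<in> F1" "{y, b, d} \<in> F1" "{y, c, d} \<in> F1"
      using stellarI(2,3)[OF tri(1), of b c y] stellarI(2,3)[OF tri(2), of b c y] unfolding F1_def by auto
  qed
  have pair: "\<not> {q, r} \<subseteq> e" if "e \<in> E" "{q, r} \<noteq> e" "q \<noteq> r" for q r e
    using simple_graph_edge_eq[OF simple that(1,3)] that(2) by auto
  have old: "e \<in> E \<and> \<not> {b, c} \<subseteq> e" if "e \<in> E" for e
    using pair[OF that, of b c] that bc dist by auto
  have cd1: "complex_drawing (insert y V) E p1 F1"
    unfolding F1_def p1_def
    by (rule complex_drawing_stellar[OF cd _ _ tri(1)]) (use dist new old in auto)
  \<comment> \<open>The edge \<open>ab\<close> leaves the graph, but its segment remains a side of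
    the triangle that is subdivided next.\<close>
  have cd1': "complex_drawing (insert y V) (E - {{a, b}}) p1 F1"
    using cd1 by (auto simp: complex_drawing_def)
  define F2 where "F2 = stellar a b x F1"
  have t2: "{x, y, a} \<in> F2" "{x, y, b} \<in> F2" "{y, c, d} \<in> F2" "{y, b, d} \<in> F2"
  proof -
    have "{y, a, b} - {a} = {y, b}" "{y, a, b} - {b} = {y, a}" using dist ne by auto
    then show "{x, y, a} \<in> F2" "{x, y, b} \<in> F2"
      using stellarI(2,3)[OF t1(1), of a b x] unfolding F2_def by auto
    show "{y, c, d} \<in> F2" "{y, b, d} \<in> F2"
      using stellarI(1)[OF t1(4), of a b x] stellarI(1)[OF t1(3), of a b x] dist ne unfolding F2_def by auto
  qed
  have cover: "e \<in> E - {{a, b}} \<and> \<not> {a, b} \<subseteq> e \<or> (\<exists>s'\<in>stellar a b x F1. e \<subseteq> s')" if e: "e \<in> rung_insert E a b c d x y" for e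
  proof -
    have "e \<in> E - {{a, b}, {c, d}} \<or> e \<in> {{a, x}, {x, b}, {c, y}, {y, d}, {x, y}}"
      using e unfolding rung_insert_def by (simp only: Un_iff)
    then show ?thesis
    proof
      assume 1: "e \<in> E - {{a, b}, {c, d}}"
      then show ?thesis using pair[of e a b] dist by auto
    next
      assume 2: "e \<in> {{a, x}, {x, b}, {c, y}, {y, d}, {x, y}}"
      have b: "\<exists>s'\<in>F2. e \<subseteq> s'" if "T \<in> F2" "e \<subseteq> T" for T using that by (rule bexI[rotated])
      have "e \<subseteq> {x, y, a} \<or> e \<subseteq> {x, y, b} \<or> e \<subseteq> {y, c, d}" using 2 by auto
      then have "\<exists>s'\<in>F2. e \<subseteq> s'" by (elim disjE) (rule b[OF t2(1)] b[OF t2(2)] b[OF t2(3)], assumption)+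
      then show ?thesis unfolding F2_def by simp
    qed
  qed
  have cd2: "complex_drawing (insert x (insert y V)) (rung_insert E a b c d x y) (p1(x := midpoint (p1 a) (p1 b))) F2"
    unfolding F2_def by (rule complex_drawing_stellar[OF cd1' ab _ t1(1) _ cover]) (use new in auto)
  have eq: "insert x (insert y V) = V \<union> {x, y}" by auto
  have t3: "{x, b, y} \<in> F2" "{b, y, d} \<in> F2" using t2 by (simp_all add: insert_commute)
  show ?thesis by (intro exI conjI) (fact cd2[unfolded eq], fact t3(1), fact t3(2))
qed

section \<open>Executable certificates\<close>

definition edges_of :: "(nat \<times> nat) list \<Rightarrow> nat set set" where
  "edges_of es = (\<lambda>(u, v). {u, v}) ` set es"

text \<open>Listing each edge once and in increasing order turns cardinalities of edge sets into
  lengths of lists and excludes loops.\<close>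

definition ordered_pairs :: "nat \<Rightarrow> (nat \<times> nat) list \<Rightarrow> bool" where
  "ordered_pairs n es \<longleftrightarrow> distinct es \<and> list_all (\<lambda>(u, v). u < v \<and> v < n) es"

definition degree_in :: "(nat \<times> nat) list \<Rightarrow> nat \<Rightarrow> nat" where
  "degree_in es v = length (filter (\<lambda>(a, b). a = v \<or> b = v) es)"

lemma ordered_pairsD: "ordered_pairs n es \<Longrightarrow> (u, v) \<in> set es \<Longrightarrow> u < v \<and> v < n"
  by (auto simp: ordered_pairs_def list_all_iff)

lemma edges_of_iff: "{u, v} \<in> edges_of es \<longleftrightarrow> (u, v) \<in> set es \<or> (v, u) \<in> set es"
proof
  assume "{u, v} \<in> edges_of es"
  then obtain a b where "(a, b) \<in> set es" "{u, v} = {a, b}" by (auto simp: edges_of_def)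
  then show "(u, v) \<in> set es \<or> (v, u) \<in> set es" by (auto simp: doubleton_eq_iff)
qed (auto simp: edges_of_def insert_commute intro: rev_image_eqI)

lemma edges_ofE:
  assumes "e \<in> edges_of es"
  obtains a b where "e = {a, b}" "(a, b) \<in> set es"
  using assms by (auto simp: edges_of_def)

lemma inj_edges: "ordered_pairs n es \<Longrightarrow> inj_on (\<lambda>(u, v). {u, v}) (set es)"
proof (rule inj_onI)
  fix e f assume *: "ordered_pairs n es" "e \<in> set es" "f \<in> set es" "(\<lambda>(u, v). {u, v}) e = (\<lambda>(u, v). {u, v}) f"
  obtain a b c d where "e = (a, b)" "f = (c, d)" by fastforce
  then show "e = f" using * ordered_pairsD[of n es a b] ordered_pairsD[of n es c d] by (auto simp: doubleton_eq_iff)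
qed

lemma simple_graph_edges_of: "ordered_pairs n es \<Longrightarrow> simple_graph {..<n} (edges_of es)"
  by (auto simp: simple_graph_def edges_of_def dest!: ordered_pairsD)

lemma card_edges_of:
  assumes "ordered_pairs n es"
  shows "card (edges_of es) = length es"
  using assms card_image[OF inj_edges[OF assms]] by (simp add: edges_of_def distinct_card ordered_pairs_def)

lemma vdegree_edges_of:
  assumes "ordered_pairs n es"
  shows "vdegree (edges_of es) v = degree_in es v"
proof -
  let ?es = "filter (\<lambda>(a, b). a = v \<or> b = v) es"
  have "{e \<in> edges_of es. v \<in> e} = edges_of ?es" by (auto simp: edges_of_def)
  moreover have "ordered_pairs n ?es" using assms by (auto simp: ordered_pairs_def list_all_iff)
  ultimately show ?thesis by (simp add: vdegree_def degree_in_def card_edges_of)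
qed

lemma card_filter_upt: "card {v \<in> {..<n}. P v} = length (filter P [0..<n])"
proof -
  have "{v \<in> {..<n}. P v} = set (filter P [0..<n])" by auto
  then show ?thesis by (simp only: distinct_card distinct_filter distinct_upt)
qed

section \<open>Certified three-connectedness\<close>

fun sweep :: "(nat \<times> nat) list \<Rightarrow> nat list \<Rightarrow> nat list" where
  "sweep [] r = r"
| "sweep ((u, v) # es) r =
    (if u \<in> set r then if v \<in> set r then sweep es r else sweep es (v # r)
     else if v \<in> set r then sweep es (u # r) else sweep es r)"

text \<open>The first argument is fuel. In a connected graph every unfinished pass adds a vertex, so
  as many passes as vertices suffice; a positive answer is sound for any fuel.\<close>

fun spans :: "nat list \<Rightarrow> (nat \<times> nat) list \<Rightarrow> nat list \<Rightarrow> nat list \<Rightarrow> bool" where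
  "spans [] es vs r = list_all (\<lambda>v. v \<in> set r) vs"
| "spans (_ # fuel) es vs r = (list_all (\<lambda>v. v \<in> set r) vs \<or> spans fuel es vs (sweep es r))"

definition connected_check :: "nat \<Rightarrow> (nat \<times> nat) list \<Rightarrow> nat list \<Rightarrow> bool" where
  "connected_check n es S = (case filter (\<lambda>v. v \<notin> set S) [0..<n] of [] \<Rightarrow> False
     | r # vs \<Rightarrow> spans [0..<n] (filter (\<lambda>(u, v). u \<notin> set S \<and> v \<notin> set S) es) vs [r])"

text \<open>The pairs with \<open>a = b\<close> stand for the deletion of a single vertex.\<close>

definition three_connected_check :: "nat \<Rightarrow> (nat \<times> nat) list \<Rightarrow> bool" where
  "three_connected_check n es \<longleftrightarrow> 3 < n \<and> connected_check n es [] \<and>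
     list_all (\<lambda>a. list_all (\<lambda>b. connected_check n es [a, b]) [a..<n]) [0..<n]"

lemma sweep_reach:
  assumes "\<And>u v. (u, v) \<in> set es \<Longrightarrow> {u, v} \<in> E" "\<And>x. x \<in> set r \<Longrightarrow> reach E w x"
  shows "x \<in> set (sweep es r) \<Longrightarrow> reach E w x"
  using assms
proof (induction es r rule: sweep.induct)
  case (2 u v es r)
  have uv1: "reach E u v" by (rule reach_edge) (use 2(6)[of u v] in simp)
  note uv = uv1 reach_sym[OF uv1]
  have sub: "\<And>a b. (a, b) \<in> set es \<Longrightarrow> {a, b} \<in> E" using 2(6) by auto
  have *: "reach E w y" if "u \<in> set r \<or> v \<in> set r" "y \<in> set r \<or> y = u \<or> y = v" for y
  proof -
    have "reach E w u" "reach E w v" using that(1) 2(7) reach_trans[OF _ uv(1)] reach_trans[OF _ uv(2)] by blast+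
    then show ?thesis using that(2) 2(7) by blast
  qed
  show ?case
  proof (cases "u \<in> set r"; cases "v \<in> set r")
    assume "u \<in> set r" "v \<in> set r"
    then show ?thesis using 2(1,5) sub 2(7) by simp
  next
    assume "u \<in> set r" "v \<notin> set r"
    then show ?thesis using 2(2,5) sub * by auto
  next
    assume "u \<notin> set r" "v \<in> set r"
    then show ?thesis using 2(3,5) sub * by auto
  next
    assume "u \<notin> set r" "v \<notin> set r"
    then show ?thesis using 2(4,5) sub 2(7) by simp
  qed
qed simp

lemma spans_reach:
  assumes "\<And>u v. (u, v) \<in> set es \<Longrightarrow> {u, v} \<in> E" "\<And>x. x \<in> set r \<Longrightarrow> reach E w x"
  shows "spans fuel es vs r \<Longrightarrow> v \<in> set vs \<Longrightarrow> reach E w v"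
  using assms
proof (induction fuel es vs r rule: spans.induct)
  case (2 f fuel es vs r)
  show ?case
  proof (cases "list_all (\<lambda>v. v \<in> set r) vs")
    case True
    then show ?thesis using 2 by (auto simp: list_all_iff)
  next
    case False
    then have "spans fuel es vs (sweep es r)" using 2(2) by simp
    then show ?thesis using 2(1)[OF _ 2(3,4)] sweep_reach[OF 2(4,5)] by blast
  qed
qed (auto simp: list_all_iff)

lemma connected_check_correct:
  assumes "connected_check n es S"
  shows "connected_graph ({..<n} - set S) {e \<in> edges_of es. e \<inter> set S = {}}"
proof -
  let ?E = "{e \<in> edges_of es. e \<inter> set S = {}}"
  obtain r vs where rvs: "filter (\<lambda>v. v \<notin> set S) [0..<n] = r # vs"
    and sp: "spans [0..<n] (filter (\<lambda>(u, v). u \<notin> set S \<and> v \<notin> set S) es) vs [r]"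
    using assms unfolding connected_check_def by (auto split: list.splits)
  have V: "{..<n} - set S = insert r (set vs)" using arg_cong[OF rvs, of set] by auto
  have r: "reach ?E r v" if "v \<in> insert r (set vs)" for v
  proof (cases "v = r")
    case False
    show ?thesis
      by (rule spans_reach[OF _ _ sp]) (use that False in \<open>auto simp: edges_of_def\<close>)
  qed simp
  have "reach ?E u v" if "u \<in> insert r (set vs)" "v \<in> insert r (set vs)" for u v
    by (rule reach_trans[OF reach_sym[OF r[OF that(1)]] r[OF that(2)]])
  then show ?thesis unfolding connected_graph_reach V by blast
qed

lemma three_connected_check_correct:
  assumes "three_connected_check n es"
  shows "k_connected 3 {..<n} (edges_of es)"
  unfolding k_connected_def
proof (intro conjI allI impI)
  show "3 < card {..<n}" using assms by (simp add: three_connected_check_def)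
  fix S assume S: "S \<subseteq> {..<n}" "card S < 3"
  have fS: "finite S" using S finite_subset by blast
  have pair: "connected_check n es [a, b]" if "a \<le> b" "b < n" for a b
    using assms that by (auto simp: three_connected_check_def list_all_iff)
  consider "S = {}" | a b where "S = {a, b}" "a \<le> b" "b < n"
  proof -
    have "card S = 0 \<or> card S = 1 \<or> card S = 2" using S by auto
    then show thesis
    proof (elim disjE)
      assume "card S = 0" then show thesis using that fS by simp
    next
      assume "card S = 1"
      then obtain a where "S = {a}" by (auto simp: card_1_singleton_iff)
      then show thesis using that(2)[of a a] S by auto
    next
      assume "card S = 2"
      then obtain a b where "S = {a, b}" by (auto simp: card_2_iff)
      then show thesis using that(2)[of a b] that(2)[of b a] S by (cases "a \<le> b") (auto simp: insert_commute)
    qed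
  qed
  then show "connected_graph ({..<n} - S) {e \<in> edges_of es. e \<inter> S = {}}"
  proof cases
    case 1
    then show ?thesis using assms connected_check_correct[of n es "[]"] by (simp add: three_connected_check_def)
  next
    case (2 a b)
    then show ?thesis using connected_check_correct[OF pair[OF 2(2,3)]] by simp
  qed
qed

section \<open>Certified matching numbers\<close>

definition other :: "nat \<Rightarrow> nat \<times> nat \<Rightarrow> nat" where
  "other v e = (if fst e = v then snd e else fst e)"

definition avoid :: "nat \<Rightarrow> (nat \<times> nat) list \<Rightarrow> (nat \<times> nat) list" where
  "avoid v es = filter (\<lambda>(a, b). a \<noteq> v \<and> b \<noteq> v) es"

text \<open>Executes the expansion of \<open>pmc_expand\<close> at the first remaining vertex,
  pruning the edge list on the way.\<close>

function matchings :: "nat list \<Rightarrow> (nat \<times> nat) list \<Rightarrow> nat" where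
  "matchings [] es = 1"
| "matchings (v # vs) es = sum_list (map (\<lambda>e. matchings (remove1 (other v e) vs) (avoid (other v e) (avoid v es)))
     (filter (\<lambda>(a, b). a = v \<or> b = v) es))"
  by pat_completeness auto
termination by (relation "Wellfounded.measure (\<lambda>(vs, es). length vs)") (auto simp: length_remove1)

lemma avoid_ordered: "ordered_pairs n es \<Longrightarrow> ordered_pairs n (avoid v es)"
  by (auto simp: ordered_pairs_def avoid_def list_all_iff)

text \<open>The ordered edges at \<open>v\<close> correspond one to one to its neighbours, which
  turns the sum over the edge list into that of \<open>pmc_expand\<close>. Pruning is harmless
  because \<open>pmc\<close> ignores edges that leave the vertex set.\<close>

lemma matchings_correct:
  assumes "distinct vs" "ordered_pairs n es" "\<And>a b. (a, b) \<in> set es \<Longrightarrow> a \<in> set vs \<and> b \<in> set vs"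
  shows "matchings vs es = pmc (set vs) (edges_of es)"
  using assms
proof (induction vs es rule: matchings.induct)
  case (1 es)
  have "{} \<notin> edges_of es" by (auto simp: edges_of_def)
  then show ?case by (simp add: pmc_empty)
next
  case (2 v vs es)
  note ord = 2(3)
  let ?I = "filter (\<lambda>(a, b). a = v \<or> b = v) es"
  have two: "card e = 2" if "e \<in> edges_of es" for e
    using simple_graph_edges_of[OF ord] that by (auto simp: simple_graph_def)
  have v: "v \<notin> set vs" "distinct vs" using 2(2) by auto
  have step: "matchings (remove1 (other v e) vs) (avoid (other v e) (avoid v es)) =
      pmc (set (v # vs) - {v, other v e}) (edges_of es)" if e: "e \<in> set ?I" for e
  proof -
    let ?u = "other v e"
    have "matchings (remove1 ?u vs) (avoid ?u (avoid v es)) = pmc (set (remove1 ?u vs)) (edges_of (avoid ?u (avoid v es)))"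
    proof (rule 2(1)[OF e])
      show "distinct (remove1 ?u vs)" using v by simp
      show "ordered_pairs n (avoid ?u (avoid v es))" using ord avoid_ordered by blast
      fix a b assume "(a, b) \<in> set (avoid ?u (avoid v es))"
      then show "a \<in> set (remove1 ?u vs) \<and> b \<in> set (remove1 ?u vs)"
        using 2(4)[of a b] v by (auto simp: avoid_def)
    qed
    also have "set (remove1 ?u vs) = set (v # vs) - {v, ?u}" using v by auto
    also have "pmc \<dots> (edges_of (avoid ?u (avoid v es))) = pmc \<dots> (edges_of es)"
      by (rule pmc_cong) (auto simp: edges_of_def avoid_def)
    finally show ?thesis .
  qed
  have inj: "inj_on (other v) (set ?I)"
  proof (rule inj_onI)
    fix e f assume ef: "e \<in> set ?I" "f \<in> set ?I" "other v e = other v f"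
    obtain a b c d where "e = (a, b)" "f = (c, d)" by fastforce
    then show "e = f" using ef ordered_pairsD[OF ord, of a b] ordered_pairsD[OF ord, of c d]
      by (auto simp: other_def split: if_splits)
  qed
  have img: "other v ` set ?I = {u \<in> set (v # vs). {v, u} \<in> edges_of es}"
  proof (intro equalityI subsetI)
    fix u assume "u \<in> other v ` set ?I"
    then obtain a b where "(a, b) \<in> set es" "a = v \<or> b = v" "u = other v (a, b)" by auto
    then show "u \<in> {u \<in> set (v # vs). {v, u} \<in> edges_of es}"
      using 2(4)[of a b] edges_of_iff[of v u es] by (auto simp: other_def split: if_splits)
  next
    fix u assume "u \<in> {u \<in> set (v # vs). {v, u} \<in> edges_of es}"
    then have "(v, u) \<in> set ?I \<or> (u, v) \<in> set ?I" using edges_of_iff[of v u es] by auto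
    moreover have "u \<noteq> v" using \<open>u \<in> _\<close> two[of "{v, u}"] by auto
    ultimately show "u \<in> other v ` set ?I" by (force simp: other_def image_iff)
  qed
  have "matchings (v # vs) es = (\<Sum>e\<leftarrow>?I. pmc (set (v # vs) - {v, other v e}) (edges_of es))"
    unfolding matchings.simps by (intro arg_cong[of _ _ sum_list] map_cong refl step)
  also have "\<dots> = (\<Sum>e\<in>set ?I. pmc (set (v # vs) - {v, other v e}) (edges_of es))"
    using ord by (intro sum_list_distinct_conv_sum_set) (simp add: ordered_pairs_def)
  also have "\<dots> = (\<Sum>u\<in>other v ` set ?I. pmc (set (v # vs) - {v, u}) (edges_of es))"
    unfolding sum.reindex[OF inj] by (simp only: comp_def)
  also have "\<dots> = pmc (set (v # vs)) (edges_of es)"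
    unfolding img by (rule pmc_expand[symmetric]) (use two in auto)
  finally show ?case .
qed

text \<open>These are the numbers in the slot conditions, with the slot edges as \<open>D\<close>
  and the removed vertices as \<open>S\<close>.\<close>

definition count_without :: "nat \<Rightarrow> (nat \<times> nat) list \<Rightarrow> (nat \<times> nat) list \<Rightarrow> nat list \<Rightarrow> nat" where
  "count_without n es D S = matchings (filter (\<lambda>v. v \<notin> set S) [0..<n])
     (filter (\<lambda>(u, v). u \<notin> set S \<and> v \<notin> set S \<and> (u, v) \<notin> set D \<and> (v, u) \<notin> set D) es)"

lemma count_without_correct:
  assumes ord: "ordered_pairs n es"
  shows "pmc ({..<n} - set S) (edges_of es - edges_of D) = count_without n es D S"
proof -
  let ?vs = "filter (\<lambda>v. v \<notin> set S) [0..<n]"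
  let ?es = "filter (\<lambda>(u, v). u \<notin> set S \<and> v \<notin> set S \<and> (u, v) \<notin> set D \<and> (v, u) \<notin> set D) es"
  have "count_without n es D S = pmc (set ?vs) (edges_of ?es)"
    unfolding count_without_def
  proof (rule matchings_correct)
    show "distinct ?vs" by simp
    show "ordered_pairs n ?es" using ord by (auto simp: ordered_pairs_def list_all_iff)
    show "a \<in> set ?vs \<and> b \<in> set ?vs" if "(a, b) \<in> set ?es" for a b
      using that ordered_pairsD[OF ord, of a b] by auto
  qed
  also have "set ?vs = {..<n} - set S" by auto
  also have "pmc \<dots> (edges_of ?es) = pmc \<dots> (edges_of es - edges_of D)"
  proof (rule pmc_cong)
    fix e assume "e \<subseteq> {..<n} - set S"
    then have eS: "v \<notin> set S" if "v \<in> e" for v using that by blast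
    show "e \<in> edges_of ?es \<longleftrightarrow> e \<in> edges_of es - edges_of D"
    proof
      assume "e \<in> edges_of ?es"
      then obtain a b where ab: "e = {a, b}" "(a, b) \<in> set ?es" by (rule edges_ofE)
      then show "e \<in> edges_of es - edges_of D" unfolding ab(1) Diff_iff edges_of_iff by auto
    next
      assume e: "e \<in> edges_of es - edges_of D"
      then obtain a b where ab: "e = {a, b}" "(a, b) \<in> set es" by (auto elim: edges_ofE)
      then have "a \<notin> set S" "b \<notin> set S" using eS by auto
      then show "e \<in> edges_of ?es" using ab e unfolding ab(1) Diff_iff edges_of_iff by auto
    qed
  qed
  finally show ?thesis by simp
qed

section \<open>Certified straight-line embeddings\<close>

text \<open>Twice the signed area of the triangle \<open>P Q R\<close>; integer coordinates keep the
  test exact.\<close>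

definition turn :: "int \<times> int \<Rightarrow> int \<times> int \<Rightarrow> int \<times> int \<Rightarrow> int" where
  "turn P Q R = (fst Q - fst P) * (snd R - snd P) - (snd Q - snd P) * (fst R - fst P)"

definition grid :: "(int \<times> int) list \<Rightarrow> nat \<Rightarrow> complex" where
  "grid cs v = Complex (of_int (fst (cs ! v))) (of_int (snd (cs ! v)))"

type_synonym labelled = "(nat \<times> int \<times> int) list"

definition label :: "(int \<times> int) list \<Rightarrow> nat list \<Rightarrow> labelled" where
  "label cs s = map (\<lambda>v. (v, cs ! v)) s"

definition among :: "labelled \<Rightarrow> nat \<Rightarrow> bool" where
  "among s v = list_ex (\<lambda>(w, _). w = v) s"

text \<open>Separation by an oriented line that may contain vertices of \<open>s\<close> but none of \<open>t\<close> outside \<open>s\<close>.\<close>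

definition separated :: "labelled \<Rightarrow> labelled \<Rightarrow> bool" where
  "separated s t \<longleftrightarrow> list_ex (\<lambda>(_, P). list_ex (\<lambda>(_, Q).
     list_all (\<lambda>(v, R). among s v \<or> turn P Q R < 0) t \<and>
     list_all (\<lambda>(v, R). if among t v then turn P Q R = 0 else 0 \<le> turn P Q R) s) (s @ t)) (s @ t)"

definition subface :: "labelled \<Rightarrow> labelled \<Rightarrow> bool" where
  "subface s t \<longleftrightarrow> list_all (\<lambda>(v, _). among t v) s"

definition compatible :: "labelled \<Rightarrow> labelled \<Rightarrow> bool" where
  "compatible s t \<longleftrightarrow> subface s t \<or> subface t s \<or> separated s t \<or> separated t s"

fun all_pairs :: "('a \<Rightarrow> 'a \<Rightarrow> bool) \<Rightarrow> 'a list \<Rightarrow> bool" where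
  "all_pairs R [] = True"
| "all_pairs R (s # ss) = (list_all (R s) ss \<and> all_pairs R ss)"

fun nondegenerate :: "labelled \<Rightarrow> bool" where
  "nondegenerate [(_, P), (_, Q)] = (P \<noteq> Q)"
| "nondegenerate [(_, P), (_, Q), (_, R)] = (turn P Q R \<noteq> 0)"
| "nondegenerate _ = False"

definition embedding_check :: "(int \<times> int) list \<Rightarrow> nat list list \<Rightarrow> bool" where
  "embedding_check cs ss \<longleftrightarrow> (let ls = map (label cs) ss in list_all nondegenerate ls \<and> all_pairs compatible ls)"

text \<open>Apart from the edges only the listed triangles are certified empty: they are the ones in
  which insertions take place.\<close>

definition drawing_check :: "nat \<Rightarrow> (nat \<times> nat) list \<Rightarrow> (int \<times> int) list \<Rightarrow> nat list list \<Rightarrow> bool" where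
  "drawing_check n es cs tris \<longleftrightarrow> embedding_check cs (map (\<lambda>(u, v). [u, v]) es @ tris) \<and>
     list_all (\<lambda>v. list_ex (\<lambda>(a, b). a = v \<or> b = v) es) [0..<n] \<and> list_all (list_all (\<lambda>v. v < n)) tris"

lemma all_pairsD: "all_pairs R xs \<Longrightarrow> x \<in> set xs \<Longrightarrow> y \<in> set xs \<Longrightarrow> x = y \<or> R x y \<or> R y x"
  by (induction xs) (auto simp: list_all_iff)

definition turnc :: "complex \<Rightarrow> complex \<Rightarrow> complex \<Rightarrow> real" where
  "turnc a b z = (Re b - Re a) * (Im z - Im a) - (Im b - Im a) * (Re z - Re a)"

lemma turnc_grid: "turnc (grid cs u) (grid cs v) (grid cs w) = of_int (turn (cs ! u) (cs ! v) (cs ! w))"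
  by (simp add: turnc_def turn_def grid_def)

text \<open>For fixed \<open>a\<close> and \<open>b\<close> the function \<open>turnc a b\<close> is
  affine, and the weights sum to one.\<close>

lemma turnc_point:
  assumes "barycentric s l"
  shows "turnc a b (point p s l) = (\<Sum>v\<in>s. l v * turnc a b (p v))"
proof -
  have re: "Re (point p s l) = (\<Sum>v\<in>s. l v * Re (p v))" and im: "Im (point p s l) = (\<Sum>v\<in>s. l v * Im (p v))"
    by (simp_all add: point_def)
  have "(\<Sum>v\<in>s. l v * turnc a b (p v)) =
    (\<Sum>v\<in>s. (Re b - Re a) * (l v * Im (p v)) - (Im b - Im a) * (l v * Re (p v))
      + l v * ((Im b - Im a) * Re a - (Re b - Re a) * Im a))"
    by (rule sum.cong) (simp_all add: turnc_def algebra_simps)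
  also have "\<dots> = (Re b - Re a) * (\<Sum>v\<in>s. l v * Im (p v)) - (Im b - Im a) * (\<Sum>v\<in>s. l v * Re (p v))
      + (\<Sum>v\<in>s. l v) * ((Im b - Im a) * Re a - (Re b - Re a) * Im a)"
    by (simp add: sum.distrib sum_subtractf sum_distrib_left sum_distrib_right)
  also have "\<dots> = turnc a b (point p s l)"
    using assms by (simp add: barycentric_def turnc_def re im algebra_simps)
  finally show ?thesis ..
qed

lemma among_label [simp]: "among (label cs s) v \<longleftrightarrow> v \<in> set s"
  by (auto simp: among_def label_def list_ex_iff)

lemma separated_label:
  "separated (label cs s) (label cs t) \<longleftrightarrow> (\<exists>u\<in>set (s @ t). \<exists>v\<in>set (s @ t).
     (\<forall>w\<in>set t. w \<in> set s \<or> turn (cs ! u) (cs ! v) (cs ! w) < 0) \<and>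
     (\<forall>w\<in>set s. if w \<in> set t then turn (cs ! u) (cs ! v) (cs ! w) = 0 else 0 \<le> turn (cs ! u) (cs ! v) (cs ! w)))"
  unfolding separated_def list_ex_iff list_all_iff among_label by (simp add: label_def bex_Un)

text \<open>The separating affine function is nonnegative on \<open>s\<close>, zero at the common
  vertices and negative at the other vertices of \<open>t\<close>. At a common point it must be
  zero, so the weights of \<open>t\<close> outside \<open>s\<close> vanish.\<close>

lemma separated_support:
  assumes sep: "separated (label cs s) (label cs t)"
    and l: "barycentric (set s) l" and m: "barycentric (set t) m"
    and eq: "point (grid cs) (set s) l = point (grid cs) (set t) m"
  shows "barycentric (set s \<inter> set t) m"
proof -
  obtain u v where uv: "\<And>w. w \<in> set t \<Longrightarrow> w \<in> set s \<or> turn (cs ! u) (cs ! v) (cs ! w) < 0"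
    "\<And>w. w \<in> set s \<Longrightarrow> if w \<in> set t then turn (cs ! u) (cs ! v) (cs ! w) = 0 else 0 \<le> turn (cs ! u) (cs ! v) (cs ! w)"
    using sep unfolding separated_label by blast
  define f where "f = (\<lambda>w. turnc (grid cs u) (grid cs v) (grid cs w))"
  have f: "f w = of_int (turn (cs ! u) (cs ! v) (cs ! w))" for w unfolding f_def by (rule turnc_grid)
  have ft: "f w < 0" if "w \<in> set t" "w \<notin> set s" for w using uv(1)[of w] that by (auto simp: f)
  have f0: "f w = 0" if "w \<in> set t" "w \<in> set s" for w using uv(2)[of w] that by (auto simp: f)
  have fs: "f w \<ge> 0" if "w \<in> set s" for w using uv(2)[of w] that by (auto simp: f split: if_splits)
  have pos: "l w \<ge> 0" "m w \<ge> 0" for w using l m by (auto simp: barycentric_def)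
  have "(\<Sum>w\<in>set s. l w * f w) = (\<Sum>w\<in>set t. m w * f w)"
    using turnc_point[OF l, of "grid cs u" "grid cs v" "grid cs"] turnc_point[OF m, of "grid cs u" "grid cs v" "grid cs"] eq
    by (simp add: f_def)
  moreover have "(\<Sum>w\<in>set s. l w * f w) \<ge> 0" by (rule sum_nonneg) (use fs pos in auto)
  moreover have nonpos: "m w * f w \<le> 0" if "w \<in> set t" for w
    using ft[of w] f0[of w] that pos(2)[of w] by (cases "w \<in> set s") (auto simp: mult_nonneg_nonpos)
  ultimately have "(\<Sum>w\<in>set t. - (m w * f w)) = 0"
    using sum_nonpos[of "set t" "\<lambda>w. m w * f w"] by (simp add: sum_negf)
  then have zero: "m w * f w = 0" if "w \<in> set t" for w
    using sum_nonneg_eq_0_iff[of "set t" "\<lambda>w. - (m w * f w)"] nonpos that by auto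
  have supp: "m w = 0" if "w \<notin> set s \<inter> set t" for w
  proof (cases "w \<in> set t")
    case True
    then show ?thesis using zero[OF True] ft[OF True] that by auto
  qed (use m in \<open>auto simp: barycentric_def\<close>)
  have "sum m (set s \<inter> set t) = sum m (set t)" by (rule sum.mono_neutral_left) (use supp in auto)
  then show ?thesis using m supp by (auto simp: barycentric_def)
qed

text \<open>For a triangle, \<open>turnc\<close> of one side vanishes at two corners and so isolates
  the coordinate at the third; two such sides and the sum of the weights determine all three. For a
  segment it suffices that its ends differ.\<close>

lemma nondegenerate_unique:
  assumes "nondegenerate (label cs s)" "barycentric (set s) l" "barycentric (set s) m"
    "point (grid cs) (set s) l = point (grid cs) (set s) m"
  shows "l = m"
proof -
  have key: "(\<Sum>w\<in>set s. (l w - m w) * turnc a b (grid cs w)) = 0" for a b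
    using turnc_point[OF assms(2), of a b "grid cs"] turnc_point[OF assms(3), of a b "grid cs"] assms(4)
    by (simp add: left_diff_distrib sum_subtractf)
  have total: "(\<Sum>w\<in>set s. (l w - m w)) = 0" using assms(2,3) by (simp add: barycentric_def sum_subtractf)
  have out: "l w = m w" if "w \<notin> set s" for w using assms(2,3) that by (simp add: barycentric_def)
  have "length s = 2 \<or> length s = 3"
    using assms(1) by (cases "label cs s" rule: nondegenerate.cases) (auto simp: label_def)
  then consider u v where "s = [u, v]" | u v w where "s = [u, v, w]"
    by (auto simp: numeral_2_eq_2 numeral_3_eq_3 length_Suc_conv)
  then show ?thesis
  proof cases
    case (1 u v)
    have ne: "cs ! u \<noteq> cs ! v" using assms(1) 1 by (simp add: label_def)
    then have uv: "u \<noteq> v" by auto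
    have "(l u - m u) *\<^sub>R grid cs u + (l v - m v) *\<^sub>R grid cs v = 0"
      using assms(4) 1 uv by (simp add: point_def scaleR_left_diff_distrib algebra_simps)
    moreover have lv: "l v - m v = - (l u - m u)" using total 1 uv by simp
    ultimately have "(l u - m u) *\<^sub>R (grid cs u - grid cs v) = 0" by (simp only: lv) (simp add: algebra_simps)
    moreover have "grid cs u \<noteq> grid cs v" using ne by (auto simp: grid_def prod_eq_iff)
    ultimately have "l u = m u" by simp
    then have "l w = m w" for w using lv out[of w] 1 by (cases "w \<in> set s") auto
    then show ?thesis by blast
  next
    case (2 u v w)
    define T where "T = turnc (grid cs u) (grid cs v) (grid cs w)"
    have T: "T \<noteq> 0" using assms(1) 2 unfolding T_def turnc_grid by (simp add: label_def)
    have d: "distinct [u, v, w]" using T by (auto simp: T_def turnc_def)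
    have "(l w - m w) * T = 0" using key[of "grid cs u" "grid cs v"] 2 d by (simp add: T_def turnc_def)
    moreover have "(l u - m u) * T = 0" using key[of "grid cs v" "grid cs w"] 2 d by (simp add: T_def turnc_def algebra_simps)
    ultimately have "l w = m w" "l u = m u" using T by auto
    moreover have "l v = m v" using total 2 d calculation by simp
    ultimately have "l x = m x" for x using out[of x] 2 by (cases "x \<in> set s") auto
    then show ?thesis by blast
  qed
qed

text \<open>Inclusion reduces to a single simplex by extending coordinates with zeros. Separation
  moves \<open>m\<close> to the common face, so that \<open>l\<close> and \<open>m\<close> describe
  the same point of one simplex.\<close>

lemma compatible_unique:
  assumes "nondegenerate (label cs s)" "nondegenerate (label cs t)" "compatible (label cs s) (label cs t)"
    "barycentric (set s) l" "barycentric (set t) m" "point (grid cs) (set s) l = point (grid cs) (set t) m"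
  shows "l = m"
proof -
  have sub: "l = m" if "set s \<subseteq> set t" "nondegenerate (label cs t)" "barycentric (set s) l" "barycentric (set t) m"
    "point (grid cs) (set s) l = point (grid cs) (set t) m" for s t l m
    using nondegenerate_unique[OF that(2) barycentric_mono[OF that(3,1)] that(4)] point_mono[OF that(3,1)] that(5) by simp
  have sep: "l = m" if "separated (label cs s) (label cs t)" "nondegenerate (label cs s)"
    "barycentric (set s) l" "barycentric (set t) m" "point (grid cs) (set s) l = point (grid cs) (set t) m" for s t l m
  proof -
    have b: "barycentric (set s \<inter> set t) m" by (rule separated_support[OF that(1,3,4,5)])
    have "barycentric (set s) m" by (rule barycentric_mono[OF b]) auto
    moreover have "point (grid cs) (set s) m = point (grid cs) (set t) m"
      using point_mono[OF b, of "set s" "grid cs"] point_mono[OF b, of "set t" "grid cs"] by simp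
    ultimately show ?thesis using nondegenerate_unique[OF that(2,3)] that(5) by simp
  qed
  have face: "subface (label cs s) (label cs t) \<longleftrightarrow> set s \<subseteq> set t" for s t
    by (auto simp: subface_def list_all_iff label_def among_label[unfolded label_def])
  have eq': "point (grid cs) (set t) m = point (grid cs) (set s) l" using assms(6) by simp
  show ?thesis
    using assms(3) unfolding compatible_def face
    using sub[OF _ assms(2,4,5,6)] sub[OF _ assms(1,5,4) eq'] sep[OF _ assms(1,4,5,6)] sep[OF _ assms(2,5,4) eq']
    by metis
qed

lemma embedding_check_correct:
  assumes "embedding_check cs ss"
  shows "embedded (grid cs) (set ` set ss)"
  unfolding embedded_def
proof (intro conjI ballI allI impI)
  fix S T l m assume ST: "S \<in> set ` set ss" "T \<in> set ` set ss"
    and lm: "barycentric S l \<and> barycentric T m \<and> point (grid cs) S l = point (grid cs) T m"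
  obtain s t where s: "s \<in> set ss" "S = set s" and t: "t \<in> set ss" "T = set t" using ST by blast
  have nd: "nondegenerate (label cs s)" "nondegenerate (label cs t)"
    using assms s t by (auto simp: embedding_check_def Let_def list_all_iff)
  have "all_pairs compatible (map (label cs) ss)" using assms by (simp add: embedding_check_def Let_def)
  then have "label cs s = label cs t \<or> compatible (label cs s) (label cs t) \<or> compatible (label cs t) (label cs s)"
    by (rule all_pairsD) (use s t in auto)
  moreover have "compatible (label cs s) (label cs t)" if "label cs s = label cs t"
    using that by (auto simp: compatible_def subface_def list_all_iff among_def list_ex_iff)
  ultimately consider "compatible (label cs s) (label cs t)" | "compatible (label cs t) (label cs s)" by blast
  then show "l = m"
  proof cases
    case 1
    show ?thesis by (rule compatible_unique[OF nd 1]) (use lm s t in auto)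
  next
    case 2
    have "m = l" by (rule compatible_unique[OF nd(2,1) 2]) (use lm s t in auto)
    then show ?thesis by simp
  qed
qed auto

lemma drawing_check_correct:
  assumes ord: "ordered_pairs n es" and dc: "drawing_check n es cs tris"
  shows "complex_drawing {..<n} (edges_of es) (grid cs) (edges_of es \<union> set ` set tris)"
proof -
  let ?ss = "map (\<lambda>(u, v). [u, v]) es @ tris"
  have F: "set ` set ?ss = edges_of es \<union> set ` set tris"
    by (simp add: edges_of_def image_image image_Un case_prod_beta)
  have sub: "\<Union>(edges_of es) \<subseteq> {..<n}" "\<Union>(set ` set tris) \<subseteq> {..<n}"
    using simple_graph_edges_of[OF ord] dc by (auto simp: simple_graph_def drawing_check_def list_all_iff)
  have sup: "v \<in> \<Union>(edges_of es)" if v: "v < n" for v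
  proof -
    have "\<exists>x\<in>set es. case x of (a, b) \<Rightarrow> a = v \<or> b = v"
      using dc v unfolding drawing_check_def list_all_iff list_ex_iff by simp
    then obtain a b where "(a, b) \<in> set es" "a = v \<or> b = v" by auto
    then show ?thesis unfolding edges_of_def by (intro UnionI[of "{a, b}"]) auto
  qed
  have "\<Union>(edges_of es \<union> set ` set tris) = {..<n}"
    unfolding Union_Un_distrib by (intro equalityI Un_least sub subsetI UnI1 sup) simp
  moreover have "embedded (grid cs) (edges_of es \<union> set ` set tris)"
    unfolding F[symmetric] by (rule embedding_check_correct) (use dc in \<open>simp add: drawing_check_def\<close>)
  moreover have "\<forall>e\<in>edges_of es. \<exists>s\<in>edges_of es \<union> set ` set tris. e \<subseteq> s" by auto
  ultimately show ?thesis by (simp only: complex_drawing_def simp_thms)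
qed

section \<open>Infinite families\<close>

lemma path_insert_simple_graph:
  assumes "simple_graph V E" "{z, w} \<in> E" "A \<in> V" "B \<in> V" "x \<notin> V" "y \<notin> V" "x \<noteq> y"
  shows "simple_graph (V \<union> {x, y}) (path_insert E z w A B x y)"
proof -
  have "z \<in> V" "w \<in> V" using assms by (auto simp: simple_graph_def)
  then have "x \<noteq> z" "x \<noteq> A" "x \<noteq> B" "y \<noteq> w" "y \<noteq> A" "y \<noteq> B" using assms by auto
  then show ?thesis using assms \<open>z \<in> V\<close> \<open>w \<in> V\<close> by (auto simp: simple_graph_def path_insert_def)
qed

lemma rung_insert_simple_graph:
  assumes "simple_graph V E" "{a, b} \<in> E" "{c, d} \<in> E" "x \<notin> V" "y \<notin> V" "x \<noteq> y"
  shows "simple_graph (V \<union> {x, y}) (rung_insert E a b c d x y)"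
proof -
  have "a \<in> V" "b \<in> V" "c \<in> V" "d \<in> V" using assms by (auto simp: simple_graph_def)
  moreover from this have "x \<noteq> a" "x \<noteq> b" "y \<noteq> c" "y \<noteq> d" using assms by auto
  ultimately show ?thesis using assms by (auto simp: simple_graph_def rung_insert_def)
qed

lemma incident_Un: "{e \<in> A \<union> B. v \<in> e} = {e \<in> A. v \<in> e} \<union> {e \<in> B. v \<in> e}"
  and incident_insert: "{e \<in> insert f A. v \<in> e} = (if v \<in> f then insert f {e \<in> A. v \<in> e} else {e \<in> A. v \<in> e})"
  and incident_empty: "{e \<in> {}. v \<in> e} = {}"
  by auto

text \<open>An end of the subdivided edge exchanges it for the edge to \<open>x\<close>, which is
  new because \<open>x\<close> is.\<close>

lemma vdegree_replace_edge:
  assumes simple: "simple_graph V E" and ab: "{a, b} \<in> E" and x: "x \<notin> V" and v: "v \<in> V"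
    and sub: "{e \<in> E'. v \<in> e} = {e \<in> E - {{a, b}}. v \<in> e} \<union> (if v = a \<or> v = b then {{v, x}} else {})"
  shows "vdegree E' v = vdegree E v"
proof -
  have fin: "finite E" using simple_graph_finite_edges[OF simple] .
  have vx: "{v, x} \<notin> E" using simple x by (auto simp: simple_graph_def)
  let ?I = "{e \<in> E. v \<in> e}"
  have "card ({e \<in> E - {{a, b}}. v \<in> e} \<union> (if v = a \<or> v = b then {{v, x}} else {})) = card ?I"
  proof (cases "v = a \<or> v = b")
    case True
    have "{e \<in> E - {{a, b}}. v \<in> e} = ?I - {{a, b}}" by blast
    moreover have "{a, b} \<in> ?I" using ab True by auto
    moreover have "finite ?I" using fin by simp
    ultimately have "Suc (card {e \<in> E - {{a, b}}. v \<in> e}) = card ?I" by (simp only: card_Suc_Diff1)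
    then show ?thesis using True vx fin by (simp add: card_insert_if)
  next
    case False
    then have "{e \<in> E - {{a, b}}. v \<in> e} = ?I" by blast
    then show ?thesis using False by simp
  qed
  then show ?thesis by (simp only: vdegree_def sub)
qed

text \<open>Seven new edges against one deleted: six more edges for two more vertices preserve the
  number 3n - 6.\<close>

lemma card_edges_path_insert:
  assumes simple: "simple_graph V E" and zw: "{z, w} \<in> E" and AB: "A \<in> V" "B \<in> V" "distinct [z, w, A, B]"
    and new: "x \<notin> V" "y \<notin> V" "x \<noteq> y"
  shows "card (path_insert E z w A B x y) = card E + 6"
proof -
  have fin: "finite E" and eV: "\<And>e. e \<in> E \<Longrightarrow> e \<subseteq> V" using simple simple_graph_finite_edges[OF simple] by (auto simp: simple_graph_def)
  have in_V: "z \<in> V" "w \<in> V" using eV[OF zw] by auto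
  let ?N = "{{z, x}, {x, y}, {y, w}, {x, A}, {x, B}, {y, A}, {y, B}}"
  have ne: "x \<noteq> z" "x \<noteq> w" "x \<noteq> A" "x \<noteq> B" "y \<noteq> z" "y \<noteq> w" "y \<noteq> A" "y \<noteq> B" using new in_V AB by auto
  have "card ?N = 7" using ne ne[symmetric] new(3) AB(3) by (simp add: card_insert_if doubleton_eq_iff)
  moreover have "?N \<inter> E = {}" using eV new by auto
  moreover have "card (path_insert E z w A B x y) = card (E - {{z, w}}) + card ?N"
    unfolding path_insert_def by (rule card_Un_disjoint) (use fin calculation(2) in auto)
  moreover have "Suc (card (E - {{z, w}})) = card E" using card_Suc_Diff1[OF fin zw] .
  ultimately show ?thesis by simp
qed

text \<open>The ends of \<open>zw\<close> keep their degrees while \<open>A\<close> and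
  \<open>B\<close> gain, so old degrees are only bounded from below.\<close>

lemma vdegree_path_insert:
  assumes simple: "simple_graph V E" and zw: "{z, w} \<in> E" and AB: "A \<in> V" "B \<in> V" "distinct [z, w, A, B]"
    and new: "x \<notin> V" "y \<notin> V" "x \<noteq> y"
  shows "vdegree (path_insert E z w A B x y) x = 4" "vdegree (path_insert E z w A B x y) y = 4"
    "v \<in> V \<Longrightarrow> vdegree E v \<le> vdegree (path_insert E z w A B x y) v"
proof -
  let ?E = "path_insert E z w A B x y"
  have fin: "finite E" and eV: "\<And>e. e \<in> E \<Longrightarrow> e \<subseteq> V" using simple simple_graph_finite_edges[OF simple] by (auto simp: simple_graph_def)
  have in_V: "z \<in> V" "w \<in> V" using eV[OF zw] by auto
  have ne: "x \<noteq> z" "x \<noteq> w" "x \<noteq> A" "x \<noteq> B" "y \<noteq> z" "y \<noteq> w" "y \<noteq> A" "y \<noteq> B" using new in_V AB by auto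
  have none: "{e \<in> E - {{z, w}}. x \<in> e} = {}" using eV new by auto
  have "{e \<in> ?E. x \<in> e} = {{z, x}, {x, y}, {x, A}, {x, B}}"
    unfolding path_insert_def incident_Un none incident_insert incident_empty using ne ne[symmetric] new(3) by simp
  then show "vdegree ?E x = 4" using ne ne[symmetric] new(3) AB(3) by (simp add: vdegree_def card_insert_if doubleton_eq_iff)
  have none: "{e \<in> E - {{z, w}}. y \<in> e} = {}" using eV new by auto
  have "{e \<in> ?E. y \<in> e} = {{x, y}, {y, w}, {y, A}, {y, B}}"
    unfolding path_insert_def incident_Un none incident_insert incident_empty using ne ne[symmetric] new(3) by simp
  then show "vdegree ?E y = 4" using ne ne[symmetric] new(3) AB(3) by (simp add: vdegree_def card_insert_if doubleton_eq_iff)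
  assume v: "v \<in> V"
  \<comment> \<open>The new neighbour that makes up for the loss of \<open>zw\<close>:
    \<open>y\<close> for \<open>w\<close>, and \<open>x\<close> for \<open>z\<close>.\<close>
  define t where "t = (if v = w then y else x)"
  have vt: "{v, t} \<notin> E" using eV[of "{v, t}"] new by (auto simp: t_def)
  let ?E2 = "E - {{z, w}} \<union> (if v = z \<or> v = w then {{v, t}} else {})"
  have "vdegree ?E2 v = vdegree E v"
    by (rule vdegree_replace_edge[OF simple zw _ v, of t]) (use new vt in \<open>auto simp: t_def\<close>)
  moreover have "finite {e \<in> ?E. v \<in> e}" using fin by (simp add: path_insert_def)
  moreover have "E - {{z, w}} \<subseteq> ?E" unfolding path_insert_def by (rule Un_upper1)
  moreover have "(if v = z \<or> v = w then {{v, t}} else {}) \<subseteq> ?E"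
    by (cases "v = w") (use AB(3) in \<open>simp_all add: path_insert_def t_def insert_commute\<close>)
  ultimately have "vdegree ?E2 v = vdegree E v" "finite {e \<in> ?E. v \<in> e}" "?E2 \<subseteq> ?E" by simp_all
  note * = this
  have "{e \<in> ?E2. v \<in> e} \<subseteq> {e \<in> ?E. v \<in> e}" using *(3) by blast
  then have "vdegree ?E2 v \<le> vdegree ?E v" unfolding vdegree_def by (rule card_mono[OF *(2)])
  then show "vdegree E v \<le> vdegree ?E v" using *(1) by simp
qed

lemma vdegree_rung_insert:
  assumes simple: "simple_graph V E" and ab: "{a, b} \<in> E" and cd: "{c, d} \<in> E" and dist: "distinct [a, b, c, d]"
    and new: "x \<notin> V" "y \<notin> V" "x \<noteq> y"
  shows "vdegree (rung_insert E a b c d x y) x = 3" "vdegree (rung_insert E a b c d x y) y = 3"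
    "v \<in> V \<Longrightarrow> vdegree (rung_insert E a b c d x y) v = vdegree E v"
proof -
  let ?E = "rung_insert E a b c d x y"
  have eV: "\<And>e. e \<in> E \<Longrightarrow> e \<subseteq> V" using simple by (auto simp: simple_graph_def)
  have in_V: "a \<in> V" "b \<in> V" "c \<in> V" "d \<in> V" using eV[OF ab] eV[OF cd] by auto
  have ne: "x \<noteq> a" "x \<noteq> b" "x \<noteq> c" "x \<noteq> d" "y \<noteq> a" "y \<noteq> b" "y \<noteq> c" "y \<noteq> d" using new in_V by auto
  have none: "{e \<in> E - {{a, b}, {c, d}}. x \<in> e} = {}" using eV new by auto
  have "{e \<in> ?E. x \<in> e} = {{a, x}, {x, b}, {x, y}}"
    unfolding rung_insert_def incident_Un none incident_insert incident_empty using ne ne[symmetric] new(3) by simp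
  then show "vdegree ?E x = 3" using ne ne[symmetric] new(3) dist by (simp add: vdegree_def card_insert_if doubleton_eq_iff)
  have none: "{e \<in> E - {{a, b}, {c, d}}. y \<in> e} = {}" using eV new by auto
  have "{e \<in> ?E. y \<in> e} = {{c, y}, {y, d}, {x, y}}"
    unfolding rung_insert_def incident_Un none incident_insert incident_empty using ne ne[symmetric] new(3) by simp
  then show "vdegree ?E y = 3" using ne ne[symmetric] new(3) dist by (simp add: vdegree_def card_insert_if doubleton_eq_iff)
  assume v: "v \<in> V"
  have vne: "v \<noteq> x" "v \<noteq> y" using v new by auto
  show "vdegree ?E v = vdegree E v"
  proof (cases "v = c \<or> v = d")
    case False
    have 1: "{e \<in> E - {{a, b}, {c, d}}. v \<in> e} = {e \<in> E - {{a, b}}. v \<in> e}" using False by auto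
    have "{e \<in> ?E. v \<in> e} = {e \<in> E - {{a, b}}. v \<in> e} \<union> (if v = a \<or> v = b then {{v, x}} else {})"
      unfolding rung_insert_def incident_Un incident_insert incident_empty 1
      using False vne dist by (simp add: insert_commute)
    from vdegree_replace_edge[OF simple ab new(1) v this] show ?thesis by simp
  next
    case True
    then have "v \<noteq> a" "v \<noteq> b" using dist by auto
    then have 1: "{e \<in> E - {{a, b}, {c, d}}. v \<in> e} = {e \<in> E - {{c, d}}. v \<in> e}" by auto
    have "{e \<in> ?E. v \<in> e} = {e \<in> E - {{c, d}}. v \<in> e} \<union> (if v = c \<or> v = d then {{v, y}} else {})"
      unfolding rung_insert_def incident_Un incident_insert incident_empty 1
      using True \<open>v \<noteq> a\<close> \<open>v \<noteq> b\<close> vne dist by (auto simp: insert_commute)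
    from vdegree_replace_edge[OF simple cd new(2) v this] show ?thesis by simp
  qed
qed

section \<open>Invariants of the growing strips\<close>

text \<open>The invariant of path lengthening. The edge \<open>zw\<close>, between two empty
  triangles, is the place of the next insertion and moves with every step, whereas \<open>A\<close>
  and \<open>B\<close> stay. The edge number is kept for maximality.\<close>

definition triangulation_state ::
    "nat set \<Rightarrow> nat set set \<Rightarrow> nat \<Rightarrow> nat \<Rightarrow> nat \<Rightarrow> nat \<Rightarrow> nat \<Rightarrow> bool" where
  "triangulation_state V E k z w A B \<longleftrightarrow> simple_graph V E \<and> k_connected 3 V E \<and> path_slot V E z w A B \<and>
     (\<exists>p F. complex_drawing V E p F \<and> {z, w, A} \<in> F \<and> {z, w, B} \<in> F) \<and>
     pmc V E = k \<and> card E + 6 = 3 * card V"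

lemma fresh_pair:
  assumes "finite (V :: nat set)"
  obtains x y where "x \<notin> V" "y \<notin> V" "x \<noteq> y"
proof -
  obtain x where "x \<notin> V" using ex_new_if_finite[OF infinite_UNIV_nat assms] by blast
  moreover obtain y where "y \<notin> insert x V" using ex_new_if_finite[of "insert x V"] assms infinite_UNIV_nat by blast
  ultimately show thesis using that[of x y] by blast
qed

lemma triangulation_state_step:
  assumes "triangulation_state V E k z w A B"
  obtains V' E' x y where "triangulation_state V' E' k x y A B" "card V' = card V + 2"
    "V' = V \<union> {x, y}" "\<And>v. v \<in> V \<Longrightarrow> vdegree E v \<le> vdegree E' v" "vdegree E' x = 4" "vdegree E' y = 4"
proof -
  obtain p F where st: "simple_graph V E" "k_connected 3 V E" "path_slot V E z w A B"
    "complex_drawing V E p F" "{z, w, A} \<in> F" "{z, w, B} \<in> F" "pmc V E = k" "card E + 6 = 3 * card V"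
    using assms unfolding triangulation_state_def by blast
  have slot: "{z, w} \<in> E" "A \<in> V" "B \<in> V" "distinct [z, w, A, B]" using st(3) by (simp_all add: path_slot_def)
  have fin: "finite V" using st(1) by (simp add: simple_graph_def)
  obtain x y where new: "x \<notin> V" "y \<notin> V" "x \<noteq> y" using fresh_pair[OF fin] .
  let ?V = "V \<union> {x, y}" and ?E = "path_insert E z w A B x y"
  have cV: "card ?V = card V + 2" using new fin by simp
  have "triangulation_state ?V ?E k x y A B"
    unfolding triangulation_state_def
  proof (intro conjI)
    show "simple_graph ?V ?E" by (rule path_insert_simple_graph[OF st(1) slot(1-3) new])
    show "k_connected 3 ?V ?E"
      using k_connected_path_insertion[OF st(1,2) slot new] by (simp only: path_insert_def)
    show "path_slot ?V ?E x y A B" by (rule pmc_path_insert(2)[OF st(1,3) new])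
    show "\<exists>p F. complex_drawing ?V ?E p F \<and> {x, y, A} \<in> F \<and> {x, y, B} \<in> F"
      by (rule complex_drawing_path_insert[OF st(1,4-6) slot(4) new])
    show "pmc ?V ?E = k" using pmc_path_insert(1)[OF st(1,3) new] st(7) by simp
    show "card ?E + 6 = 3 * card ?V" using card_edges_path_insert[OF st(1) slot new] st(8) cV by simp
  qed
  then show thesis
    by (rule that[OF _ cV refl]) (use vdegree_path_insert[OF st(1) slot new] in auto)
qed

text \<open>The invariant of rung insertion. The diagonal \<open>bc\<close> must not be an edge,
  because the drawing puts a vertex on it.\<close>

definition ladder_state ::
    "nat set \<Rightarrow> nat set set \<Rightarrow> nat \<Rightarrow> nat \<Rightarrow> nat \<Rightarrow> nat \<Rightarrow> nat \<Rightarrow> nat \<Rightarrow> bool" where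
  "ladder_state V E a b c d P Q \<longleftrightarrow> simple_graph V E \<and> k_connected 3 V E \<and> rung_slot V E a b c d P Q \<and>
     {b, c} \<notin> E \<and> (\<exists>p F. complex_drawing V E p F \<and> {a, b, c} \<in> F \<and> {b, c, d} \<in> F)"

text \<open>The colouring is proper off the slot edges, and \<open>ev\<close> records whether it is
  proper on them too. One rung spoils this and the next repairs it, so the invariant has to cover
  both cases.\<close>

definition ladder_colouring :: "nat set set \<Rightarrow> nat \<Rightarrow> nat \<Rightarrow> nat \<Rightarrow> nat \<Rightarrow> bool \<Rightarrow> bool" where
  "ladder_colouring E a b c d ev \<longleftrightarrow> (\<exists>col :: nat \<Rightarrow> bool.
     (\<forall>u v. {u, v} \<in> E - {{a, b}, {c, d}} \<longrightarrow> col u \<noteq> col v) \<and>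
     col a \<noteq> col c \<and> col b \<noteq> col d \<and> (col a \<noteq> col b) = ev)"

text \<open>\<open>x\<close> gets the colour opposite to \<open>a\<close> and \<open>y\<close> the
  one opposite to \<open>c\<close>, so \<open>x\<close> and \<open>y\<close> differ as
  \<open>a\<close> and \<open>c\<close> do, while \<open>x\<close> and \<open>b\<close> differ
  exactly if \<open>a\<close> and \<open>b\<close> agree.\<close>

lemma ladder_colouring_step:
  assumes simple: "simple_graph V E" and ab: "{a, b} \<in> E" and cd: "{c, d} \<in> E"
    and new: "x \<notin> V" "y \<notin> V" "x \<noteq> y" and col: "ladder_colouring E a b c d ev"
  shows "ladder_colouring (rung_insert E a b c d x y) x b y d (\<not> ev)"
proof -
  have eV: "\<And>e. e \<in> E \<Longrightarrow> e \<subseteq> V" using simple by (auto simp: simple_graph_def)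
  have in_V: "a \<in> V" "b \<in> V" "c \<in> V" "d \<in> V" using eV[OF ab] eV[OF cd] by auto
  have ne: "x \<noteq> a" "x \<noteq> b" "x \<noteq> c" "x \<noteq> d" "y \<noteq> a" "y \<noteq> b" "y \<noteq> c" "y \<noteq> d" using new in_V by auto
  obtain col :: "nat \<Rightarrow> bool" where c: "\<And>u v. {u, v} \<in> E - {{a, b}, {c, d}} \<Longrightarrow> col u \<noteq> col v"
    "col a \<noteq> col c" "col b \<noteq> col d" "(col a \<noteq> col b) = ev"
    using col unfolding ladder_colouring_def by blast
  define col' where "col' = col(x := \<not> col a, y := \<not> col c)"
  have vals: "col' x = (\<not> col a)" "col' y = (\<not> col c)" "\<And>v. v \<noteq> x \<Longrightarrow> v \<noteq> y \<Longrightarrow> col' v = col v"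
    using new by (auto simp: col'_def)
  have old: "col' u \<noteq> col' v" if "{u, v} \<in> E - {{a, b}, {c, d}}" for u v
  proof -
    have "u \<in> V" "v \<in> V" using eV[of "{u, v}"] that by auto
    then have "u \<noteq> x" "u \<noteq> y" "v \<noteq> x" "v \<noteq> y" using new by auto
    then show ?thesis using c(1)[OF that] vals(3) by simp
  qed
  have proper: "col' u \<noteq> col' v" if uv: "{u, v} \<in> rung_insert E a b c d x y - {{x, b}, {y, d}}" for u v
  proof -
    have "e \<in> E - {{a, b}, {c, d}} \<or> e = {a, x} \<or> e = {c, y} \<or> e = {x, y}"
      if "e \<in> rung_insert E a b c d x y - {{x, b}, {y, d}}" for e
      using that unfolding rung_insert_def by auto
    from this[OF uv] show ?thesis
    proof (elim disjE)
      assume "{u, v} = {a, x}"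
      then show ?thesis using vals ne by (auto simp: doubleton_eq_iff)
    next
      assume "{u, v} = {c, y}"
      then show ?thesis using vals ne by (auto simp: doubleton_eq_iff)
    next
      assume "{u, v} = {x, y}"
      then show ?thesis using vals c(2) by (auto simp: doubleton_eq_iff)
    qed (rule old)
  qed
  have "col' x \<noteq> col' y" "col' b \<noteq> col' d" "(col' x \<noteq> col' b) = (\<not> ev)"
    using vals ne ne[symmetric] c(2-4) by auto
  then show ?thesis unfolding ladder_colouring_def using proper by blast
qed

lemma bipartite_ladder:
  assumes simple: "simple_graph V E" and col: "ladder_colouring E a b c d True"
  shows "bipartite_graph V E"
proof -
  obtain col :: "nat \<Rightarrow> bool" where c: "\<And>u v. {u, v} \<in> E - {{a, b}, {c, d}} \<Longrightarrow> col u \<noteq> col v"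
    "col a \<noteq> col c" "col b \<noteq> col d" "col a \<noteq> col b"
    using col unfolding ladder_colouring_def by auto
  have all: "col u \<noteq> col v" if "{u, v} \<in> E" for u v
  proof (cases "{u, v} \<in> {{a, b}, {c, d}}")
    case True
    then show ?thesis using c(2-4) by (auto simp: doubleton_eq_iff)
  qed (use c(1) that in blast)
  show ?thesis
    unfolding bipartite_graph_def
  proof (intro exI conjI ballI)
    show "{v \<in> V. col v} \<union> {v \<in> V. \<not> col v} = V" "{v \<in> V. col v} \<inter> {v \<in> V. \<not> col v} = {}" by auto
    fix e assume e: "e \<in> E"
    then obtain u v where uv: "e = {u, v}" "u \<in> V" "v \<in> V" using simple by (auto simp: simple_graph_def card_2_iff)
    then have "col u \<noteq> col v" using all e by blast
    then show "\<exists>a\<in>{v \<in> V. col v}. \<exists>b\<in>{v \<in> V. \<not> col v}. e = {a, b}"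
      using uv by (cases "col u") (auto simp: insert_commute)
  qed
qed

lemma ladder_state_step:
  assumes "ladder_state V E a b c d P Q"
  obtains V' E' x y where "ladder_state V' E' x b y d Q P" "card V' = card V + 2"
    "\<And>k. k \<noteq> 3 \<Longrightarrow> card {v \<in> V'. vdegree E' v = k} = card {v \<in> V. vdegree E v = k}"
    "card {v \<in> V'. vdegree E' v = 3} = card {v \<in> V. vdegree E v = 3} + 2"
    "\<And>ev. ladder_colouring E a b c d ev \<Longrightarrow> ladder_colouring E' x b y d (\<not> ev)"
proof -
  obtain p F where st: "simple_graph V E" "k_connected 3 V E" "rung_slot V E a b c d P Q" "{b, c} \<notin> E"
    "complex_drawing V E p F" "{a, b, c} \<in> F" "{b, c, d} \<in> F"
    using assms unfolding ladder_state_def by blast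
  have slot: "{a, b} \<in> E" "{c, d} \<in> E" "distinct [a, b, c, d]" using st(3) by (simp_all add: rung_slot_def)
  have fin: "finite V" and eV: "\<And>e. e \<in> E \<Longrightarrow> e \<subseteq> V" using st(1) by (auto simp: simple_graph_def)
  have in_V: "a \<in> V" "b \<in> V" "c \<in> V" "d \<in> V" using eV[OF slot(1)] eV[OF slot(2)] by auto
  obtain x y where new: "x \<notin> V" "y \<notin> V" "x \<noteq> y" using fresh_pair[OF fin] .
  let ?V = "V \<union> {x, y}" and ?E = "rung_insert E a b c d x y"
  note deg = vdegree_rung_insert[OF st(1) slot new]
  have "ladder_state ?V ?E x b y d Q P"
    unfolding ladder_state_def
  proof (intro conjI)
    show "simple_graph ?V ?E" by (rule rung_insert_simple_graph[OF st(1) slot(1,2) new])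
    show "k_connected 3 ?V ?E"
      using k_connected_rung_insertion[OF st(1,2) slot new] by (simp only: rung_insert_def)
    show "rung_slot ?V ?E x b y d Q P" by (rule rung_slot_insert[OF st(1,3) new])
    have "{b, y} \<notin> E" using eV[of "{b, y}"] new by auto
    moreover have "{b, y} \<notin> {{a, x}, {x, b}, {c, y}, {y, d}, {x, y}}"
      using slot(3) new in_V by (auto simp: doubleton_eq_iff)
    ultimately show "{b, y} \<notin> ?E" unfolding rung_insert_def by blast
    show "\<exists>p F. complex_drawing ?V ?E p F \<and> {x, b, y} \<in> F \<and> {b, y, d} \<in> F"
      by (rule complex_drawing_rung_insert[OF st(1,5-7) slot(3) st(4) new])
  qed
  moreover have "card ?V = card V + 2" using new fin by simp
  moreover have "card {v \<in> ?V. vdegree ?E v = k} = card {v \<in> V. vdegree E v = k}" if "k \<noteq> 3" for k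
  proof -
    have "{v \<in> ?V. vdegree ?E v = k} = {v \<in> V. vdegree E v = k}" using deg that by auto
    then show ?thesis by simp
  qed
  moreover have "card {v \<in> ?V. vdegree ?E v = 3} = card {v \<in> V. vdegree E v = 3} + 2"
  proof -
    have "{v \<in> ?V. vdegree ?E v = 3} = insert x (insert y {v \<in> V. vdegree E v = 3})" using deg by auto
    then show ?thesis using new fin by simp
  qed
  moreover have "ladder_colouring ?E x b y d (\<not> ev)" if "ladder_colouring E a b c d ev" for ev
    by (rule ladder_colouring_step[OF st(1) slot(1,2) new that])
  ultimately show thesis by (rule that)
qed

section \<open>Initial graphs\<close>

definition graph_check ::
    "nat \<Rightarrow> (nat \<times> nat) list \<Rightarrow> (int \<times> int) list \<Rightarrow> nat list list \<Rightarrow> nat \<Rightarrow> bool" where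
  "graph_check n es cs tris k \<longleftrightarrow> ordered_pairs n es \<and> three_connected_check n es \<and>
     drawing_check n es cs tris \<and> count_without n es [] [] = k"

definition has_edge :: "(nat \<times> nat) list \<Rightarrow> nat \<Rightarrow> nat \<Rightarrow> bool" where
  "has_edge es u v = list_ex (\<lambda>(a, b). a = u \<and> b = v \<or> a = v \<and> b = u) es"

definition triangulation_check ::
    "nat \<Rightarrow> (nat \<times> nat) list \<Rightarrow> (int \<times> int) list \<Rightarrow> nat \<Rightarrow> nat \<Rightarrow> nat \<Rightarrow> nat \<Rightarrow> nat \<Rightarrow> bool" where
  "triangulation_check n es cs k z w A B \<longleftrightarrow> graph_check n es cs [[z, w, A], [z, w, B]] k \<and>
     length es + 6 = 3 * n \<and> has_edge es z w \<and> A < n \<and> B < n \<and> distinct [z, w, A, B] \<and>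
     list_all (\<lambda>S. count_without n es [(z, w)] S = 0)
       [[z, A], [z, B], [w, A], [w, B], [A, B], [z, w, A, B]]"

text \<open>\<open>Q\<close> is the matching number of the graph itself, \<open>P\<close> the one
  after an odd number of rungs.\<close>

definition ladder_check ::
    "nat \<Rightarrow> (nat \<times> nat) list \<Rightarrow> (int \<times> int) list \<Rightarrow> nat \<Rightarrow> nat \<Rightarrow> nat \<Rightarrow> nat \<Rightarrow> nat \<Rightarrow> nat \<Rightarrow> bool" where
  "ladder_check n es cs a b c d P Q \<longleftrightarrow> graph_check n es cs [[a, b, c], [b, c, d]] Q \<and>
     has_edge es a b \<and> has_edge es c d \<and> distinct [a, b, c, d] \<and> \<not> has_edge es b c \<and>
     list_all (\<lambda>S. count_without n es [(a, b), (c, d)] S = 0) [[], [a, c], [b, d], [a, b, c, d]] \<and>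
     count_without n es [(a, b), (c, d)] [a, d] + count_without n es [(a, b), (c, d)] [b, c] = P \<and>
     count_without n es [(a, b), (c, d)] [a, b] + count_without n es [(a, b), (c, d)] [c, d] = Q"

definition colouring_check :: "(nat \<times> nat) list \<Rightarrow> nat \<Rightarrow> nat \<Rightarrow> nat \<Rightarrow> nat \<Rightarrow> nat list \<Rightarrow> bool" where
  "colouring_check es a b c d X \<longleftrightarrow> list_all (\<lambda>(u, v). u \<in> set X \<longleftrightarrow> v \<notin> set X) es \<and>
     (a \<in> set X \<longleftrightarrow> c \<notin> set X) \<and> (b \<in> set X \<longleftrightarrow> d \<notin> set X) \<and> (a \<in> set X \<longleftrightarrow> b \<notin> set X)"

lemma has_edge_iff: "has_edge es u v \<longleftrightarrow> {u, v} \<in> edges_of es"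
  unfolding edges_of_iff by (auto simp: has_edge_def list_ex_iff)

lemma graph_check_correct:
  assumes "graph_check n es cs tris k"
  shows "ordered_pairs n es" "simple_graph {..<n} (edges_of es)" "k_connected 3 {..<n} (edges_of es)"
    "complex_drawing {..<n} (edges_of es) (grid cs) (edges_of es \<union> set ` set tris)"
    "planar_graph {..<n} (edges_of es)" "pmc {..<n} (edges_of es) = k"
    "num_perfect_matchings {..<n} (edges_of es) = k"
proof -
  show ord: "ordered_pairs n es" using assms by (simp add: graph_check_def)
  show simple: "simple_graph {..<n} (edges_of es)" by (rule simple_graph_edges_of[OF ord])
  show "k_connected 3 {..<n} (edges_of es)"
    by (rule three_connected_check_correct) (use assms in \<open>simp add: graph_check_def\<close>)
  show cd: "complex_drawing {..<n} (edges_of es) (grid cs) (edges_of es \<union> set ` set tris)"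
    by (rule drawing_check_correct[OF ord]) (use assms in \<open>simp add: graph_check_def\<close>)
  show "planar_graph {..<n} (edges_of es)" by (rule planar_graph_complex_drawing[OF simple cd])
  from count_without_correct[OF ord, of "[]" "[]"]
  show pmc: "pmc {..<n} (edges_of es) = k" using assms by (simp add: graph_check_def edges_of_def)
  show "num_perfect_matchings {..<n} (edges_of es) = k" using pmc pmc_simple[OF simple] by simp
qed

lemma triangulation_check_correct:
  assumes "triangulation_check n es cs k z w A B"
  shows "triangulation_state {..<n} (edges_of es) k z w A B"
proof -
  have gc: "graph_check n es cs [[z, w, A], [z, w, B]] k"
    using assms unfolding triangulation_check_def by (rule conjunct1)
  note g = graph_check_correct[OF gc]
  have D: "edges_of [(z, w)] = {{z, w}}" by (simp add: edges_of_def)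
  have count: "pmc ({..<n} - set S) (edges_of es - {{z, w}}) = count_without n es [(z, w)] S" for S
    using count_without_correct[OF g(1), of S "[(z, w)]"] unfolding D .
  have slot: "path_slot {..<n} (edges_of es) z w A B"
    unfolding path_slot_def
    using assms count[of "[z, A]"] count[of "[z, B]"] count[of "[w, A]"] count[of "[w, B]"] count[of "[A, B]"]
      count[of "[z, w, A, B]"]
    by (simp add: triangulation_check_def has_edge_iff)
  have card: "card (edges_of es) + 6 = 3 * card {..<n}"
  proof -
    have "length es + 6 = 3 * n" using assms unfolding triangulation_check_def by (elim conjE)
    then show ?thesis by (simp only: card_edges_of[OF g(1)] card_lessThan)
  qed
  have tri: "{z, w, A} \<in> edges_of es \<union> set ` set [[z, w, A], [z, w, B]]"
    "{z, w, B} \<in> edges_of es \<union> set ` set [[z, w, A], [z, w, B]]" by simp_all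
  show ?thesis unfolding triangulation_state_def
    by (intro conjI exI) (rule g(2,3) slot g(4) tri g(6) card)+
qed

lemma ladder_check_correct:
  assumes "ladder_check n es cs a b c d P Q"
  shows "ladder_state {..<n} (edges_of es) a b c d P Q"
proof -
  have gc: "graph_check n es cs [[a, b, c], [b, c, d]] Q"
    using assms unfolding ladder_check_def by (rule conjunct1)
  note g = graph_check_correct[OF gc]
  have D: "edges_of [(a, b), (c, d)] = {{a, b}, {c, d}}" by (simp add: edges_of_def)
  have count: "pmc ({..<n} - set S) (edges_of es - {{a, b}, {c, d}}) = count_without n es [(a, b), (c, d)] S" for S
    using count_without_correct[OF g(1), of S "[(a, b), (c, d)]"] unfolding D .
  have slot: "rung_slot {..<n} (edges_of es) a b c d P Q"
    unfolding rung_slot_def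
    using assms count[of "[]"] count[of "[a, c]"] count[of "[b, d]"] count[of "[a, b, c, d]"]
      count[of "[a, d]"] count[of "[b, c]"] count[of "[a, b]"] count[of "[c, d]"]
    by (simp add: ladder_check_def has_edge_iff)
  have bc: "{b, c} \<notin> edges_of es" using assms by (simp add: ladder_check_def has_edge_iff)
  have tri: "{a, b, c} \<in> edges_of es \<union> set ` set [[a, b, c], [b, c, d]]"
    "{b, c, d} \<in> edges_of es \<union> set ` set [[a, b, c], [b, c, d]]" by simp_all
  show ?thesis unfolding ladder_state_def
    by (intro conjI exI) (rule g(2,3) slot bc g(4) tri)+
qed

lemma colouring_check_correct:
  assumes "colouring_check es a b c d X"
  shows "ladder_colouring (edges_of es) a b c d True"
  unfolding ladder_colouring_def
proof (intro exI[of _ "\<lambda>v. v \<in> set X"] conjI allI impI)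
  fix u v assume "{u, v} \<in> edges_of es - {{a, b}, {c, d}}"
  then have "(u, v) \<in> set es \<or> (v, u) \<in> set es" by (simp add: edges_of_iff)
  then show "(u \<in> set X) \<noteq> (v \<in> set X)" using assms by (auto simp: colouring_check_def list_all_iff)
qed (use assms in \<open>auto simp: colouring_check_def\<close>)

lemma card_vdegree_edges_of:
  "ordered_pairs n es \<Longrightarrow> card {v \<in> {..<n}. vdegree (edges_of es) v = k} = length (filter (\<lambda>v. degree_in es v = k) [0..<n])"
  by (simp only: vdegree_edges_of card_filter_upt)

text \<open>Old degrees never drop and each new vertex starts with degree four, so the lower bound
  four persists and is attained by the latest insertion.\<close>

lemma triangulation_family:
  assumes "triangulation_state V E k z w A B"
  shows "\<exists>V' E' z' w'. triangulation_state V' E' k z' w' A B \<and> card V' = card V + 2 * j \<and>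
    ((\<forall>v\<in>V. 4 \<le> vdegree E v) \<and> (\<exists>v\<in>V. vdegree E v = 4) \<longrightarrow>
     (\<forall>v\<in>V'. 4 \<le> vdegree E' v) \<and> (\<exists>v\<in>V'. vdegree E' v = 4))"
proof (induction j)
  case 0
  then show ?case using assms by (intro exI[of _ V] exI[of _ E] exI[of _ z] exI[of _ w]) simp
next
  case (Suc j)
  then obtain V1 E1 z1 w1 where 1: "triangulation_state V1 E1 k z1 w1 A B" "card V1 = card V + 2 * j"
    "(\<forall>v\<in>V. 4 \<le> vdegree E v) \<and> (\<exists>v\<in>V. vdegree E v = 4) \<longrightarrow> (\<forall>v\<in>V1. 4 \<le> vdegree E1 v)" by blast
  obtain V2 E2 x y where 2: "triangulation_state V2 E2 k x y A B" "card V2 = card V1 + 2" "V2 = V1 \<union> {x, y}"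
    "\<And>v. v \<in> V1 \<Longrightarrow> vdegree E1 v \<le> vdegree E2 v" "vdegree E2 x = 4" "vdegree E2 y = 4"
    by (rule triangulation_state_step[OF 1(1)]) (rule that)
  have "4 \<le> vdegree E2 v" if "\<forall>v\<in>V1. 4 \<le> vdegree E1 v" "v \<in> V2" for v
    using that 2(3,5,6) order_trans[OF _ 2(4)[of v]] by auto
  then show ?case using 1 2 by (intro exI[of _ V2] exI[of _ E2] exI[of _ x] exI[of _ y]) auto
qed

lemma triangulation_state_correct:
  assumes "triangulation_state V E k z w A B"
  shows "simple_graph V E" "planar_graph V E" "k_connected 3 V E" "num_perfect_matchings V E = k"
    "planar_triangulation V E"
proof -
  obtain p F where st: "simple_graph V E" "k_connected 3 V E" "complex_drawing V E p F" "pmc V E = k"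
    "card E + 6 = 3 * card V"
    using assms unfolding triangulation_state_def by blast
  show "simple_graph V E" "k_connected 3 V E" by (fact st)+
  show pl: "planar_graph V E" by (rule planar_graph_complex_drawing[OF st(1,3)])
  show "num_perfect_matchings V E = k" using st(4) pmc_simple[OF st(1)] by simp
  show "planar_triangulation V E" by (rule planar_triangulation_of_card_edges[OF st(1,2) pl st(5)])
qed

lemma ladder_state_correct:
  assumes "ladder_state V E a b c d P Q"
  shows "simple_graph V E" "planar_graph V E" "k_connected 3 V E" "num_perfect_matchings V E = Q"
proof -
  obtain p F where st: "simple_graph V E" "k_connected 3 V E" "complex_drawing V E p F" "rung_slot V E a b c d P Q"
    using assms unfolding ladder_state_def by blast
  show "simple_graph V E" "k_connected 3 V E" by (fact st)+
  show "planar_graph V E" by (rule planar_graph_complex_drawing[OF st(1,3)])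
  show "num_perfect_matchings V E = Q" using pmc_rung_slot[OF st(1,4)] pmc_simple[OF st(1)] by simp
qed

text \<open>The slot moves at the ends \<open>a\<close> and \<open>c\<close> only. The parity of
  \<open>j\<close> decides which of \<open>P\<close> and \<open>Q\<close> counts the matchings and
  whether the colouring is proper.\<close>

lemma ladder_family:
  assumes "ladder_state V E a b c d P Q"
  shows "\<exists>V' E' a' c'. ladder_state V' E' a' b c' d (if even j then P else Q) (if even j then Q else P) \<and>
    card V' = card V + 2 * j \<and>
    (\<forall>k. k \<noteq> 3 \<longrightarrow> card {v \<in> V'. vdegree E' v = k} = card {v \<in> V. vdegree E v = k}) \<and>
    card {v \<in> V'. vdegree E' v = 3} = card {v \<in> V. vdegree E v = 3} + 2 * j \<and>
    (ladder_colouring E a b c d True \<longrightarrow> ladder_colouring E' a' b c' d (even j))"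
proof (induction j)
  case 0
  then show ?case using assms by (intro exI[of _ V] exI[of _ E] exI[of _ a] exI[of _ c]) simp
next
  case (Suc j)
  then obtain V1 E1 a1 c1 where 1: "ladder_state V1 E1 a1 b c1 d (if even j then P else Q) (if even j then Q else P)"
    "card V1 = card V + 2 * j"
    "\<And>k. k \<noteq> 3 \<Longrightarrow> card {v \<in> V1. vdegree E1 v = k} = card {v \<in> V. vdegree E v = k}"
    "card {v \<in> V1. vdegree E1 v = 3} = card {v \<in> V. vdegree E v = 3} + 2 * j"
    "ladder_colouring E a b c d True \<Longrightarrow> ladder_colouring E1 a1 b c1 d (even j)" by blast
  obtain V2 E2 x y where 2: "ladder_state V2 E2 x b y d (if even j then Q else P) (if even j then P else Q)"
    "card V2 = card V1 + 2"
    "\<And>k. k \<noteq> 3 \<Longrightarrow> card {v \<in> V2. vdegree E2 v = k} = card {v \<in> V1. vdegree E1 v = k}"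
    "card {v \<in> V2. vdegree E2 v = 3} = card {v \<in> V1. vdegree E1 v = 3} + 2"
    "\<And>ev. ladder_colouring E1 a1 b c1 d ev \<Longrightarrow> ladder_colouring E2 x b y d (\<not> ev)"
    by (rule ladder_state_step[OF 1(1)]) (rule that)
  have "ladder_state V2 E2 x b y d (if even (Suc j) then P else Q) (if even (Suc j) then Q else P)"
    using 2(1) by (cases "even j") simp_all
  moreover have "ladder_colouring E2 x b y d (even (Suc j))" if "ladder_colouring E a b c d True"
    using 2(5)[OF 1(5)[OF that]] by simp
  ultimately show ?case using 1(2-4) 2(2-4)
    by (intro exI[of _ V2] exI[of _ E2] exI[of _ x] exI[of _ y]) auto
qed


lemma even_offset:
  assumes "k \<le> n" "even (n :: nat)" "even k"
  obtains j where "n = k + 2 * j"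
  using assms by (metis dvdE dvd_diff_nat le_add_diff_inverse)

lemma even_ge_step: "k \<le> n \<Longrightarrow> n \<noteq> k \<Longrightarrow> even n \<Longrightarrow> even k \<Longrightarrow> k + 2 \<le> (n :: nat)"
  by presburger

text \<open>Serves all families of prescribed degrees: with \<open>P = k\<close> any number of rungs
  is allowed, otherwise they come in pairs. \<open>X\<close> is a candidate colour class for the
  bipartite case.\<close>

lemma ladder_graphs:
  assumes lc: "ladder_check n0 es cs a b c d P k"
    and deg: "length (filter (\<lambda>v. degree_in es v = q) [0..<n0]) = r" "q \<noteq> 3"
      "length (filter (\<lambda>v. degree_in es v = 3) [0..<n0]) = n0 - r" "r \<le> n0"
    and n: "n = n0 + 2 * j" and P: "even j \<or> P = k"
  shows "\<exists>(V :: nat set) E. simple_graph V E \<and> card V = n \<and>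
        planar_graph V E \<and> k_connected 3 V E \<and> num_perfect_matchings V E = k \<and>
        (colouring_check es a b c d X \<and> even j \<longrightarrow> bipartite_graph V E) \<and>
        card {v \<in> V. vdegree E v = q} = r \<and> card {v \<in> V. vdegree E v = 3} = n - r"
proof -
  have st: "ladder_state {..<n0} (edges_of es) a b c d P k" by (rule ladder_check_correct[OF lc])
  have ord: "ordered_pairs n0 es" using lc by (simp add: ladder_check_def graph_check_def)
  obtain V E a' c' where F: "ladder_state V E a' b c' d (if even j then P else k) (if even j then k else P)" "card V = n"
    "\<And>l. l \<noteq> 3 \<Longrightarrow> card {v \<in> V. vdegree E v = l} = card {v \<in> {..<n0}. vdegree (edges_of es) v = l}"
    "card {v \<in> V. vdegree E v = 3} = card {v \<in> {..<n0}. vdegree (edges_of es) v = 3} + 2 * j"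
    "ladder_colouring (edges_of es) a b c d True \<Longrightarrow> ladder_colouring E a' b c' d (even j)"
    using ladder_family[OF st, of j] n unfolding card_lessThan by blast
  have "(if even j then k else P) = k" using P by auto
  then have "num_perfect_matchings V E = k" using ladder_state_correct(4)[OF F(1)] by simp
  moreover have "bipartite_graph V E" if "colouring_check es a b c d X \<and> even j"
    using bipartite_ladder[OF ladder_state_correct(1)[OF F(1)], of a' b c' d] F(5) colouring_check_correct[of es a b c d X] that by simp
  moreover have "card {v \<in> V. vdegree E v = q} = r" "card {v \<in> V. vdegree E v = 3} = n - r"
    using F(3)[OF deg(2)] F(4) deg n unfolding card_vdegree_edges_of[OF ord] by simp_all
  ultimately show ?thesis
    using ladder_state_correct(1-3)[OF F(1)] F(2) by (intro exI[of _ V] exI[of _ E] conjI) simp_all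
qed

lemma sporadic_graph:
  assumes "graph_check n es cs [] k" "length (filter (\<lambda>v. degree_in es v = q) [0..<n]) = r"
    "length (filter (\<lambda>v. degree_in es v = 3) [0..<n]) = n - r"
  shows "\<exists>(V :: nat set) E. simple_graph V E \<and> card V = n \<and>
        planar_graph V E \<and> k_connected 3 V E \<and> num_perfect_matchings V E = k \<and>
        card {v \<in> V. vdegree E v = q} = r \<and> card {v \<in> V. vdegree E v = 3} = n - r"
  using graph_check_correct[OF assms(1)] assms(2,3) card_vdegree_edges_of[OF graph_check_correct(1)[OF assms(1)]]
  by (intro exI[of _ "{..<n}"] exI[of _ "edges_of es"]) simp

lemma triangulations:
  assumes "triangulation_check n0 es cs k z w A B" and j: "n = n0 + 2 * j"
  shows "\<exists>(V :: nat set) E. simple_graph V E \<and> card V = n \<and>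
        planar_graph V E \<and> k_connected 3 V E \<and> num_perfect_matchings V E = k \<and> planar_triangulation V E \<and>
        (list_all (\<lambda>v. 4 \<le> degree_in es v) [0..<n0] \<and> list_ex (\<lambda>v. degree_in es v = 4) [0..<n0] \<longrightarrow> min_degree V E = 4)"
proof -
  have st: "triangulation_state {..<n0} (edges_of es) k z w A B" by (rule triangulation_check_correct[OF assms(1)])
  have ord: "ordered_pairs n0 es" using assms(1) by (simp add: triangulation_check_def graph_check_def)
  obtain V E z' w' where F: "triangulation_state V E k z' w' A B" "card V = n"
    "(\<forall>v\<in>{..<n0}. 4 \<le> vdegree (edges_of es) v) \<and> (\<exists>v\<in>{..<n0}. vdegree (edges_of es) v = 4) \<longrightarrow>
     (\<forall>v\<in>V. 4 \<le> vdegree E v) \<and> (\<exists>v\<in>V. vdegree E v = 4)"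
    using triangulation_family[OF st, of j] j unfolding card_lessThan by blast
  have fin: "finite V" using triangulation_state_correct(1)[OF F(1)] by (simp add: simple_graph_def)
  have min: "min_degree V E = 4" if deg: "list_all (\<lambda>v. 4 \<le> degree_in es v) [0..<n0]" "list_ex (\<lambda>v. degree_in es v = 4) [0..<n0]"
  proof -
    have "\<forall>v\<in>{..<n0}. 4 \<le> vdegree (edges_of es) v" "\<exists>v\<in>{..<n0}. vdegree (edges_of es) v = 4"
      using deg by (auto simp: vdegree_edges_of[OF ord] list_all_iff list_ex_iff)
    then have le: "\<forall>v\<in>V. 4 \<le> vdegree E v" and ex: "\<exists>v\<in>V. vdegree E v = 4" using F(3) by blast+
    show ?thesis
      unfolding min_degree_def
    proof (rule Min_eqI)
      show "finite (vdegree E ` V)" using fin by simp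
      show "4 \<le> d" if "d \<in> vdegree E ` V" for d using le that by blast
      show "4 \<in> vdegree E ` V" using ex by (metis imageI)
    qed
  qed
  show ?thesis using min triangulation_state_correct[OF F(1)] F(2) by (intro exI[of _ V] exI[of _ E]) simp
qed

text \<open>The names refer to the parts of the theorem and the numbers of vertices. With the notation of the
  introduction, one takes the bipartite graph on ten vertices together with
  \<^item> the edges \<open>uA, Bj\<close> for \<open>i_10\<close>; new vertices \<open>a, o\<close> and the edges \<open>au, aA, ao, uo, Bo\<close> for \<open>i_12\<close>;
  \<^item> all edges of the triangulation on \<open>A, B, u, i, j\<close> for \<open>iii_10\<close>; in addition a vertex \<open>v\<close> adjacent to
    \<open>A, B, u\<close> and one adjacent to \<open>A, B, v\<close> for \<open>iii_12\<close>; all vertices of degree three replaced by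
    triangles for \<open>v_24\<close>;
  \<^item> a vertex \<open>a\<close> adjacent to \<open>u, A\<close>, and two copies joined by edges at \<open>a, u, B\<close> for \<open>iv_22\<close>; a further
    rung between two of these edges and a rotated second copy for \<open>iv_24\<close>.
  The graphs \<open>i_14\<close> and \<open>ii_16\<close> arise from \<open>i_12\<close> and \<open>ii_14\<close> by replacing a vertex by a triangle; \<open>ii_14\<close>
  was found by a computer search.\<close>

definition edges_i_10 :: "(nat \<times> nat) list" where
  "edges_i_10 = [(0,2),(0,6),(0,7),(1,2),(1,6),(1,9),(2,3),(2,7),(3,7),(3,9),(4,6),(4,8),(4,9),(5,7),(5,8),(5,9),
    (6,8)]"

definition coords_i_10 :: "(int \<times> int) list" where
  "coords_i_10 = [(10,0),(3,2),(5,2),(3,3),(1,2),(2,5),(0,0),(4,4),(1,4),(2,3)]"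

lemma check_i_10: "graph_check 10 edges_i_10 coords_i_10 [] 12"
  by code_simp

lemma degrees_i_10: "length (filter (\<lambda>v. degree_in edges_i_10 v = 4) [0..<10]) = 4"
  "length (filter (\<lambda>v. degree_in edges_i_10 v = 3) [0..<10]) = 6"
  by code_simp+

definition edges_i_12 :: "(nat \<times> nat) list" where
  "edges_i_12 = [(0,1),(0,8),(0,9),(1,2),(1,3),(2,8),(2,11),(3,9),(3,11),(4,8),(4,10),(4,11),(5,9),(5,10),(5,11),
    (6,7),(6,8),(6,10),(7,9),(7,10)]"

definition coords_i_12 :: "(int \<times> int) list" where
  "coords_i_12 = [(8,4),(5,6),(5,5),(0,13),(6,3),(4,1),(8,2),(11,1),(7,4),(13,0),(7,2),(4,4)]"

lemma check_i_12: "graph_check 12 edges_i_12 coords_i_12 [] 12"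
  by code_simp

lemma degrees_i_12: "length (filter (\<lambda>v. degree_in edges_i_12 v = 4) [0..<12]) = 4"
  "length (filter (\<lambda>v. degree_in edges_i_12 v = 3) [0..<12]) = 8"
  by code_simp+

definition edges_i_14 :: "(nat \<times> nat) list" where
  "edges_i_14 = [(0,1),(0,9),(0,13),(1,2),(1,3),(2,11),(2,13),(3,9),(3,11),(4,7),(4,9),(4,12),(5,9),(5,12),(5,13),
    (6,7),(6,8),(6,11),(7,8),(8,12),(10,11),(10,12),(10,13)]"

definition coords_i_14 :: "(int \<times> int) list" where
  "coords_i_14 = [(9,6),(14,3),(6,11),(18,0),(3,4),(6,6),(1,6),(2,4),(2,6),(8,3),(2,12),(0,18),(3,7),(5,9)]"

text \<open>The slot edges leave the triangle 6, 7, 8 at 7 and 8. Both matching numbers are 12, so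
  any number of rungs is allowed.\<close>

lemma check_i_14: "ladder_check 14 edges_i_14 coords_i_14 7 4 8 12 12 12"
  by code_simp

lemma degrees_i_14: "length (filter (\<lambda>v. degree_in edges_i_14 v = 4) [0..<14]) = 4"
  "length (filter (\<lambda>v. degree_in edges_i_14 v = 3) [0..<14]) = 10"
  by code_simp+

definition edges_ii_14 :: "(nat \<times> nat) list" where
  "edges_ii_14 = [(0,1),(0,12),(0,13),(1,2),(1,3),(2,4),(2,13),(3,4),(3,12),(4,5),(5,6),(5,13),(6,10),(6,12),(7,8),
    (7,12),(7,13),(8,9),(8,11),(9,10),(9,13),(10,11),(11,12)]"

definition coords_ii_14 :: "(int \<times> int) list" where
  "coords_ii_14 = [(3,14),(3,12),(4,10),(2,10),(3,7),(7,6),(20,0),(4,14),(5,13),(7,10),(10,9),(6,13),(0,20),(5,11)]"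

lemma check_ii_14: "graph_check 14 edges_ii_14 coords_ii_14 [] 18"
  by code_simp

lemma degrees_ii_14: "length (filter (\<lambda>v. degree_in edges_ii_14 v = 5) [0..<14]) = 2"
  "length (filter (\<lambda>v. degree_in edges_ii_14 v = 3) [0..<14]) = 12"
  by code_simp+

definition edges_ii_16 :: "(nat \<times> nat) list" where
  "edges_ii_16 = [(0,1),(0,3),(0,14),(1,2),(1,12),(2,3),(2,13),(3,4),(4,13),(4,14),(5,9),(5,11),(5,13),(6,8),(6,13),
    (6,14),(7,8),(7,9),(7,14),(8,10),(9,10),(10,13),(11,12),(11,15),(12,15),(14,15)]"

definition coords_ii_16 :: "(int \<times> int) list" where
  "coords_ii_16 = [(6,3),(9,4),(8,5),(6,4),(5,4),(14,6),(4,9),(0,32),(4,16),(11,13),(7,13),(18,3),(13,3),(7,7),(0,0),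
    (14,2)]"

text \<open>The slot edges leave the triangle 11, 12, 15 at 11 and 12, and again both matching
  numbers agree.\<close>

lemma check_ii_16: "ladder_check 16 edges_ii_16 coords_ii_16 11 5 12 1 18 18"
  by code_simp

lemma degrees_ii_16: "length (filter (\<lambda>v. degree_in edges_ii_16 v = 5) [0..<16]) = 2"
  "length (filter (\<lambda>v. degree_in edges_ii_16 v = 3) [0..<16]) = 14"
  by code_simp+

definition edges_iii_10 :: "(nat \<times> nat) list" where
  "edges_iii_10 = [(0,6),(0,8),(0,9),(1,6),(1,7),(1,8),(2,6),(2,7),(2,9),(3,5),(3,7),(3,9),(4,5),(4,8),(4,9),(5,7),
    (5,8),(5,9),(6,7),(6,8),(6,9),(7,8),(7,9),(8,9)]"

definition coords_iii_10 :: "(int \<times> int) list" where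
  "coords_iii_10 = [(4,3),(1,5),(3,8),(6,8),(11,1),(16,0),(3,6),(0,16),(0,0),(7,3)]"

lemma check_iii_10: "graph_check 10 edges_iii_10 coords_iii_10 [] 12"
  by code_simp

lemma size_iii_10: "length edges_iii_10 + 6 = 3 * 10"
  by code_simp

definition edges_iii_12 :: "(nat \<times> nat) list" where
  "edges_iii_12 = [(0,3),(0,10),(0,11),(1,3),(1,9),(1,10),(2,3),(2,9),(2,11),(3,9),(3,10),(3,11),(4,8),(4,9),(4,10),
    (5,8),(5,9),(5,11),(6,7),(6,10),(6,11),(7,8),(7,10),(7,11),(8,9),(8,10),(8,11),(9,10),(9,11),
    (10,11)]"

definition coords_iii_12 :: "(int \<times> int) list" where
  "coords_iii_12 = [(14,17),(0,0),(7,22),(0,32),(24,4),(17,11),(23,8),(24,7),(21,8),(13,9),(32,0),(12,18)]"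

text \<open>The slot edge is \<open>uv\<close>, with 8 as \<open>u\<close> and 7 as
  \<open>v\<close>. The vertices 3, 7, 8, 9, 10, 11 form the barrier, the other six being pairwise
  nonadjacent; with barrier vertices removed these six lack partners, which explains the
  zeros.\<close>

lemma check_iii_12: "triangulation_check 12 edges_iii_12 coords_iii_12 12 8 7 10 11"
  by code_simp

definition edges_iv_22 :: "(nat \<times> nat) list" where
  "edges_iv_22 = [(0,9),(0,15),(0,17),(1,2),(1,3),(1,4),(2,15),(2,16),(3,15),(3,18),(4,16),(4,18),(5,15),(5,17),
    (5,18),(6,16),(6,17),(6,18),(7,9),(7,13),(7,14),(7,17),(8,10),(8,19),(8,20),(9,19),(10,11),
    (10,12),(11,19),(11,21),(12,20),(12,21),(13,19),(13,21),(14,20),(14,21),(16,20)]"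

definition coords_iv_22 :: "(int \<times> int) list" where
  "coords_iv_22 = [(12,12),(7,6),(6,7),(9,7),(6,4),(12,8),(15,4),(18,14),(6,26),(13,15),(7,27),(9,24),(7,29),(13,20),
    (15,21),(10,9),(0,0),(17,9),(10,6),(10,21),(0,40),(11,24)]"

text \<open>In each copy the colour class of \<open>a\<close> has six vertices and the other five,
  so \<open>a\<close> alone is matched outwards: the edge from 0 to 9 is forced and 12 * 12 choices
  remain. \<open>P\<close> is 0, as it counts matchings for which one copy has lost a vertex of its
  smaller class.\<close>

lemma check_iv_22: "ladder_check 22 edges_iv_22 coords_iv_22 0 9 17 7 0 144"
  by code_simp

lemma degrees_iv_22: "length (filter (\<lambda>v. degree_in edges_iv_22 v = 4) [0..<22]) = 8"
  "length (filter (\<lambda>v. degree_in edges_iv_22 v = 3) [0..<22]) = 14"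
  by code_simp+

definition class_iv_22 :: "nat list" where
  "class_iv_22 = [0,2,3,4,5,6,7,10,19,20,21]"

lemma colouring_iv_22: "colouring_check edges_iv_22 0 9 17 7 class_iv_22"
  by code_simp

definition edges_iv_24 :: "(nat \<times> nat) list" where
  "edges_iv_24 = [(0,3),(0,4),(0,5),(1,2),(1,8),(1,20),(2,13),(2,17),(3,15),(3,18),(4,16),(4,18),(5,15),(5,16),
    (6,15),(6,17),(6,18),(7,16),(7,17),(7,18),(8,15),(8,17),(9,14),(9,19),(9,20),(10,14),(10,20),
    (10,22),(11,14),(11,19),(11,22),(12,20),(12,21),(12,22),(13,19),(13,21),(16,21),(19,23),(21,23),
    (22,23)]"

definition coords_iv_24 :: "(int \<times> int) list" where
  "coords_iv_24 = [(15,12),(26,29),(37,26),(19,13),(13,8),(13,14),(26,15),(30,8),(26,23),(20,48),(18,49),(17,52),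
    (13,53),(28,44),(18,50),(20,18),(0,0),(36,16),(21,11),(18,52),(21,42),(0,80),(15,54),(12,60)]"

text \<open>The second copy is turned so that the vertices \<open>a\<close> of the two copies, 8 and
  13, lie on different rails; this makes the graph bipartite despite the rung from 1 to 2. The edges
  from 8 to 1 and from 13 to 2 are forced.\<close>

lemma check_iv_24: "ladder_check 24 edges_iv_24 coords_iv_24 1 20 2 13 0 144"
  by code_simp

lemma degrees_iv_24: "length (filter (\<lambda>v. degree_in edges_iv_24 v = 4) [0..<24]) = 8"
  "length (filter (\<lambda>v. degree_in edges_iv_24 v = 3) [0..<24]) = 16"
  by code_simp+

definition class_iv_24 :: "nat list" where
  "class_iv_24 = [0,1,9,10,11,12,13,15,16,17,18,23]"

lemma colouring_iv_24: "colouring_check edges_iv_24 1 20 2 13 class_iv_24"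
  by code_simp

definition edges_v_24 :: "(nat \<times> nat) list" where
  "edges_v_24 = [(0,1),(0,2),(0,22),(0,23),(1,2),(1,9),(1,23),(2,9),(2,22),(3,4),(3,5),(3,21),(3,22),(4,5),(4,9),
    (4,21),(5,9),(5,22),(6,7),(6,8),(6,21),(6,23),(7,8),(7,9),(7,21),(8,9),(8,23),(9,21),(9,22),
    (9,23),(10,11),(10,12),(10,20),(10,22),(11,12),(11,20),(11,21),(12,21),(12,22),(13,14),(13,15),
    (13,20),(13,23),(14,15),(14,20),(14,21),(15,21),(15,23),(16,17),(16,18),(16,22),(16,23),(17,18),
    (17,19),(17,23),(18,19),(18,22),(19,20),(19,22),(19,23),(20,21),(20,22),(20,23),(21,22),(21,23),
    (22,23)]"

definition coords_v_24 :: "(int \<times> int) list" where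
  "coords_v_24 = [(73,14),(77,13),(76,12),(86,8),(91,8),(83,9),(98,9),(104,7),(87,12),(83,11),(62,6),(86,3),(83,5),
    (29,43),(0,126),(38,59),(61,16),(58,15),(51,12),(44,11),(0,0),(126,0),(67,10),(68,20)]"

text \<open>Without 9, 19, 20, 21, 22, 23 exactly the six triangles remain as components. Being odd,
  each sends exactly one matching edge to these six vertices.\<close>

lemma check_v_24: "triangulation_check 24 edges_v_24 coords_v_24 768 20 19 22 23"
  by code_simp

lemma degrees_v_24: "list_all (\<lambda>v. 4 \<le> degree_in edges_v_24 v) [0..<24]"
  "list_ex (\<lambda>v. degree_in edges_v_24 v = 4) [0..<24]"
  by code_simp+

theorem theorem2:
  "(\<forall>n\<ge>10. even n \<longrightarrow> (\<exists>(V :: nat set) E. simple_graph V E \<and> card V = n \<and>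
        planar_graph V E \<and> k_connected 3 V E \<and> num_perfect_matchings V E = 12 \<and>
        card {v \<in> V. vdegree E v = 4} = 4 \<and>
        card {v \<in> V. vdegree E v = 3} = n - 4)) \<and>
   (\<forall>n\<ge>14. even n \<longrightarrow> (\<exists>(V :: nat set) E. simple_graph V E \<and> card V = n \<and>
        planar_graph V E \<and> k_connected 3 V E \<and> num_perfect_matchings V E = 18 \<and>
        card {v \<in> V. vdegree E v = 5} = 2 \<and>
        card {v \<in> V. vdegree E v = 3} = n - 2)) \<and>
   (\<forall>n\<ge>10. even n \<longrightarrow> (\<exists>(V :: nat set) E. simple_graph V E \<and> card V = n \<and>
        planar_graph V E \<and> k_connected 3 V E \<and> num_perfect_matchings V E = 12 \<and>
        planar_triangulation V E)) \<and>
   (\<forall>n\<ge>22. even n \<longrightarrow> (\<exists>(V :: nat set) E. simple_graph V E \<and> card V = n \<and>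
        planar_graph V E \<and> k_connected 3 V E \<and> num_perfect_matchings V E = 144 \<and>
        bipartite_graph V E \<and>
        card {v \<in> V. vdegree E v = 4} = 8 \<and>
        card {v \<in> V. vdegree E v = 3} = n - 8)) \<and>
   (\<forall>n\<ge>24. even n \<longrightarrow> (\<exists>(V :: nat set) E. simple_graph V E \<and> card V = n \<and>
        planar_graph V E \<and> k_connected 3 V E \<and> num_perfect_matchings V E = 768 \<and>
        planar_triangulation V E \<and>
        min_degree V E = 4))"
proof (intro conjI allI impI, goal_cases)
  case (1 n)
  \<comment> \<open>The ladder used here starts at 14 vertices, so 10 and 12 are covered by single
    graphs.\<close>
  consider "n = 10" | "n = 12" | "14 \<le> n"
    using even_ge_step[OF 1(1) _ 1(2)] even_ge_step[of 12 n] 1(2) by fastforce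
  then show ?case
  proof cases
    assume n: "n = 10"
    show ?thesis unfolding n by (rule sporadic_graph[OF check_i_10]) (simp_all add: degrees_i_10)
  next
    assume n: "n = 12"
    show ?thesis unfolding n by (rule sporadic_graph[OF check_i_12]) (simp_all add: degrees_i_12)
  next
    assume "14 \<le> n"
    then obtain j where "n = 14 + 2 * j" using 1(2) by (rule even_offset) simp
    from ladder_graphs[OF check_i_14 degrees_i_14(1) _ _ _ this, of Nil] show ?thesis by (simp add: degrees_i_14) blast
  qed
next
  case (2 n)
  show ?case
  proof (cases "n = 14")
    case True
    show ?thesis unfolding True by (rule sporadic_graph[OF check_ii_14]) (simp_all add: degrees_ii_14)
  next
    case False
    have "16 \<le> n" using even_ge_step[OF 2(1) False 2(2)] by simp
    then obtain j where "n = 16 + 2 * j" using 2(2) by (rule even_offset) simp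
    from ladder_graphs[OF check_ii_16 degrees_ii_16(1) _ _ _ this, of Nil] show ?thesis by (simp add: degrees_ii_16) blast
  qed
next
  case (3 n)
  show ?case
  proof (cases "n = 10")
    case True
    note g = graph_check_correct[OF check_iii_10]
    have "card (edges_of edges_iii_10) + 6 = 3 * card {..<10::nat}"
      using card_edges_of[OF g(1)] size_iii_10 by simp
    then have "planar_triangulation {..<10} (edges_of edges_iii_10)"
      by (rule planar_triangulation_of_card_edges[OF g(2,3,5)])
    then show ?thesis using g True by (intro exI[of _ "{..<10}"] exI[of _ "edges_of edges_iii_10"]) simp
  next
    case False
    have n: "12 \<le> n" using even_ge_step[OF 3(1) False 3(2)] by simp
    then obtain j where "n = 12 + 2 * j" using 3(2) by (rule even_offset) simp
    from triangulations[OF check_iii_12 this] show ?thesis by blast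
  qed
next
  case (4 n)
  then obtain j where j: "n = 22 + 2 * j" by (rule even_offset) simp
  show ?case
  \<comment> \<open>An odd number of rungs leaves no perfect matching, so one initial graph reaches
    only every other even \<open>n\<close>; the graphs on 22 and 24 vertices share the two residue
    classes modulo four.\<close>
  proof (cases "even j")
    case True
    from ladder_graphs[OF check_iv_22 degrees_iv_22(1) _ _ _ j, of class_iv_22] colouring_iv_22 True
    show ?thesis by (simp add: degrees_iv_22)
  next
    case False
    then have "n = 24 + 2 * (j - 1)" "even (j - 1)" using j by (cases j; simp)+
    from ladder_graphs[OF check_iv_24 degrees_iv_24(1) _ _ _ this(1), of class_iv_24] colouring_iv_24 this(2)
    show ?thesis by (simp add: degrees_iv_24)
  qed
next
  case (5 n)
  then obtain j where "n = 24 + 2 * j" by (rule even_offset) simp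
  from triangulations[OF check_v_24 this] degrees_v_24 show ?case by blast
qed

end
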